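(* Let $t_0\in\mathbb{T}$ and let $\alpha,\beta$ be complex numbers with $0<\operatorname{Re}\alpha<1/2$ and $-1/2<\operatorname{Re}\beta\le 1/2$. Let $a=\sigma b$, where $$\sigma(t)=|t-t_0|^{-2\alpha}\varphi_{\beta,t_0}(t)\qquad(t\in\mathbb{T})$$ and $b$ is a function in $L^\infty(\mathbb{T})$ that is continuous at $t_0$ and does not vanish at $t_0$. Then $$\|T_n(a)\|\sim\|K\|\,|b(t_0)|\,n^{2\operatorname{Re}\alpha}\qquad\text{as } n\to\infty,$$ where $K$ is the integral operator on $L^2(0,1)$ with kernel $$k(x,y)=\begin{cases} C_{\alpha,\beta}^{+}(x-y)^{2\alpha-1} & \text{for } x>y,\\ C_{\alpha,\beta}^{-}(y-x)^{2\alpha-1} & \text{for } x<y,\end{cases}\qquad C_{\alpha,\beta}^{\pm}=\Gamma(1-2\alpha)\,\frac{\sin\pi(\alpha\mp\beta)}{\pi}.$$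
   Context: $\mathbb{T}$ is the complex unit circle. $\varphi_{\beta,t_0}(t)=\exp\bigl(i\beta\arg(-t/t_0)\bigr)$ for $t\in\mathbb{T}$, with $\arg z\in(-\pi,\pi]$. For $a\in L^1(\mathbb{T})$, $T_n(a)=(a_{j-k})_{j,k=0}^{n-1}$ is the $n\times n$ Toeplitz matrix formed from the Fourier coefficients $a_k=\frac{1}{2\pi}\int_{-\pi}^{\pi}a(e^{i\theta})e^{-ik\theta}\,d\theta$. $\|T_n(a)\|$ is the spectral norm (operator norm on $\mathbb{C}^n$ with the Euclidean norm), and $\|K\|$ is the operator norm on $L^2(0,1)$. The notation $x_n\sim y_n$ means $x_n/y_n\to1$. For real $u>0$ and complex $\gamma$, $u^\gamma=\exp(\gamma\log u)$. *)

theory Defs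
  imports "HOL-Analysis.Analysis" "Jordan_Normal_Form.Matrix"
begin

hide_const (open) Finite_Cartesian_Product.vec
hide_type (open) Finite_Cartesian_Product.vec
no_notation Finite_Cartesian_Product.vec_nth (infixl "$" 90)

text \<open>
  The unit circle is \<^term>\<open>sphere (0::complex) 1\<close>. Functions on it are represented by total
  functions on \<^typ>\<open>complex\<close>, whose values elsewhere are never used, and measure-theoretic
  notions refer to the parametrisation \<^const>\<open>cis\<close> on \<open>[-\<pi>, \<pi>]\<close> with Lebesgue measure.
\<close>

definition phi :: "complex \<Rightarrow> complex \<Rightarrow> complex \<Rightarrow> complex" where
  "phi \<beta> t0 t = exp (\<i> * \<beta> * complex_of_real (Arg (- t / t0)))"

text \<open>
  At \<open>t = t0\<close> the power is singular; there \<open>0 powr z = 0\<close> only affects a null set.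
\<close>

definition symbol_sigma :: "complex \<Rightarrow> complex \<Rightarrow> complex \<Rightarrow> complex \<Rightarrow> complex" where
  "symbol_sigma \<alpha> \<beta> t0 t = complex_of_real (cmod (t - t0)) powr (- 2 * \<alpha>) * phi \<beta> t0 t"

definition Linfinity_circle :: "(complex \<Rightarrow> complex) \<Rightarrow> bool" where
  "Linfinity_circle b \<longleftrightarrow>
     (\<lambda>\<theta>. b (cis \<theta>)) \<in> borel_measurable (lebesgue_on {-pi..pi}) \<and>
     (\<exists>C. AE \<theta> in lebesgue_on {-pi..pi}. cmod (b (cis \<theta>)) \<le> C)"

definition fourier_coeff :: "(complex \<Rightarrow> complex) \<Rightarrow> int \<Rightarrow> complex" where
  "fourier_coeff a k =
     1 / (2 * complex_of_real pi) *
       (LINT \<theta>|lebesgue_on {-pi..pi}. a (cis \<theta>) * exp (- \<i> * of_int k * complex_of_real \<theta>))"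

definition toeplitz :: "nat \<Rightarrow> (complex \<Rightarrow> complex) \<Rightarrow> complex mat" where
  "toeplitz n a = mat n n (\<lambda>(j, k). fourier_coeff a (int j - int k))"

definition euclidean_norm :: "complex vec \<Rightarrow> real" where
  "euclidean_norm v = L2_set (\<lambda>i. cmod (v $ i)) {..<dim_vec v}"

definition spectral_norm :: "complex mat \<Rightarrow> real" where
  "spectral_norm A =
     Inf {C. 0 \<le> C \<and>
       (\<forall>v \<in> carrier_vec (dim_col A). euclidean_norm (A *\<^sub>v v) \<le> C * euclidean_norm v)}"

text \<open>
  \<open>L\<^sup>2(0,1)\<close> is represented by square-integrable functions rather than by equivalence classes;
  accordingly \<open>L2_norm\<close> is a seminorm.
\<close>

definition L2_space :: "(real \<Rightarrow> complex) set" where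
  "L2_space = {f \<in> borel_measurable (lebesgue_on {0<..<1}).
     integrable (lebesgue_on {0<..<1}) (\<lambda>x. (cmod (f x))\<^sup>2)}"

definition L2_norm :: "(real \<Rightarrow> complex) \<Rightarrow> real" where
  "L2_norm f = sqrt (LINT x|lebesgue_on {0<..<1}. (cmod (f x))\<^sup>2)"

definition integral_operator ::
    "(real \<Rightarrow> real \<Rightarrow> complex) \<Rightarrow> (real \<Rightarrow> complex) \<Rightarrow> (real \<Rightarrow> complex)" where
  "integral_operator k f x = (LINT y|lebesgue_on {0<..<1}. k x y * f y)"

text \<open>
  Membership of \<open>K f\<close> in \<^const>\<open>L2_space\<close> is part of the condition on \<open>C\<close>, because
  \<^const>\<open>L2_norm\<close> is \<open>0\<close> on functions that are not square-integrable.
\<close>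

definition L2_operator_norm :: "((real \<Rightarrow> complex) \<Rightarrow> (real \<Rightarrow> complex)) \<Rightarrow> real" where
  "L2_operator_norm K =
     Inf {C. 0 \<le> C \<and> (\<forall>f \<in> L2_space. K f \<in> L2_space \<and> L2_norm (K f) \<le> C * L2_norm f)}"

definition C_plus :: "complex \<Rightarrow> complex \<Rightarrow> complex" where
  "C_plus \<alpha> \<beta> = Gamma (1 - 2 * \<alpha>) * (sin (complex_of_real pi * (\<alpha> - \<beta>)) / complex_of_real pi)"

definition C_minus :: "complex \<Rightarrow> complex \<Rightarrow> complex" where
  "C_minus \<alpha> \<beta> = Gamma (1 - 2 * \<alpha>) * (sin (complex_of_real pi * (\<alpha> + \<beta>)) / complex_of_real pi)"

text \<open>The kernel is not specified on the diagonal, a null set; it is \<open>0\<close> there.\<close>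

definition kernel_k :: "complex \<Rightarrow> complex \<Rightarrow> real \<Rightarrow> real \<Rightarrow> complex" where
  "kernel_k \<alpha> \<beta> x y =
     (if x > y then C_plus \<alpha> \<beta> * complex_of_real (x - y) powr (2 * \<alpha> - 1)
      else if x < y then C_minus \<alpha> \<beta> * complex_of_real (y - x) powr (2 * \<alpha> - 1)
      else 0)"

end

theory Submission
  imports "HOL-Complex_Analysis.Cauchy_Integral_Theorem" Defs
begin

text \<open>
  The norm of the section \<open>T\<^sub>n(a)\<close> is decided by the singularity of the symbol alone, and near the
  singularity the matrix is a discretisation of a homogeneous integral operator.

  First, if a symbol is \<open>o(|t - t0| powr (-q))\<close> at \<open>t0\<close> and \<open>O(|t - t0| powr (-q))\<close> everywhere,
  with \<open>0 < q < 1\<close>, then the norms of its sections are \<open>o(n powr q)\<close>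
  (\<open>toeplitz_norm_small_o\<close>). This is a statement on the quadratic forms
  \<open>\<integral> |t - t0| powr (-q) |U|\<^sup>2\<close> of polynomials of degree below \<open>n\<close>, and involves no Fourier
  coefficients. Hence, with \<open>q = 2 Re \<alpha>\<close>, the given symbol may be replaced by any other symbol with
  the same one-sided limits relative to \<open>|t - t0| powr (-2 \<alpha>)\<close>.

  A convenient substitute is a linear combination of \<open>(1 - t/t0) powr (-2 \<alpha>)\<close> and
  \<open>(1 - t0/t) powr (-2 \<alpha>)\<close>. The weights are fixed by the two one-sided limits
  (\<open>weights_match\<close>), and the Fourier coefficients are binomial coefficients on either half-line
  (\<open>branch_coeff\<close>), whose asymptotics are classical. Up to a modulation, which does not change
  norms, the coefficient of index \<open>k\<close> is thus asymptotic to \<open>C\<^sup>+ k powr (2 \<alpha> - 1)\<close> for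
  \<open>k \<rightarrow> \<infinity>\<close>, and likewise with \<open>C\<^sup>-\<close> for \<open>k \<rightarrow> -\<infinity>\<close>; Euler's reflection formula
  produces the constants (\<open>model_coeff_asymp\<close>).

  Finally, \<open>n powr (- 2 Re \<alpha>)\<close> times the norm of an \<open>n\<close> by \<open>n\<close> matrix with entries
  \<open>s (j - k)\<close> is the norm of an integral operator on \<open>L\<^sup>2(0,1)\<close> whose kernel is constant on
  squares of side \<open>1/n\<close>. If \<open>s\<close> has the above asymptotics, this kernel differs from the
  homogeneous kernel of \<open>K\<close> by little in the sense of the Schur test, so that the norms converge
  to \<open>\<parallel>K\<parallel>\<close> (\<open>toeplitz_norm_tendsto_operator_norm\<close>). As \<open>\<parallel>K\<parallel> > 0\<close>
  (\<open>conv_operator_norm_pos\<close>), the quotient of the two sides tends to \<open>1\<close>.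
\<close>

section \<open>Norms of Toeplitz sections\<close>

text \<open>
  Everything below depends on a Toeplitz matrix only through its coefficient sequence, so the
  spectral norm is studied as a function of that sequence; it is a seminorm there, invariant under
  modulation.
\<close>

definition toeplitz_norm :: "(int \<Rightarrow> complex) \<Rightarrow> nat \<Rightarrow> real" where
  "toeplitz_norm c n = spectral_norm (mat n n (\<lambda>(j, k). c (int j - int k)))"

abbreviation l2norm :: "nat \<Rightarrow> (nat \<Rightarrow> complex) \<Rightarrow> real" where
  "l2norm n v \<equiv> L2_set (\<lambda>i. cmod (v i)) {..<n}"

definition toeplitz_mult :: "(int \<Rightarrow> complex) \<Rightarrow> nat \<Rightarrow> (nat \<Rightarrow> complex) \<Rightarrow> nat \<Rightarrow> complex" where
  "toeplitz_mult c n v j = (\<Sum>k<n. c (int j - int k) * v k)"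

lemma toeplitz_norm_eq_Inf:
  "toeplitz_norm c n = Inf {C. 0 \<le> C \<and> (\<forall>v. l2norm n (toeplitz_mult c n v) \<le> C * l2norm n v)}"
proof -
  let ?A = "mat n n (\<lambda>(j, k). c (int j - int k))"
  have norm_vec: "euclidean_norm v = l2norm n (\<lambda>i. v $ i)" if "v \<in> carrier_vec n" for v
    using that by (simp add: euclidean_norm_def)
  have norm_mult: "euclidean_norm (?A *\<^sub>v v) = l2norm n (toeplitz_mult c n (\<lambda>i. v $ i))"
    if "v \<in> carrier_vec n" for v
    using that by (auto simp: euclidean_norm_def toeplitz_mult_def scalar_prod_def atLeast0LessThan
        intro!: L2_set_cong)
  have cong: "l2norm n (toeplitz_mult c n (\<lambda>i. vec n v $ i)) = l2norm n (toeplitz_mult c n v)"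
     "l2norm n (\<lambda>i. vec n v $ i) = l2norm n v" for v
    by (auto simp: toeplitz_mult_def intro!: L2_set_cong)
  have "(\<forall>v \<in> carrier_vec (dim_col ?A). euclidean_norm (?A *\<^sub>v v) \<le> C * euclidean_norm v) \<longleftrightarrow>
        (\<forall>v. l2norm n (toeplitz_mult c n v) \<le> C * l2norm n v)" for C
  proof (intro iffI allI ballI)
    fix v :: "nat \<Rightarrow> complex"
    assume "\<forall>v \<in> carrier_vec (dim_col ?A). euclidean_norm (?A *\<^sub>v v) \<le> C * euclidean_norm v"
    then have "euclidean_norm (?A *\<^sub>v vec n v) \<le> C * euclidean_norm (vec n v)" by simp
    then show "l2norm n (toeplitz_mult c n v) \<le> C * l2norm n v"
      by (simp only: norm_mult norm_vec vec_carrier cong)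
  next
    fix v :: "complex vec" assume "\<forall>v. l2norm n (toeplitz_mult c n v) \<le> C * l2norm n v" "v \<in> carrier_vec (dim_col ?A)"
    then show "euclidean_norm (?A *\<^sub>v v) \<le> C * euclidean_norm v"
      by (simp add: norm_mult norm_vec)
  qed
  then show ?thesis by (simp only: toeplitz_norm_def spectral_norm_def)
qed

lemma norm_sum_mult_le_l2norm: "cmod (\<Sum>k<n. u k * v k) \<le> l2norm n u * l2norm n v"
proof -
  have "cmod (\<Sum>k<n. u k * v k) \<le> (\<Sum>k<n. \<bar>cmod (u k)\<bar> * \<bar>cmod (v k)\<bar>)"
    by (rule order_trans[OF norm_sum]) (simp add: norm_mult)
  also have "\<dots> \<le> l2norm n u * l2norm n v" by (rule L2_set_mult_ineq)
  finally show ?thesis .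
qed

lemma toeplitz_bound_exists: "\<exists>C\<ge>0. \<forall>v. l2norm n (toeplitz_mult c n v) \<le> C * l2norm n v"
proof (intro exI conjI allI)
  let ?r = "\<lambda>j. l2norm n (\<lambda>k. c (int j - int k))"
  show "0 \<le> (\<Sum>j<n. ?r j)" by (intro sum_nonneg L2_set_nonneg)
  fix v
  have "l2norm n (toeplitz_mult c n v) \<le> (\<Sum>j<n. cmod (toeplitz_mult c n v j))"
    using L2_set_le_sum_abs[of "\<lambda>i. cmod (toeplitz_mult c n v i)" "{..<n}"] by simp
  also have "\<dots> \<le> (\<Sum>j<n. ?r j * l2norm n v)"
    unfolding toeplitz_mult_def by (intro sum_mono norm_sum_mult_le_l2norm)
  finally show "l2norm n (toeplitz_mult c n v) \<le> (\<Sum>j<n. ?r j) * l2norm n v"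
    by (simp add: sum_distrib_right)
qed

lemma toeplitz_norm_nonneg: "0 \<le> toeplitz_norm c n"
  unfolding toeplitz_norm_eq_Inf using toeplitz_bound_exists by (intro cInf_greatest) auto

lemma toeplitz_norm_least:
  assumes "0 \<le> C" "\<And>v. l2norm n (toeplitz_mult c n v) \<le> C * l2norm n v"
  shows "toeplitz_norm c n \<le> C"
  unfolding toeplitz_norm_eq_Inf using assms by (intro cInf_lower) (auto intro!: bdd_belowI[of _ 0])

lemma toeplitz_norm_bound: "l2norm n (toeplitz_mult c n v) \<le> toeplitz_norm c n * l2norm n v"
proof (cases "l2norm n v = 0")
  case True
  obtain C where "\<forall>v. l2norm n (toeplitz_mult c n v) \<le> C * l2norm n v"
    using toeplitz_bound_exists[where n=n and c=c] by (elim exE conjE)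
  then have "l2norm n (toeplitz_mult c n v) \<le> C * l2norm n v" by (rule spec)
  with True show ?thesis by simp
next
  case False
  then have pos: "l2norm n v > 0" using L2_set_nonneg[of "\<lambda>i. cmod (v i)" "{..<n}"] by linarith
  have "l2norm n (toeplitz_mult c n v) / l2norm n v \<le> toeplitz_norm c n"
    unfolding toeplitz_norm_eq_Inf using toeplitz_bound_exists pos
    by (intro cInf_greatest) (auto simp: field_simps)
  with pos show ?thesis by (simp add: field_simps)
qed

lemma toeplitz_norm_add_le: "toeplitz_norm (\<lambda>k. c k + d k) n \<le> toeplitz_norm c n + toeplitz_norm d n"
proof (rule toeplitz_norm_least)
  fix v
  have "toeplitz_mult (\<lambda>k. c k + d k) n v j = toeplitz_mult c n v j + toeplitz_mult d n v j" for j
    by (simp add: toeplitz_mult_def distrib_right sum.distrib)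
  then have "l2norm n (toeplitz_mult (\<lambda>k. c k + d k) n v)
      \<le> L2_set (\<lambda>j. cmod (toeplitz_mult c n v j) + cmod (toeplitz_mult d n v j)) {..<n}"
    by (intro L2_set_mono) (auto simp: norm_triangle_ineq)
  also have "\<dots> \<le> l2norm n (toeplitz_mult c n v) + l2norm n (toeplitz_mult d n v)"
    by (rule L2_set_triangle_ineq)
  also have "\<dots> \<le> toeplitz_norm c n * l2norm n v + toeplitz_norm d n * l2norm n v"
    by (intro add_mono toeplitz_norm_bound)
  finally show "l2norm n (toeplitz_mult (\<lambda>k. c k + d k) n v)
      \<le> (toeplitz_norm c n + toeplitz_norm d n) * l2norm n v" by (simp add: algebra_simps)
qed (simp add: toeplitz_norm_nonneg)

lemma toeplitz_norm_scale_le: "toeplitz_norm (\<lambda>k. z * c k) n \<le> cmod z * toeplitz_norm c n"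
proof (rule toeplitz_norm_least)
  fix v
  have "toeplitz_mult (\<lambda>k. z * c k) n v j = z * toeplitz_mult c n v j" for j
    by (simp add: toeplitz_mult_def sum_distrib_left mult.assoc)
  then have "l2norm n (toeplitz_mult (\<lambda>k. z * c k) n v) = cmod z * l2norm n (toeplitz_mult c n v)"
    by (simp add: norm_mult L2_set_right_distrib)
  also have "\<dots> \<le> cmod z * (toeplitz_norm c n * l2norm n v)"
    by (intro mult_left_mono toeplitz_norm_bound) simp
  finally show "l2norm n (toeplitz_mult (\<lambda>k. z * c k) n v) \<le> cmod z * toeplitz_norm c n * l2norm n v"
    by (simp add: mult.assoc)
qed (simp add: toeplitz_norm_nonneg)

lemma toeplitz_norm_scale: "toeplitz_norm (\<lambda>k. z * c k) n = cmod z * toeplitz_norm c n"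
proof (cases "z = 0")
  case True
  then show ?thesis using toeplitz_norm_scale_le[of z c n] toeplitz_norm_nonneg[of "\<lambda>k. z * c k" n] by simp
next
  case False
  have "toeplitz_norm (\<lambda>k. inverse z * (z * c k)) n \<le> cmod (inverse z) * toeplitz_norm (\<lambda>k. z * c k) n"
    by (rule toeplitz_norm_scale_le)
  with False have "cmod z * toeplitz_norm c n \<le> toeplitz_norm (\<lambda>k. z * c k) n"
    by (simp add: norm_divide mult.assoc[symmetric] field_simps)
  with toeplitz_norm_scale_le[of z c n] show ?thesis by simp
qed

lemma toeplitz_norm_modulate_le:
  "toeplitz_norm (\<lambda>k. cis (of_int k * \<theta>) * c k) n \<le> toeplitz_norm c n"
proof (rule toeplitz_norm_least)
  fix v
  let ?w = "\<lambda>k. cis (- real k * \<theta>) * v k"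
  have "toeplitz_mult (\<lambda>k. cis (of_int k * \<theta>) * c k) n v j = cis (real j * \<theta>) * toeplitz_mult c n ?w j" for j
  proof -
    have "cis (of_int (int j - int k) * \<theta>) = cis (real j * \<theta>) * cis (- real k * \<theta>)" for k
      by (simp add: cis_mult algebra_simps)
    then show ?thesis by (simp add: toeplitz_mult_def sum_distrib_left algebra_simps)
  qed
  then have "l2norm n (toeplitz_mult (\<lambda>k. cis (of_int k * \<theta>) * c k) n v) = l2norm n (toeplitz_mult c n ?w)"
    by (simp add: norm_mult)
  also have "\<dots> \<le> toeplitz_norm c n * l2norm n ?w" by (rule toeplitz_norm_bound)
  also have "l2norm n ?w = l2norm n v" by (simp add: norm_mult)
  finally show "l2norm n (toeplitz_mult (\<lambda>k. cis (of_int k * \<theta>) * c k) n v) \<le> toeplitz_norm c n * l2norm n v" .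
qed (rule toeplitz_norm_nonneg)

text \<open>
  Modulating the coefficients conjugates the matrix by a diagonal unitary. This is how the position
  of the singularity on the circle drops out of the norms.
\<close>

lemma toeplitz_norm_modulate:
  "toeplitz_norm (\<lambda>k. cis (of_int k * \<theta>) * c k) n = toeplitz_norm c n"
proof (rule antisym[OF toeplitz_norm_modulate_le])
  have "toeplitz_norm (\<lambda>k. cis (of_int k * (-\<theta>)) * (cis (of_int k * \<theta>) * c k)) n
      \<le> toeplitz_norm (\<lambda>k. cis (of_int k * \<theta>) * c k) n" by (rule toeplitz_norm_modulate_le)
  then show "toeplitz_norm c n \<le> toeplitz_norm (\<lambda>k. cis (of_int k * \<theta>) * c k) n"
    by (simp add: mult.assoc[symmetric] cis_mult)
qed

section \<open>Trigonometric polynomials and power weights\<close>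

abbreviation circle_M :: "real measure" where
  "circle_M \<equiv> lebesgue_on {-pi..pi}"

text \<open>
  The trigonometric polynomial with coefficient vector \<open>u\<close>: the Toeplitz matrix of \<open>g\<close>
  is the Gram matrix of the form \<open>\<integral> g U V\<^sup>*\<close> in these polynomials.
\<close>

definition trig_poly :: "nat \<Rightarrow> (nat \<Rightarrow> complex) \<Rightarrow> real \<Rightarrow> complex" where
  "trig_poly n u \<theta> = (\<Sum>k<n. u k * cis (real k * \<theta>))"

lemma nn_integral_powr_interval:
  fixes c h p :: real
  assumes "0 < p" "0 \<le> h"
  shows "(\<integral>\<^sup>+x. ennreal (indicator {c - h..c + h} x * \<bar>x - c\<bar> powr (p - 1)) \<partial>lborel)
     = ennreal (2 * h powr p / p)"
proof -
  have right: "((\<lambda>x. \<bar>x\<bar> powr (p - 1)) has_integral h powr p / p) {0..h}"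
    using has_integral_powr_from_0[of "p - 1" h] assms
    by (subst has_integral_cong[where g = "\<lambda>x. x powr (p - 1)"]) auto
  have "((\<lambda>x. \<bar>-x\<bar> powr (p - 1)) has_integral h powr p / p) {-h..-0}"
    using right by (subst has_integral_reflect_real) 
  then have left: "((\<lambda>x. \<bar>x\<bar> powr (p - 1)) has_integral h powr p / p) {-h..0}" by simp
  have "((\<lambda>x. \<bar>x\<bar> powr (p - 1)) has_integral h powr p / p + h powr p / p) {-h..h}"
    by (rule has_integral_combine[OF _ _ left right]) (use assms in auto)
  then have "((\<lambda>x. if x \<in> {-h..h} then \<bar>x\<bar> powr (p - 1) else 0) has_integral 2 * h powr p / p) UNIV"
    by (subst has_integral_restrict_UNIV) (simp add: field_simps)
  also have "(\<lambda>x. if x \<in> {-h..h} then \<bar>x\<bar> powr (p - 1) else 0) =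
      (\<lambda>x. indicator {-h..h} x * \<bar>x\<bar> powr (p - 1))" by (auto simp: indicator_def)
  finally have "(\<integral>\<^sup>+x. ennreal (indicator {-h..h} x * \<bar>x\<bar> powr (p - 1)) \<partial>lborel)
     = ennreal (2 * h powr p / p)"
    by (intro nn_integral_has_integral_lborel) auto
  moreover have "(\<integral>\<^sup>+x. ennreal (indicator {c - h..c + h} x * \<bar>x - c\<bar> powr (p - 1)) \<partial>lborel) =
     (\<integral>\<^sup>+x. ennreal (indicator {c - h..c + h} (c + 1 * x) * \<bar>(c + 1 * x) - c\<bar> powr (p - 1)) \<partial>lborel)"
    by (subst nn_integral_real_affine[of _ 1 c]) auto
  moreover have "indicator {c - h..c + h} (c + 1 * x) = (indicator {-h..h} x :: real)" for x
    by (auto simp: indicator_def)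
  ultimately show ?thesis by simp
qed

lemma borel_measurable_lebesgue_on_borel:
  assumes "f \<in> borel_measurable borel"
  shows "f \<in> borel_measurable (lebesgue_on S)"
proof -
  have "f \<in> borel_measurable lborel" using assms by simp
  then show ?thesis by (intro measurable_restrict_space1 measurable_completion)
qed

lemma nn_integral_lebesgue_on_borel:
  fixes f :: "real \<Rightarrow> ennreal"
  assumes "f \<in> borel_measurable borel" "S \<in> sets borel"
  shows "(\<integral>\<^sup>+x. f x \<partial>lebesgue_on S) = (\<integral>\<^sup>+x. f x * indicator S x \<partial>lborel)"
  using assms by (simp add: nn_integral_restrict_space nn_integral_completion)

lemma integrable_lebesgue_on_nn_bound:
  fixes f :: "real \<Rightarrow> real"
  assumes "f \<in> borel_measurable borel" "\<And>x. 0 \<le> f x" "S \<in> sets borel"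
    and "(\<integral>\<^sup>+x. ennreal (f x) * indicator S x \<partial>lborel) \<le> ennreal B" "0 \<le> B"
  shows "integrable (lebesgue_on S) f" "(LINT x|lebesgue_on S. f x) \<le> B"
proof -
  have eq: "(\<integral>\<^sup>+x. ennreal (f x) \<partial>lebesgue_on S) = (\<integral>\<^sup>+x. ennreal (f x) * indicator S x \<partial>lborel)"
    by (rule nn_integral_lebesgue_on_borel) (use assms in auto)
  show int: "integrable (lebesgue_on S) f"
    using assms(2,4) eq
    by (intro integrableI_nonneg borel_measurable_lebesgue_on_borel[OF assms(1)])
       (auto intro: le_less_trans)
  have "ennreal (LINT x|lebesgue_on S. f x) \<le> ennreal B"
    using nn_integral_eq_integral[OF int] assms(2,4) eq by simp
  then show "(LINT x|lebesgue_on S. f x) \<le> B" using assms(5) by simp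
qed

lemma integral_cis: "(LINT \<theta>|circle_M. cis (of_int k * \<theta>)) = (if k = 0 then 2 * of_real pi else 0)"
proof (cases "k = 0")
  case True
  then show ?thesis by (simp add: measure_restrict_space scaleR_conv_of_real)
next
  case False
  have int: "integrable circle_M (\<lambda>\<theta>. cis (of_int k * \<theta>))"
    by (intro continuous_imp_integrable_real continuous_intros)
  have "((\<lambda>\<theta>. cis (of_int k * \<theta>)) has_integral
      (cis (of_int k * pi) / (\<i> * of_int k) - cis (of_int k * (-pi)) / (\<i> * of_int k))) {-pi..pi}"
  proof (rule fundamental_theorem_of_calculus)
    fix x :: real
    have "((\<lambda>z. exp (c * z) / c) has_field_derivative exp (c * of_real x)) (at (of_real x))"
      if "c \<noteq> 0" for c :: complex
      using that by (auto intro!: derivative_eq_intros)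
    from has_vector_derivative_real_field[OF this[of "\<i> * of_int k"], of "{-pi..pi}"]
    have "((\<lambda>\<theta>. exp (\<i> * of_int k * of_real \<theta>) / (\<i> * of_int k)) has_vector_derivative
        exp (\<i> * of_int k * of_real x)) (at x within {-pi..pi})" using False by simp
    moreover have "exp (\<i> * of_int k * of_real t) = cis (of_int k * t)" for t
      unfolding cis_conv_exp by (simp only: of_real_mult of_real_of_int_eq mult.assoc)
    ultimately show "((\<lambda>\<theta>. cis (of_int k * \<theta>) / (\<i> * of_int k)) has_vector_derivative
        cis (of_int k * x)) (at x within {-pi..pi})"
      by (simp only:)
  qed simp
  also have "cis (of_int k * (-pi)) = cis (of_int k * pi)"
  proof -
    have "cis (of_int k * pi) = cis (of_int k * (-pi)) * cis (2 * pi * of_int k)"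
      by (simp add: cis_mult algebra_simps)
    then show ?thesis by (simp add: cis_multiple_2pi)
  qed
  finally have "integral {-pi..pi} (\<lambda>\<theta>. cis (of_int k * \<theta>)) = 0" by auto
  with int False show ?thesis by (simp add: lebesgue_integral_eq_integral)
qed

lemma continuous_on_trig_poly: "continuous_on S (trig_poly n u)"
  unfolding trig_poly_def by (intro continuous_intros)

lemma borel_measurable_trig_poly: "trig_poly n u \<in> borel_measurable borel"
  by (intro borel_measurable_continuous_onI continuous_on_trig_poly)

lemma trig_poly_norm_le: "cmod (trig_poly n u \<theta>) ^ 2 \<le> real n * (l2norm n u)\<^sup>2"
proof -
  have "cmod (trig_poly n u \<theta>) \<le> l2norm n u * l2norm n (\<lambda>k. cis (real k * \<theta>))"
    unfolding trig_poly_def by (rule norm_sum_mult_le_l2norm)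
  also have "l2norm n (\<lambda>k. cis (real k * \<theta>)) = sqrt n" by (simp add: L2_set_def)
  finally have "cmod (trig_poly n u \<theta>) ^ 2 \<le> (l2norm n u * sqrt n)\<^sup>2" by (intro power_mono) auto
  then show ?thesis by (simp add: power_mult_distrib mult.commute)
qed

lemma integral_double_sum:
  fixes f :: "nat \<Rightarrow> nat \<Rightarrow> 'a \<Rightarrow> complex"
  assumes "\<And>j k. integrable M (f j k)"
  shows "(LINT x|M. (\<Sum>j<m. \<Sum>k<n. f j k x)) = (\<Sum>j<m. \<Sum>k<n. LINT x|M. f j k x)"
  using assms by (simp add: Bochner_Integration.integral_sum Bochner_Integration.integrable_sum)

lemma trig_poly_product:
  "trig_poly n u \<theta> * cnj (trig_poly n v \<theta>) =
     (\<Sum>j<n. \<Sum>k<n. cnj (v j) * u k * cis (- of_int (int j - int k) * \<theta>))"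
proof -
  have *: "u k * cis (real k * \<theta>) * (cnj (v j) * cis (- (real j * \<theta>))) =
     cnj (v j) * u k * cis (- of_int (int j - int k) * \<theta>)" for j k
  proof -
    have "u k * cis (real k * \<theta>) * (cnj (v j) * cis (- (real j * \<theta>))) =
       cnj (v j) * u k * (cis (real k * \<theta>) * cis (- (real j * \<theta>)))" by (simp add: ac_simps)
    then show ?thesis by (simp add: cis_mult algebra_simps)
  qed
  show ?thesis
    unfolding trig_poly_def cnj_sum complex_cnj_mult cis_cnj sum_product * by (rule sum.swap)
qed

lemma parseval_trig_poly: "(LINT \<theta>|circle_M. cmod (trig_poly n u \<theta>) ^ 2) = 2 * pi * (l2norm n u)\<^sup>2"
proof -
  have int: "integrable circle_M (\<lambda>\<theta>. z * cis (- of_int m * \<theta>))" for z m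
    by (intro continuous_imp_integrable_real continuous_intros)
  have orth: "(LINT \<theta>|circle_M. z * cis (- of_int m * \<theta>)) = (if m = 0 then 2 * of_real pi * z else 0)" for z m
    using integral_cis[of "-m"] by simp
  have "of_real (LINT \<theta>|circle_M. cmod (trig_poly n u \<theta>) ^ 2) =
      (LINT \<theta>|circle_M. trig_poly n u \<theta> * cnj (trig_poly n u \<theta>))"
    by (simp add: complex_norm_square[symmetric] del: of_real_power)
  also have "\<dots> = (\<Sum>j<n. \<Sum>k<n. (if int j - int k = 0 then 2 * of_real pi * (cnj (u j) * u k) else 0))"
    unfolding trig_poly_product
    by (subst integral_double_sum[OF int]) (intro sum.cong refl orth)
  also have "\<dots> = (\<Sum>j<n. 2 * of_real pi * (u j * cnj (u j)))"
    by (intro sum.cong refl) (simp add: sum.delta' mult.commute)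
  also have "\<dots> = of_real (2 * pi * (\<Sum>j<n. (cmod (u j))\<^sup>2))"
    by (simp add: complex_norm_square[symmetric] sum_distrib_left)
  finally show ?thesis by (simp add: L2_set_def sum_nonneg of_real_eq_iff del: of_real_mult)
qed

lemma integrable_mult_trig_poly:
  fixes f :: "real \<Rightarrow> 'a :: {real_normed_algebra, second_countable_topology, banach}"
  assumes "integrable circle_M f" "g \<in> borel_measurable borel" "\<And>\<theta>. norm (g \<theta>) \<le> B"
  shows "integrable circle_M (\<lambda>\<theta>. f \<theta> * g \<theta>)"
proof (rule Bochner_Integration.integrable_bound)
  show "integrable circle_M (\<lambda>\<theta>. B * norm (f \<theta>))" using assms(1) by simp
  show "(\<lambda>\<theta>. f \<theta> * g \<theta>) \<in> borel_measurable circle_M"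
    using assms borel_measurable_lebesgue_on_borel[OF assms(2)] by simp
  have "norm (f \<theta> * g \<theta>) \<le> norm (B * norm (f \<theta>))" for \<theta>
  proof -
    have "norm (f \<theta> * g \<theta>) \<le> norm (f \<theta>) * norm (g \<theta>)" by (rule norm_mult_ineq)
    also have "\<dots> \<le> norm (f \<theta>) * B" by (intro mult_left_mono assms) simp
    also have "\<dots> \<le> norm (B * norm (f \<theta>))" by (simp add: mult.commute)
    finally show ?thesis .
  qed
  then show "AE \<theta> in circle_M. norm (f \<theta> * g \<theta>) \<le> norm (B * norm (f \<theta>))" by simp
qed

lemma toeplitz_quadratic_form:
  assumes "integrable circle_M g"
    and c: "\<And>k. c k = 1 / (2 * of_real pi) * (LINT \<theta>|circle_M. g \<theta> * cis (- of_int k * \<theta>))"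
  shows "(\<Sum>j<n. cnj (v j) * toeplitz_mult c n u j) =
     1 / (2 * of_real pi) * (LINT \<theta>|circle_M. g \<theta> * (trig_poly n u \<theta> * cnj (trig_poly n v \<theta>)))"
proof -
  have gi: "integrable circle_M (\<lambda>\<theta>. g \<theta> * cis (- of_int m * \<theta>))" for m
    by (rule integrable_mult_trig_poly[where B=1, OF assms(1)])
       (intro borel_measurable_continuous_onI continuous_intros, simp)
  have int: "integrable circle_M (\<lambda>\<theta>. g \<theta> * (z * cis (- of_int m * \<theta>)))" for z m
    using integrable_mult_right[OF gi, of z m] by (simp add: ac_simps)
  have val: "(LINT \<theta>|circle_M. g \<theta> * (z * cis (- of_int m * \<theta>))) = z * (2 * of_real pi * c m)" for z m
  proof -
    have "(LINT \<theta>|circle_M. g \<theta> * (z * cis (- of_int m * \<theta>)))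
       = (LINT \<theta>|circle_M. z * (g \<theta> * cis (- of_int m * \<theta>)))" by (simp add: ac_simps)
    then show ?thesis by (simp add: c)
  qed
  have "(LINT \<theta>|circle_M. g \<theta> * (trig_poly n u \<theta> * cnj (trig_poly n v \<theta>))) =
     (\<Sum>j<n. \<Sum>k<n. cnj (v j) * u k * (2 * of_real pi * c (int j - int k)))"
    unfolding trig_poly_product sum_distrib_left
    by (subst integral_double_sum[OF int]) (intro sum.cong refl val)
  also have "\<dots> = 2 * of_real pi * (\<Sum>j<n. cnj (v j) * toeplitz_mult c n u j)"
    by (simp add: toeplitz_mult_def sum_distrib_left ac_simps)
  finally show ?thesis by simp
qed

text \<open>
  The reduction to quadratic forms: \<open>|<T u, v>|\<close> is at most the integral of
  \<open>W |U| |V|\<close>, and the arithmetic-geometric mean inequality splits this product into the two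
  forms \<open>\<integral> W |U|\<^sup>2\<close> and \<open>\<integral> W |V|\<^sup>2\<close>. Hence it suffices to control a positive
  weight on the diagonal.
\<close>

lemma toeplitz_norm_le_weight:
  assumes g: "g \<in> borel_measurable circle_M" and W: "integrable circle_M W"
    and le: "AE \<theta> in circle_M. cmod (g \<theta>) \<le> W \<theta>"
    and c: "\<And>k. c k = 1 / (2 * of_real pi) * (LINT \<theta>|circle_M. g \<theta> * cis (- of_int k * \<theta>))"
    and Q: "0 < Q"
    and form: "\<And>u. (LINT \<theta>|circle_M. W \<theta> * cmod (trig_poly n u \<theta>) ^ 2) \<le> 2 * pi * Q * (l2norm n u)\<^sup>2"
  shows "toeplitz_norm c n \<le> Q"
proof (rule toeplitz_norm_least)
  fix u
  define v where "v = toeplitz_mult c n u"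
  have gi: "integrable circle_M g"
    by (rule Bochner_Integration.integrable_bound[OF W g]) (use le in \<open>auto elim!: eventually_mono\<close>)
  have Wi: "integrable circle_M (\<lambda>\<theta>. W \<theta> * cmod (trig_poly n w \<theta>) ^ 2)" for w
    by (rule integrable_mult_trig_poly[OF W _ , where B = "real n * (l2norm n w)\<^sup>2"])
       (use trig_poly_norm_le[of n w] borel_measurable_trig_poly[of n w] in simp_all)
  have "of_real ((l2norm n v)\<^sup>2) = (\<Sum>j<n. cnj (v j) * v j)"
    by (simp add: L2_set_def sum_nonneg complex_norm_square mult.commute del: of_real_power)
  also have "\<dots> = 1 / (2 * of_real pi) *
     (LINT \<theta>|circle_M. g \<theta> * (trig_poly n u \<theta> * cnj (trig_poly n v \<theta>)))"
    unfolding v_def by (rule toeplitz_quadratic_form[OF gi c])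
  finally have "cmod (of_real ((l2norm n v)\<^sup>2)) = cmod (1 / (2 * of_real pi) *
     (LINT \<theta>|circle_M. g \<theta> * (trig_poly n u \<theta> * cnj (trig_poly n v \<theta>))))" by simp
  then have "2 * pi * (l2norm n v)\<^sup>2 = cmod (LINT \<theta>|circle_M. g \<theta> * (trig_poly n u \<theta> * cnj (trig_poly n v \<theta>)))"
    by (simp add: norm_mult norm_divide norm_power field_simps)
  also have "\<dots> \<le> (LINT \<theta>|circle_M. (Q * (W \<theta> * cmod (trig_poly n u \<theta>) ^ 2) +
       (W \<theta> * cmod (trig_poly n v \<theta>) ^ 2) / Q) / 2)"
  proof (rule order_trans[OF integral_norm_bound integral_mono_AE])
    let ?P = "\<lambda>\<theta>. trig_poly n u \<theta> * cnj (trig_poly n v \<theta>)"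
    let ?B = "\<lambda>w. sqrt (real n) * l2norm n w"
    have B: "cmod (trig_poly n w \<theta>) \<le> ?B w" for w \<theta>
      by (rule power2_le_imp_le)
         (use trig_poly_norm_le[of n w \<theta>] in \<open>simp_all add: power_mult_distrib L2_set_nonneg\<close>)
    have meas: "?P \<in> borel_measurable borel"
      by (intro borel_measurable_continuous_onI continuous_intros continuous_on_trig_poly)
    have "cmod (?P \<theta>) \<le> ?B u * ?B v" for \<theta>
      unfolding norm_mult complex_mod_cnj
      by (intro mult_mono B mult_nonneg_nonneg L2_set_nonneg) auto
    then show "integrable circle_M (\<lambda>\<theta>. cmod (g \<theta> * ?P \<theta>))"
      by (intro integrable_norm integrable_mult_trig_poly[OF gi meas])
    show "integrable circle_M (\<lambda>\<theta>. (Q * (W \<theta> * cmod (trig_poly n u \<theta>) ^ 2) +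
       (W \<theta> * cmod (trig_poly n v \<theta>) ^ 2) / Q) / 2)"
      using Wi by simp
    \<comment> \<open>The multiplier \<open>Q\<close> balances the two forms so that \<open>\<parallel>v\<parallel>\<^sup>2\<close> can be absorbed on the left.\<close>
    have amgm: "x * y \<le> (Q * x\<^sup>2 + y\<^sup>2 / Q) / 2" for x y
    proof -
      have expand: "Q * (x - z)\<^sup>2 = Q * x\<^sup>2 - 2 * (x * (Q * z)) + (Q * z) * z" for z
        by (simp add: power2_eq_square algebra_simps)
      have "0 \<le> Q * (x - y / Q)\<^sup>2" using Q by simp
      also note expand
      also have "Q * (y / Q) = y" using Q by simp
      finally have "0 \<le> Q * x\<^sup>2 - 2 * (x * y) + y * (y / Q)" .
      moreover have "t \<le> (A + B) / 2" if "0 \<le> A - 2 * t + B" for A B t :: real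
        using that by simp
      ultimately show ?thesis by (simp only: power2_eq_square times_divide_eq_right)
    qed
    show "AE \<theta> in circle_M. cmod (g \<theta> * ?P \<theta>) \<le>
       (Q * (W \<theta> * cmod (trig_poly n u \<theta>) ^ 2) + (W \<theta> * cmod (trig_poly n v \<theta>) ^ 2) / Q) / 2"
      using le
    proof (rule eventually_mono)
      fix \<theta> assume *: "cmod (g \<theta>) \<le> W \<theta>"
      then have W0: "0 \<le> W \<theta>" by (meson norm_ge_zero order_trans)
      have "cmod (g \<theta> * ?P \<theta>) \<le> W \<theta> * (cmod (trig_poly n u \<theta>) * cmod (trig_poly n v \<theta>))"
        using * by (simp add: norm_mult mult_right_mono)
      also have "\<dots> \<le> W \<theta> * ((Q * (cmod (trig_poly n u \<theta>))\<^sup>2 + (cmod (trig_poly n v \<theta>))\<^sup>2 / Q) / 2)"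
        by (intro mult_left_mono amgm W0)
      finally show "cmod (g \<theta> * ?P \<theta>) \<le>
         (Q * (W \<theta> * cmod (trig_poly n u \<theta>) ^ 2) + (W \<theta> * cmod (trig_poly n v \<theta>) ^ 2) / Q) / 2"
        by (simp add: algebra_simps)
    qed
  qed
  also have "\<dots> = (Q * (LINT \<theta>|circle_M. W \<theta> * cmod (trig_poly n u \<theta>) ^ 2) +
       (LINT \<theta>|circle_M. W \<theta> * cmod (trig_poly n v \<theta>) ^ 2) / Q) / 2"
    using Wi by (simp add: Bochner_Integration.integral_add)
  also have "\<dots> \<le> (Q * (2 * pi * Q * (l2norm n u)\<^sup>2) + (2 * pi * Q * (l2norm n v)\<^sup>2) / Q) / 2"
    using Q by (intro divide_right_mono add_mono mult_left_mono form) auto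
  also have "\<dots> = pi * ((Q * l2norm n u)\<^sup>2 + (l2norm n v)\<^sup>2)"
  proof -
    have "2 * pi * Q * (l2norm n v)\<^sup>2 / Q = 2 * pi * (l2norm n v)\<^sup>2" using Q by simp
    then show ?thesis by (simp add: power2_eq_square distrib_left)
  qed
  finally have "pi * (2 * (l2norm n v)\<^sup>2) \<le> pi * ((Q * l2norm n u)\<^sup>2 + (l2norm n v)\<^sup>2)"
    by (simp only: mult.commute mult.left_commute)
  then have "(l2norm n v)\<^sup>2 \<le> (Q * l2norm n u)\<^sup>2" by simp
  then show "l2norm n v \<le> Q * l2norm n u"
    by (rule power2_le_imp_le) (use Q in \<open>simp add: L2_set_nonneg\<close>)
qed (use Q in simp)

lemma integrable_powr_circle:
  assumes "0 < q" "q < 1"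
  shows "integrable circle_M (\<lambda>\<theta>. \<bar>\<theta> - c\<bar> powr (-q))"
proof (rule integrable_lebesgue_on_nn_bound(1))
  let ?h = "\<bar>c\<bar> + pi"
  have "(\<integral>\<^sup>+\<theta>. ennreal (\<bar>\<theta> - c\<bar> powr (-q)) * indicator {-pi..pi} \<theta> \<partial>lborel)
     \<le> (\<integral>\<^sup>+x. ennreal (indicator {c - ?h..c + ?h} x * \<bar>x - c\<bar> powr ((1 - q) - 1)) \<partial>lborel)"
    by (intro nn_integral_mono) (auto simp: indicator_def)
  also have "\<dots> = ennreal (2 * ?h powr (1 - q) / (1 - q))"
    by (rule nn_integral_powr_interval) (use assms in auto)
  finally show "(\<integral>\<^sup>+\<theta>. ennreal (\<bar>\<theta> - c\<bar> powr (-q)) * indicator {-pi..pi} \<theta> \<partial>lborel)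
     \<le> ennreal (2 * ?h powr (1 - q) / (1 - q))" .
qed (use assms in auto)

text \<open>
  Why the exponent of \<open>n\<close> equals the order of the singularity. Within distance \<open>1/n\<close> of the
  singularity a polynomial of degree below \<open>n\<close> satisfies \<open>|U|\<^sup>2 \<le> n \<parallel>u\<parallel>\<^sup>2\<close> and the weight
  has integral of order \<open>n powr (q - 1)\<close>; farther away the weight is at most \<open>n powr q\<close> and
  Parseval's identity applies. Both parts are of order \<open>n powr q\<close>.
\<close>

lemma powr_weight_form_bound:
  assumes q: "0 < q" "q < 1" and n: "0 < n"
  shows "(LINT \<theta>|circle_M. \<bar>\<theta> - c\<bar> powr (-q) * cmod (trig_poly n u \<theta>) ^ 2)
     \<le> (2 / (1 - q) + 2 * pi) * real n powr q * (l2norm n u)\<^sup>2"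
proof -
  define h where "h = 1 / real n"
  have h: "h > 0" using n by (simp add: h_def)
  let ?near = "\<lambda>\<theta>. indicator {c - h..c + h} \<theta> * \<bar>\<theta> - c\<bar> powr ((1 - q) - 1)"
  let ?N = "real n * (l2norm n u)\<^sup>2"
  have h_powr: "h powr (-q) = real n powr q"
    using n by (simp add: h_def powr_divide powr_minus)
  have h_powr': "h powr (1 - q) * real n = real n powr q"
  proof -
    have "h powr (1 - q) = h * h powr (-q)" using h by (simp add: powr_diff powr_minus divide_inverse)
    then show ?thesis using n by (simp add: h_powr) (simp add: h_def)
  qed
  have near_int: "integrable circle_M ?near" "(LINT \<theta>|circle_M. ?near \<theta>) \<le> 2 * h powr (1 - q) / (1 - q)"
  proof -
    have "(\<integral>\<^sup>+\<theta>. ennreal (?near \<theta>) * indicator {-pi..pi} \<theta> \<partial>lborel) \<le> (\<integral>\<^sup>+\<theta>. ennreal (?near \<theta>) \<partial>lborel)"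
      by (intro nn_integral_mono) (auto simp: indicator_def)
    also have "\<dots> = ennreal (2 * h powr (1 - q) / (1 - q))"
      by (rule nn_integral_powr_interval) (use q h in auto)
    finally have *: "(\<integral>\<^sup>+\<theta>. ennreal (?near \<theta>) * indicator {-pi..pi} \<theta> \<partial>lborel) \<le> ennreal (2 * h powr (1 - q) / (1 - q))" .
    have meas: "?near \<in> borel_measurable borel" by measurable
    have nonneg: "0 \<le> ?near \<theta>" for \<theta> by simp
    have B: "0 \<le> 2 * h powr (1 - q) / (1 - q)" using q by simp
    have S: "{-pi..pi} \<in> sets borel" by simp
    show "integrable circle_M ?near" by (rule integrable_lebesgue_on_nn_bound(1)[OF meas nonneg S * B])
    show "(LINT \<theta>|circle_M. ?near \<theta>) \<le> 2 * h powr (1 - q) / (1 - q)"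
      by (rule integrable_lebesgue_on_nn_bound(2)[OF meas nonneg S * B])
  qed
  have trig_int: "integrable circle_M (\<lambda>\<theta>. cmod (trig_poly n u \<theta>) ^ 2)"
    by (intro continuous_imp_integrable_real continuous_intros continuous_on_trig_poly)
  have "(LINT \<theta>|circle_M. \<bar>\<theta> - c\<bar> powr (-q) * cmod (trig_poly n u \<theta>) ^ 2)
      \<le> (LINT \<theta>|circle_M. ?N * ?near \<theta> + h powr (-q) * cmod (trig_poly n u \<theta>) ^ 2)"
  proof (rule integral_mono)
    show "integrable circle_M (\<lambda>\<theta>. \<bar>\<theta> - c\<bar> powr (-q) * cmod (trig_poly n u \<theta>) ^ 2)"
      by (rule integrable_mult_trig_poly[OF integrable_powr_circle[OF q] , where B = ?N])
         (use trig_poly_norm_le[of n u] borel_measurable_trig_poly[of n u] in simp_all)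
    show "integrable circle_M (\<lambda>\<theta>. ?N * ?near \<theta> + h powr (-q) * cmod (trig_poly n u \<theta>) ^ 2)"
      by (intro Bochner_Integration.integrable_add integrable_mult_right near_int(1) trig_int)
    fix \<theta>
    show "\<bar>\<theta> - c\<bar> powr (-q) * cmod (trig_poly n u \<theta>) ^ 2 \<le> ?N * ?near \<theta> + h powr (-q) * cmod (trig_poly n u \<theta>) ^ 2"
    proof (cases "\<bar>\<theta> - c\<bar> \<le> h")
      case True
      then have ind: "indicator {c - h..c + h} \<theta> = (1::real)" by (auto simp: indicator_def)
      have "\<bar>\<theta> - c\<bar> powr (-q) * cmod (trig_poly n u \<theta>) ^ 2 \<le> \<bar>\<theta> - c\<bar> powr (-q) * ?N"
        by (intro mult_left_mono trig_poly_norm_le) simp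
      moreover have "0 \<le> h powr (-q) * cmod (trig_poly n u \<theta>) ^ 2" by simp
      moreover have "?N * ?near \<theta> = \<bar>\<theta> - c\<bar> powr (-q) * ?N" using ind by (simp add: mult.commute)
      ultimately show ?thesis by linarith
    next
      case False
      then have "\<bar>\<theta> - c\<bar> powr (-q) \<le> h powr (-q)" using q h by (intro powr_mono2') auto
      then have "\<bar>\<theta> - c\<bar> powr (-q) * cmod (trig_poly n u \<theta>) ^ 2 \<le> h powr (-q) * cmod (trig_poly n u \<theta>) ^ 2"
        by (rule mult_right_mono) simp
      moreover have "0 \<le> ?N * ?near \<theta>" by simp
      ultimately show ?thesis by linarith
    qed
  qed
  also have "\<dots> = ?N * (LINT \<theta>|circle_M. ?near \<theta>) + h powr (-q) * (2 * pi * (l2norm n u)\<^sup>2)"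
    by (subst Bochner_Integration.integral_add)
       (intro integrable_mult_right near_int(1) trig_int | simp only: integral_mult_right_zero parseval_trig_poly)+
  also have "\<dots> \<le> ?N * (2 * h powr (1 - q) / (1 - q)) + h powr (-q) * (2 * pi * (l2norm n u)\<^sup>2)"
    by (intro add_mono mult_left_mono near_int) auto
  also have "\<dots> = (2 / (1 - q) * (h powr (1 - q) * real n) + 2 * pi * h powr (-q)) * (l2norm n u)\<^sup>2"
    by (simp add: algebra_simps)
  also have "\<dots> = (2 / (1 - q) + 2 * pi) * real n powr q * (l2norm n u)\<^sup>2"
    unfolding h_powr h_powr' by (simp add: algebra_simps)
  finally show ?thesis .
qed

section \<open>Symbols with a power singularity on the circle\<close>

lemma sin_ge_quarter:
  fixes x :: real
  assumes "0 \<le> x" "x \<le> pi / 2"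
  shows "x / 4 \<le> sin x"
proof (cases "x \<le> pi / 3")
  case True
  have "\<exists>z>0. z < x \<and> sin x - sin 0 = (x - 0) * cos z" if "x > 0"
    using MVT2[of 0 x sin cos] that by (auto intro!: derivative_eq_intros)
  then have "sin x \<ge> x / 2" if pos: "x > 0"
  proof -
    from \<open>x > 0 \<Longrightarrow> _\<close> pos obtain z where z: "0 < z" "z < x" "sin x = x * cos z" by auto
    have "cos (pi / 3) \<le> cos z" using z True by (intro cos_monotone_0_pi_le) auto
    then show ?thesis using z pos by (simp add: cos_60)
  qed
  then show ?thesis using assms by (cases "x = 0") (auto intro: order_trans[rotated])
next
  case False
  have "sin (pi / 6) \<le> sin x" using False assms pi_gt_zero by (intro sin_monotone_2pi_le) auto
  moreover have "x \<le> 2" using assms pi_less_4 by simp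
  ultimately show ?thesis by (simp add: sin_30)
qed

lemma cmod_cis_minus_1_ge:
  assumes "\<bar>x\<bar> \<le> pi"
  shows "\<bar>x\<bar> / 4 \<le> cmod (cis x - 1)"
proof -
  have "\<bar>x\<bar> / 4 \<le> \<bar>2 * sin (x / 2)\<bar>"
    using sin_ge_quarter[of "\<bar>x\<bar> / 2"] assms by (cases "x \<ge> 0") auto
  also have "\<bar>2 * sin (x / 2)\<bar> = cmod (cis x - 1)"
  proof -
    have "(cmod (cis x - 1))\<^sup>2 = (cos x - 1)\<^sup>2 + (sin x)\<^sup>2"
      by (simp add: cmod_power2)
    also have "\<dots> = 2 - 2 * cos x"
      using sin_cos_squared_add[of x] by (simp add: power2_diff)
    also have "\<dots> = \<bar>2 * sin (x / 2)\<bar>\<^sup>2"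
      using cos_double_sin[of "x / 2"] by (simp add: power_mult_distrib)
    finally have "\<bar>2 * sin (x / 2)\<bar>\<^sup>2 = (cmod (cis x - 1))\<^sup>2" by (rule sym)
    then show ?thesis by (rule power2_eq_imp_eq) auto
  qed
  finally show ?thesis .
qed

definition singular_weight :: "real \<Rightarrow> real \<Rightarrow> real \<Rightarrow> real" where
  "singular_weight q \<theta>0 \<theta> = cmod (cis \<theta> - cis \<theta>0) powr (-q)"

lemma singular_weight_nonneg: "0 \<le> singular_weight q \<theta>0 \<theta>"
  by (simp add: singular_weight_def)

lemma borel_measurable_singular_weight: "singular_weight q \<theta>0 \<in> borel_measurable borel"
proof -
  have "(\<lambda>\<theta>. cmod (cis \<theta> - cis \<theta>0)) \<in> borel_measurable borel"
    by (intro borel_measurable_continuous_onI continuous_intros)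
  then show ?thesis unfolding singular_weight_def by measurable
qed

text \<open>
  Two angles in \<open>[-pi, pi]\<close> may be far apart although they belong to nearby points of the circle;
  shifting one of them by a period brings them together, whence three terms. With these the circle
  never has to be rotated.
\<close>

lemma singular_weight_le:
  assumes "0 < q" "q < 1" "\<bar>\<theta>\<bar> \<le> pi" "\<bar>\<theta>0\<bar> \<le> pi"
  shows "singular_weight q \<theta>0 \<theta> \<le> 4 * (\<bar>\<theta> - \<theta>0\<bar> powr (-q) + \<bar>\<theta> - (\<theta>0 + 2 * pi)\<bar> powr (-q)
     + \<bar>\<theta> - (\<theta>0 - 2 * pi)\<bar> powr (-q))"
proof -
  have key: "singular_weight q \<theta>0 \<theta> \<le> 4 * \<bar>\<theta> - d\<bar> powr (-q)"
    if "cis d = cis \<theta>0" "\<bar>\<theta> - d\<bar> \<le> pi" for d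
  proof (cases "\<theta> = d")
    case True
    with that show ?thesis by (simp add: singular_weight_def)
  next
    case False
    have "cis \<theta> - cis \<theta>0 = cis d * (cis (\<theta> - d) - 1)"
      unfolding that(1)[symmetric] by (simp add: right_diff_distrib cis_mult)
    then have "cmod (cis \<theta> - cis \<theta>0) = cmod (cis (\<theta> - d) - 1)" by (simp add: norm_mult)
    with cmod_cis_minus_1_ge[OF that(2)] have "\<bar>\<theta> - d\<bar> / 4 \<le> cmod (cis \<theta> - cis \<theta>0)" by simp
    then have "singular_weight q \<theta>0 \<theta> \<le> (\<bar>\<theta> - d\<bar> / 4) powr (-q)"
      unfolding singular_weight_def using assms False by (intro powr_mono2') auto
    also have "\<dots> = 4 powr q * \<bar>\<theta> - d\<bar> powr (-q)"
      by (simp add: powr_divide powr_minus field_simps)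
    also have "\<dots> \<le> 4 * \<bar>\<theta> - d\<bar> powr (-q)"
      using assms powr_mono[of q 1 4] by (intro mult_right_mono) auto
    finally show ?thesis .
  qed
  have period: "cis (\<theta>0 + 2 * pi) = cis \<theta>0" "cis (\<theta>0 - 2 * pi) = cis \<theta>0"
    by (simp_all add: cis_mult[symmetric] cis_divide[symmetric])
  have "\<bar>\<theta> - \<theta>0\<bar> \<le> pi \<or> \<bar>\<theta> - (\<theta>0 + 2 * pi)\<bar> \<le> pi \<or> \<bar>\<theta> - (\<theta>0 - 2 * pi)\<bar> \<le> pi"
    using assms(3,4) by linarith
  then have "singular_weight q \<theta>0 \<theta> \<le> 4 * \<bar>\<theta> - \<theta>0\<bar> powr (-q) \<or>
      singular_weight q \<theta>0 \<theta> \<le> 4 * \<bar>\<theta> - (\<theta>0 + 2 * pi)\<bar> powr (-q) \<or>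
      singular_weight q \<theta>0 \<theta> \<le> 4 * \<bar>\<theta> - (\<theta>0 - 2 * pi)\<bar> powr (-q)"
    using key[OF refl] key[OF period(1)] key[OF period(2)] by blast
  moreover have "s \<le> 4 * (a + b + c)"
    if "s \<le> 4 * a \<or> s \<le> 4 * b \<or> s \<le> 4 * c" "0 \<le> a" "0 \<le> b" "0 \<le> c" for s a b c :: real
    using that by auto
  ultimately show ?thesis by (meson powr_ge_zero)
qed

lemma integrable_singular_weight:
  assumes "0 < q" "q < 1" "\<bar>\<theta>0\<bar> \<le> pi"
  shows "integrable circle_M (singular_weight q \<theta>0)"
proof (rule Bochner_Integration.integrable_bound)
  show "integrable circle_M (\<lambda>\<theta>. 4 * (\<bar>\<theta> - \<theta>0\<bar> powr (-q) + \<bar>\<theta> - (\<theta>0 + 2 * pi)\<bar> powr (-q)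
     + \<bar>\<theta> - (\<theta>0 - 2 * pi)\<bar> powr (-q)))"
    by (intro integrable_mult_right Bochner_Integration.integrable_add integrable_powr_circle assms)
  show "singular_weight q \<theta>0 \<in> borel_measurable circle_M"
    by (rule borel_measurable_lebesgue_on_borel[OF borel_measurable_singular_weight])
  show "AE \<theta> in circle_M. norm (singular_weight q \<theta>0 \<theta>) \<le>
     norm (4 * (\<bar>\<theta> - \<theta>0\<bar> powr (-q) + \<bar>\<theta> - (\<theta>0 + 2 * pi)\<bar> powr (-q)
     + \<bar>\<theta> - (\<theta>0 - 2 * pi)\<bar> powr (-q)))"
  proof (rule AE_I2)
    fix \<theta> assume "\<theta> \<in> space circle_M"
    then have "\<bar>\<theta>\<bar> \<le> pi" by (simp add: abs_le_iff)
    from singular_weight_le[OF assms(1,2) this assms(3)] singular_weight_nonneg[of q \<theta>0 \<theta>]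
    show "norm (singular_weight q \<theta>0 \<theta>) \<le>
     norm (4 * (\<bar>\<theta> - \<theta>0\<bar> powr (-q) + \<bar>\<theta> - (\<theta>0 + 2 * pi)\<bar> powr (-q)
     + \<bar>\<theta> - (\<theta>0 - 2 * pi)\<bar> powr (-q)))" unfolding real_norm_def by linarith
  qed
qed

lemma singular_weight_form_bound:
  assumes q: "0 < q" "q < 1" "\<bar>\<theta>0\<bar> \<le> pi" and n: "0 < n"
  shows "(LINT \<theta>|circle_M. singular_weight q \<theta>0 \<theta> * cmod (trig_poly n u \<theta>) ^ 2)
     \<le> 12 * (2 / (1 - q) + 2 * pi) * real n powr q * (l2norm n u)\<^sup>2"
proof -
  let ?T = "\<lambda>c \<theta>. \<bar>\<theta> - c\<bar> powr (-q) * cmod (trig_poly n u \<theta>) ^ 2"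
  let ?B = "(2 / (1 - q) + 2 * pi) * real n powr q * (l2norm n u)\<^sup>2"
  have int: "integrable circle_M (\<lambda>\<theta>. W \<theta> * cmod (trig_poly n u \<theta>) ^ 2)"
    if "integrable circle_M W" for W :: "real \<Rightarrow> real"
    by (rule integrable_mult_trig_poly[OF that, where B = "real n * (l2norm n u)\<^sup>2"])
       (use trig_poly_norm_le[of n u] borel_measurable_trig_poly[of n u] in simp_all)
  have T: "integrable circle_M (?T c)" for c
    by (intro int integrable_powr_circle q)
  have "(LINT \<theta>|circle_M. singular_weight q \<theta>0 \<theta> * cmod (trig_poly n u \<theta>) ^ 2)
      \<le> (LINT \<theta>|circle_M. 4 * (?T \<theta>0 \<theta> + ?T (\<theta>0 + 2 * pi) \<theta> + ?T (\<theta>0 - 2 * pi) \<theta>))"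
  proof (rule integral_mono)
    show "integrable circle_M (\<lambda>\<theta>. singular_weight q \<theta>0 \<theta> * cmod (trig_poly n u \<theta>) ^ 2)"
      by (intro int integrable_singular_weight q)
    show "integrable circle_M (\<lambda>\<theta>. 4 * (?T \<theta>0 \<theta> + ?T (\<theta>0 + 2 * pi) \<theta> + ?T (\<theta>0 - 2 * pi) \<theta>))"
      by (intro integrable_mult_right Bochner_Integration.integrable_add T)
    fix \<theta> assume "\<theta> \<in> space circle_M"
    then have "\<bar>\<theta>\<bar> \<le> pi" by (simp add: abs_le_iff)
    from mult_right_mono[OF singular_weight_le[OF q(1,2) this q(3)], of "cmod (trig_poly n u \<theta>) ^ 2"]
    show "singular_weight q \<theta>0 \<theta> * cmod (trig_poly n u \<theta>) ^ 2
      \<le> 4 * (?T \<theta>0 \<theta> + ?T (\<theta>0 + 2 * pi) \<theta> + ?T (\<theta>0 - 2 * pi) \<theta>)"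
      by (simp only: distrib_right distrib_left mult.assoc zero_le_power2 if_True simp_thms)
  qed
  also have "\<dots> = 4 * ((LINT \<theta>|circle_M. ?T \<theta>0 \<theta>) + (LINT \<theta>|circle_M. ?T (\<theta>0 + 2 * pi) \<theta>)
      + (LINT \<theta>|circle_M. ?T (\<theta>0 - 2 * pi) \<theta>))"
    by (simp only: integral_mult_right_zero Bochner_Integration.integral_add T
        Bochner_Integration.integrable_add)
  also have "\<dots> \<le> 4 * (?B + ?B + ?B)"
    by (intro mult_left_mono add_mono powr_weight_form_bound q n) simp
  also have "\<dots> = 12 * ?B" by (simp only: mult_2[symmetric]) simp
  finally show ?thesis by (simp only: mult.assoc)
qed

text \<open>
  Only the behaviour of a symbol at its singularity matters to leading order. Where the symbol is
  at most \<open>\<epsilon>\<close> times the weight, it contributes \<open>O(\<epsilon> n powr q)\<close>; elsewhere it is bounded,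
  and contributes \<open>O(1)\<close>.
\<close>

lemma toeplitz_norm_small_o:
  assumes q: "0 < q" "q < 1" "\<bar>\<theta>0\<bar> \<le> pi"
    and g: "g \<in> borel_measurable circle_M"
    and M: "AE \<theta> in circle_M. cmod (g \<theta>) \<le> M * singular_weight q \<theta>0 \<theta>"
    and local: "\<And>\<epsilon>. 0 < \<epsilon> \<Longrightarrow> \<exists>\<delta>>0. AE \<theta> in circle_M. cmod (cis \<theta> - cis \<theta>0) < \<delta> \<longrightarrow>
           cmod (g \<theta>) \<le> \<epsilon> * singular_weight q \<theta>0 \<theta>"
    and c: "\<And>k. c k = 1 / (2 * of_real pi) * (LINT \<theta>|circle_M. g \<theta> * cis (- of_int k * \<theta>))"
  shows "(\<lambda>n. toeplitz_norm c n / real n powr q) \<longlonglongrightarrow> 0"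
proof -
  define C where "C = 12 * (2 / (1 - q) + 2 * pi) / (2 * pi)"
  have C: "C > 0" using q by (simp add: C_def add_pos_pos)
  have main: "\<exists>B. \<forall>n>0. toeplitz_norm c n \<le> \<epsilon> * C * real n powr q + B" if \<epsilon>: "0 < \<epsilon>" for \<epsilon>
  proof -
    from local[OF \<epsilon>] obtain \<delta> where \<delta>: "\<delta> > 0" "AE \<theta> in circle_M. cmod (cis \<theta> - cis \<theta>0) < \<delta> \<longrightarrow>
           cmod (g \<theta>) \<le> \<epsilon> * singular_weight q \<theta>0 \<theta>" by blast
    define B where "B = \<bar>M\<bar> * \<delta> powr (-q)"
    let ?W = "\<lambda>\<theta>. \<epsilon> * singular_weight q \<theta>0 \<theta> + B"
    have const: "integrable circle_M (\<lambda>\<theta>. B)" by (intro continuous_imp_integrable_real continuous_intros)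
    have W: "integrable circle_M ?W"
      by (intro Bochner_Integration.integrable_add integrable_mult_right integrable_singular_weight q const)
    have le: "AE \<theta> in circle_M. cmod (g \<theta>) \<le> ?W \<theta>"
      using M \<delta>(2)
    proof eventually_elim
      case (elim \<theta>)
      note 1 = elim(1) and 2 = elim(2)
      show "cmod (g \<theta>) \<le> ?W \<theta>"
      proof (cases "cmod (cis \<theta> - cis \<theta>0) < \<delta>")
        case True
        with 2 show ?thesis by (simp add: B_def add_increasing2)
      next
        case False
        then have "singular_weight q \<theta>0 \<theta> \<le> \<delta> powr (-q)"
          unfolding singular_weight_def using q \<delta> by (intro powr_mono2') auto
        then have "\<bar>M\<bar> * singular_weight q \<theta>0 \<theta> \<le> B" unfolding B_def by (intro mult_left_mono) auto
        moreover have "M * singular_weight q \<theta>0 \<theta> \<le> \<bar>M\<bar> * singular_weight q \<theta>0 \<theta>"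
          by (intro mult_right_mono singular_weight_nonneg) auto
        moreover have "0 \<le> \<epsilon> * singular_weight q \<theta>0 \<theta>" using \<epsilon> by (simp add: singular_weight_nonneg)
        ultimately show ?thesis using 1 by linarith
      qed
    qed
    have "toeplitz_norm c n \<le> \<epsilon> * C * real n powr q + B" if n: "0 < n" for n
    proof (rule toeplitz_norm_le_weight[OF g W le c])
      show "0 < \<epsilon> * C * real n powr q + B" using \<epsilon> C n by (simp add: B_def add_pos_nonneg)
      fix u
      have T: "integrable circle_M (\<lambda>\<theta>. cmod (trig_poly n u \<theta>) ^ 2)"
        by (intro continuous_imp_integrable_real continuous_intros continuous_on_trig_poly)
      have S: "integrable circle_M (\<lambda>\<theta>. singular_weight q \<theta>0 \<theta> * cmod (trig_poly n u \<theta>) ^ 2)"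
        by (rule integrable_mult_trig_poly[OF integrable_singular_weight[OF q], where B = "real n * (l2norm n u)\<^sup>2"])
           (use trig_poly_norm_le[of n u] borel_measurable_trig_poly[of n u] in simp_all)
      have "(LINT \<theta>|circle_M. ?W \<theta> * cmod (trig_poly n u \<theta>) ^ 2) =
          \<epsilon> * (LINT \<theta>|circle_M. singular_weight q \<theta>0 \<theta> * cmod (trig_poly n u \<theta>) ^ 2)
          + B * (LINT \<theta>|circle_M. cmod (trig_poly n u \<theta>) ^ 2)"
        by (simp only: distrib_right mult.assoc Bochner_Integration.integral_add integral_mult_right_zero
            integrable_mult_right S T)
      also have "\<dots> \<le> \<epsilon> * (12 * (2 / (1 - q) + 2 * pi) * real n powr q * (l2norm n u)\<^sup>2) + B * (2 * pi * (l2norm n u)\<^sup>2)"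
        unfolding parseval_trig_poly using \<epsilon>
        by (intro add_mono mult_left_mono singular_weight_form_bound q n) (auto simp: B_def)
      also have "\<dots> = 2 * pi * (\<epsilon> * C * real n powr q + B) * (l2norm n u)\<^sup>2"
      proof -
        have "12 * (2 / (1 - q) + 2 * pi) = 2 * pi * C" by (simp add: C_def)
        show ?thesis unfolding \<open>12 * (2 / (1 - q) + 2 * pi) = 2 * pi * C\<close> by (simp add: algebra_simps)
      qed
      finally show "(LINT \<theta>|circle_M. ?W \<theta> * cmod (trig_poly n u \<theta>) ^ 2)
         \<le> 2 * pi * (\<epsilon> * C * real n powr q + B) * (l2norm n u)\<^sup>2" .
    qed
    then show ?thesis by blast
  qed
  show ?thesis
  proof (rule LIMSEQ_I)
    fix r :: real assume r: "0 < r"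
    define \<epsilon> where "\<epsilon> = r / (2 * C)"
    have \<epsilon>: "0 < \<epsilon>" "\<epsilon> * C = r / 2" using r C by (auto simp: \<epsilon>_def)
    from main[OF \<epsilon>(1)] obtain B where B: "\<And>n. n > 0 \<Longrightarrow> toeplitz_norm c n \<le> r / 2 * real n powr q + B"
      unfolding \<epsilon>(2) by blast
    have "(\<lambda>n. B * real n powr (-q)) \<longlonglongrightarrow> B * 0"
      by (intro tendsto_mult tendsto_const tendsto_neg_powr filterlim_real_sequentially) (use q in auto)
    then have "eventually (\<lambda>n. B * real n powr (-q) < r / 2) sequentially"
      by (rule order_tendstoD(2)) (use r in simp)
    then have "eventually (\<lambda>n. norm (toeplitz_norm c n / real n powr q - 0) < r) sequentially"
      using eventually_gt_at_top[of 0]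
    proof eventually_elim
      case (elim n)
      have "toeplitz_norm c n / real n powr q \<le> (r / 2 * real n powr q + B) / real n powr q"
        by (intro divide_right_mono B elim) simp
      also have "\<dots> = r / 2 + B * real n powr (-q)"
        using elim by (simp add: add_divide_distrib powr_minus_divide)
      also have "\<dots> < r" using elim by simp
      finally show ?case by (simp add: toeplitz_norm_nonneg)
    qed
    then show "\<exists>no. \<forall>n\<ge>no. norm (toeplitz_norm c n / real n powr q - 0) < r"
      unfolding eventually_sequentially .
  qed
qed

section \<open>Fourier coefficients of one-sided binomial symbols\<close>

text \<open>
  The Taylor coefficients of \<open>(1 - w) powr (- z)\<close>.
\<close>

definition binomial_coeff :: "complex \<Rightarrow> nat \<Rightarrow> complex" where
  "binomial_coeff z k = (-1) ^ k * ((- z) gchoose k)"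

lemma binomial_coeff_sums:
  assumes "cmod w < 1"
  shows "(\<lambda>k. binomial_coeff z k * w ^ k) sums ((1 - w) powr (-z))"
proof -
  have "(\<lambda>k. ((- z) gchoose k) * (- w) ^ k) sums (1 + (- w)) powr (-z)"
    by (rule gen_binomial_complex) (use assms in simp)
  moreover have "((- z) gchoose k) * (- w) ^ k = binomial_coeff z k * w ^ k" for k
    by (subst power_minus) (simp add: binomial_coeff_def)
  ultimately show ?thesis by simp
qed

lemma summable_norm_binomial_coeff:
  assumes "0 \<le> \<rho>" "\<rho> < 1"
  shows "summable (\<lambda>k. cmod (binomial_coeff z k) * \<rho> ^ k)"
proof -
  have "summable (\<lambda>k. binomial_coeff z k * of_real ((1 + \<rho>) / 2) ^ k)"
    by (rule sums_summable[OF binomial_coeff_sums]) (use assms in \<open>simp add: norm_divide del: of_real_add of_real_divide\<close>)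
  then have "summable (\<lambda>k. cmod (binomial_coeff z k * of_real \<rho> ^ k))"
    by (rule powser_insidea) (use assms in \<open>simp del: of_real_add of_real_divide\<close>)
  then show ?thesis using assms by (simp add: norm_mult norm_power)
qed

lemma cmod_powr_le: "cmod (w powr (-z)) \<le> exp (pi * \<bar>Im z\<bar>) * cmod w powr (- Re z)"
proof (cases "w = 0")
  case False
  have "Im z * Arg w \<le> \<bar>Im z\<bar> * pi"
  proof -
    have "\<bar>Arg w\<bar> \<le> pi" using Arg_bounded[of w] by (simp add: abs_le_iff)
    then have "\<bar>Im z * Arg w\<bar> \<le> \<bar>Im z\<bar> * pi" unfolding abs_mult by (intro mult_left_mono) auto
    then show ?thesis by linarith
  qed
  moreover have "cmod (w powr (-z)) = exp (Im z * Arg w) * exp (- Re z * ln (cmod w))"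
    using False by (simp add: powr_def Arg_eq_Im_Ln exp_add[symmetric])
  ultimately show ?thesis using False by (simp add: powr_def mult.commute)
qed simp

text \<open>
  The majorant, uniform in the radius, for passing to the boundary in the binomial series: the
  point \<open>1\<close> is, up to a factor of two, no closer to \<open>\<rho> w\<close> than to \<open>w\<close>.
\<close>

lemma radial_dominated:
  assumes "cmod w = 1" "0 \<le> \<rho>" "\<rho> \<le> 1" "w \<noteq> 1" "0 \<le> Re z" "Re z \<le> 1"
  shows "cmod ((1 - of_real \<rho> * w) powr (-z)) \<le> 2 * exp (pi * \<bar>Im z\<bar>) * cmod (1 - w) powr (- Re z)"
proof -
  have "1 - \<rho> \<le> cmod (1 - of_real \<rho> * w)"
    using norm_triangle_ineq2[of 1 "of_real \<rho> * w"] assms by (simp add: norm_mult)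
  moreover have "cmod (of_real \<rho> * w - w) = 1 - \<rho>"
  proof -
    have "of_real \<rho> * w - w = of_real (\<rho> - 1) * w" by (simp add: algebra_simps)
    then show ?thesis using assms by (simp add: norm_mult del: of_real_diff)
  qed
  moreover have "cmod (1 - w) \<le> cmod (1 - of_real \<rho> * w) + cmod (of_real \<rho> * w - w)"
    using norm_triangle_ineq[of "1 - of_real \<rho> * w" "of_real \<rho> * w - w"] by simp
  ultimately have half: "cmod (1 - w) / 2 \<le> cmod (1 - of_real \<rho> * w)" by simp
  have "cmod ((1 - of_real \<rho> * w) powr (-z)) \<le> exp (pi * \<bar>Im z\<bar>) * cmod (1 - of_real \<rho> * w) powr (- Re z)"
    by (rule cmod_powr_le)
  also have "\<dots> \<le> exp (pi * \<bar>Im z\<bar>) * (cmod (1 - w) / 2) powr (- Re z)"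
    using half assms by (intro mult_left_mono powr_mono2') auto
  also have "(cmod (1 - w) / 2) powr (- Re z) = 2 powr Re z * cmod (1 - w) powr (- Re z)"
    by (simp add: powr_divide powr_minus_divide)
  also have "exp (pi * \<bar>Im z\<bar>) * (2 powr Re z * cmod (1 - w) powr (- Re z)) \<le>
      exp (pi * \<bar>Im z\<bar>) * (2 * cmod (1 - w) powr (- Re z))"
    using powr_mono[of "Re z" 1 2] assms by (intro mult_left_mono mult_right_mono) auto
  finally show ?thesis by (simp add: ac_simps)
qed

lemma integral_cis_shift:
  "(LINT \<theta>|circle_M. cis (of_int m * (\<theta> - \<theta>0)) * cis (- of_int j * \<theta>)) =
     (if m = j then 2 * of_real pi * cis (- of_int j * \<theta>0) else 0)"
proof -
  have "cis (of_int m * (\<theta> - \<theta>0)) * cis (- of_int j * \<theta>) = cis (- of_int m * \<theta>0) * cis (of_int (m - j) * \<theta>)" for \<theta>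
    by (simp add: cis_mult algebra_simps)
  then show ?thesis using integral_cis[of "m - j"] by simp
qed

lemma AE_cis_ne: "AE \<theta> in circle_M. cis \<theta> \<noteq> cis \<theta>0"
proof -
  have "{\<theta>. cis \<theta> = cis \<theta>0} \<subseteq> (\<lambda>n::int. \<theta>0 + of_int n * 2 * pi) ` UNIV"
  proof safe
    fix \<theta> assume "cis \<theta> = cis \<theta>0"
    then have "cis (\<theta> - \<theta>0) = 1" by (simp add: cis_divide[symmetric])
    then have "cos (\<theta> - \<theta>0) = 1" by (metis cis.simps(1) one_complex.simps(1))
    then obtain n :: int where "\<theta> - \<theta>0 = of_int n * 2 * pi" by (auto simp: cos_one_2pi_int)
    then have "\<theta> = \<theta>0 + of_int n * 2 * pi" by simp
    then show "\<theta> \<in> (\<lambda>n::int. \<theta>0 + of_int n * 2 * pi) ` UNIV" by blast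
  qed
  then have "countable {\<theta>. cis \<theta> = cis \<theta>0}" by (rule countable_subset) simp
  then have "{\<theta>. cis \<theta> = cis \<theta>0} \<in> null_sets lborel" by (rule countable_imp_null_set_lborel)
  then have "AE \<theta> in lborel. cis \<theta> \<noteq> cis \<theta>0" by (rule AE_I') auto
  then have "AE \<theta> in lebesgue. cis \<theta> \<noteq> cis \<theta>0" by (rule AE_completion)
  then show ?thesis by (simp add: AE_restrict_space_iff) (auto elim: eventually_mono)
qed

lemma cmod_one_minus_cis:
  assumes "e = 1 \<or> e = -1"
  shows "cmod (1 - cis (of_int e * (\<theta> - \<theta>0))) = cmod (cis \<theta> - cis \<theta>0)"
  using assms
proof
  assume "e = 1"
  have "cis \<theta>0 - cis \<theta> = cis \<theta>0 * (1 - cis (\<theta> - \<theta>0))" by (simp add: right_diff_distrib cis_mult)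
  then have "cmod (cis \<theta>0 - cis \<theta>) = cmod (1 - cis (\<theta> - \<theta>0))" by (simp add: norm_mult)
  with \<open>e = 1\<close> show ?thesis by (simp add: norm_minus_commute)
next
  assume "e = -1"
  have "cis \<theta> - cis \<theta>0 = cis \<theta> * (1 - cis (-(\<theta> - \<theta>0)))" by (simp add: right_diff_distrib cis_mult)
  then have "cmod (cis \<theta> - cis \<theta>0) = cmod (1 - cis (-(\<theta> - \<theta>0)))" by (simp add: norm_mult)
  with \<open>e = -1\<close> show ?thesis by simp
qed

lemma Re_one_minus_unit_pos:
  assumes "cmod w = 1" "w \<noteq> 1"
  shows "0 < Re (1 - w)"
proof -
  have "Re w \<le> 1" using complex_Re_le_cmod[of w] assms by simp
  moreover have "Re w \<noteq> 1"
  proof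
    assume "Re w = 1"
    moreover have "(Re w)\<^sup>2 + (Im w)\<^sup>2 = 1" using assms(1) cmod_power2[of w] by simp
    ultimately have "w = 1" by (simp add: complex_eq_iff)
    with assms show False by simp
  qed
  ultimately show ?thesis by simp
qed

text \<open>
  The boundary values of the binomial series (\<open>e = 1\<close>) and of its reflection (\<open>e = -1\<close>). The
  former has Fourier coefficients at nonnegative indices only, the latter at nonpositive ones.
\<close>

definition branch :: "complex \<Rightarrow> real \<Rightarrow> int \<Rightarrow> real \<Rightarrow> complex" where
  "branch z \<theta>0 e \<theta> = (1 - cis (of_int e * (\<theta> - \<theta>0))) powr (-z)"

lemma radial_coeff:
  assumes e: "e = 1 \<or> e = -1" and \<rho>: "0 \<le> \<rho>" "\<rho> < 1"
  shows "(LINT \<theta>|circle_M. (1 - of_real \<rho> * cis (of_int e * (\<theta> - \<theta>0))) powr (-z) * cis (- of_int j * \<theta>)) =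
     (if 0 \<le> e * j then 2 * of_real pi * (binomial_coeff z (nat (e * j)) * of_real \<rho> ^ nat (e * j) * cis (- of_int j * \<theta>0)) else 0)"
proof -
  let ?f = "\<lambda>k \<theta>. binomial_coeff z k * of_real \<rho> ^ k *
      (cis (of_int (e * int k) * (\<theta> - \<theta>0)) * cis (- of_int j * \<theta>))"
  have sums: "(\<lambda>k. ?f k \<theta>) sums ((1 - of_real \<rho> * cis (of_int e * (\<theta> - \<theta>0))) powr (-z) * cis (- of_int j * \<theta>))" for \<theta>
  proof -
    have "cmod (of_real \<rho> * cis (of_int e * (\<theta> - \<theta>0))) < 1" using \<rho> by (simp add: norm_mult)
    from sums_mult2[OF binomial_coeff_sums[OF this, of z], of "cis (- of_int j * \<theta>)"]
    have "(\<lambda>k. binomial_coeff z k * (of_real \<rho> * cis (of_int e * (\<theta> - \<theta>0))) ^ k * cis (- of_int j * \<theta>)) sums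
      ((1 - of_real \<rho> * cis (of_int e * (\<theta> - \<theta>0))) powr (-z) * cis (- of_int j * \<theta>))" .
    moreover have "cis (of_int e * (\<theta> - \<theta>0)) ^ k = cis (of_int (e * int k) * (\<theta> - \<theta>0))" for k
      by (simp add: Complex.DeMoivre ac_simps)
    ultimately show ?thesis by (simp only: power_mult_distrib mult.assoc)
  qed
  have int: "integrable circle_M (?f k)" for k
    by (intro continuous_imp_integrable_real continuous_intros)
  have norm_f: "cmod (?f k \<theta>) = cmod (binomial_coeff z k) * \<rho> ^ k" for k \<theta>
    using \<rho> by (simp add: norm_mult norm_power)
  have coeff: "(LINT \<theta>|circle_M. ?f k \<theta>) = (if e * int k = j then
      2 * of_real pi * (binomial_coeff z k * of_real \<rho> ^ k * cis (- of_int j * \<theta>0)) else 0)" for k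
    by (simp only: integral_mult_right_zero integral_cis_shift) (simp add: ac_simps)
  have "(LINT \<theta>|circle_M. (\<Sum>k. ?f k \<theta>)) = (\<Sum>k. LINT \<theta>|circle_M. ?f k \<theta>)"
  proof (rule integral_suminf[OF int])
    show "AE \<theta> in circle_M. summable (\<lambda>k. norm (?f k \<theta>))"
      unfolding norm_f using summable_norm_binomial_coeff[OF \<rho>] by simp
    show "summable (\<lambda>k. LINT \<theta>|circle_M. norm (?f k \<theta>))"
      unfolding norm_f using summable_mult[OF summable_norm_binomial_coeff[OF \<rho>, of z], of "2 * pi"]
      by (simp add: measure_restrict_space)
  qed
  also have "\<dots> = (\<Sum>k. if e * int k = j then
      2 * of_real pi * (binomial_coeff z k * of_real \<rho> ^ k * cis (- of_int j * \<theta>0)) else 0)"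
    by (simp only: coeff)
  also have "(\<Sum>k. if e * int k = j then
      2 * of_real pi * (binomial_coeff z k * of_real \<rho> ^ k * cis (- of_int j * \<theta>0)) else 0) =
     (if 0 \<le> e * j then 2 * of_real pi * (binomial_coeff z (nat (e * j)) * of_real \<rho> ^ nat (e * j) * cis (- of_int j * \<theta>0)) else 0)"
  proof (cases "0 \<le> e * j")
    case True
    have "e * int k = j \<longleftrightarrow> k = nat (e * j)" for k using e True by auto
    then show ?thesis using True
      by (simp add: sums_unique[OF sums_single, symmetric])
  next
    case False
    have "e * int k \<noteq> j" for k using e False by auto
    then show ?thesis using False by simp
  qed
  finally show ?thesis by (simp only: sums_unique[OF sums, symmetric])
qed

lemma branch_measurable: "branch z \<theta>0 e \<in> borel_measurable borel"
proof -
  have "(\<lambda>\<theta>. 1 - cis (of_int e * (\<theta> - \<theta>0))) \<in> borel_measurable borel"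
    by (intro borel_measurable_continuous_onI continuous_intros)
  then show ?thesis unfolding branch_def by measurable
qed

lemma branch_le:
  assumes "e = 1 \<or> e = -1"
  shows "cmod (branch z \<theta>0 e \<theta>) \<le> exp (pi * \<bar>Im z\<bar>) * singular_weight (Re z) \<theta>0 \<theta>"
  using cmod_powr_le[of "1 - cis (of_int e * (\<theta> - \<theta>0))" z] cmod_one_minus_cis[OF assms, of \<theta> \<theta>0]
  by (simp add: branch_def singular_weight_def)

text \<open>
  Inside the disc the coefficients are read off from the series; dominated convergence carries them
  to the boundary.
\<close>

lemma branch_coeff:
  assumes e: "e = 1 \<or> e = -1" and z: "0 < Re z" "Re z < 1" "\<bar>\<theta>0\<bar> \<le> pi"
  shows "(LINT \<theta>|circle_M. branch z \<theta>0 e \<theta> * cis (- of_int j * \<theta>)) =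
     (if 0 \<le> e * j then 2 * of_real pi * (binomial_coeff z (nat (e * j)) * cis (- of_int j * \<theta>0)) else 0)"
proof -
  define \<rho> :: "nat \<Rightarrow> real" where "\<rho> m = 1 - inverse (real (Suc m))" for m
  have \<rho>: "0 \<le> \<rho> m" "\<rho> m < 1" for m by (auto simp: \<rho>_def field_simps)
  have \<rho>_lim: "\<rho> \<longlonglongrightarrow> 1"
    unfolding \<rho>_def using tendsto_diff[OF tendsto_const LIMSEQ_inverse_real_of_nat, of 1] by simp
  let ?w = "\<lambda>\<theta>. cis (of_int e * (\<theta> - \<theta>0))"
  let ?s = "\<lambda>m \<theta>. (1 - of_real (\<rho> m) * ?w \<theta>) powr (-z) * cis (- of_int j * \<theta>)"
  have "(\<lambda>m. LINT \<theta>|circle_M. ?s m \<theta>) \<longlonglongrightarrow> (LINT \<theta>|circle_M. branch z \<theta>0 e \<theta> * cis (- of_int j * \<theta>))"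
  proof (rule integral_dominated_convergence)
    let ?W = "\<lambda>\<theta>. 2 * exp (pi * \<bar>Im z\<bar>) * singular_weight (Re z) \<theta>0 \<theta>"
    have cis_meas: "(\<lambda>\<theta>. cis (- of_int j * \<theta>)) \<in> borel_measurable borel"
      by (intro borel_measurable_continuous_onI continuous_intros)
    show "(\<lambda>\<theta>. branch z \<theta>0 e \<theta> * cis (- of_int j * \<theta>)) \<in> borel_measurable circle_M"
      by (intro borel_measurable_lebesgue_on_borel borel_measurable_times branch_measurable cis_meas)
    have base_meas: "(\<lambda>\<theta>. 1 - of_real (\<rho> m) * ?w \<theta>) \<in> borel_measurable borel" for m
      by (intro borel_measurable_continuous_onI continuous_intros)
    have "?s m \<in> borel_measurable borel" for m
      using base_meas[of m] cis_meas by measurable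
    then show "?s m \<in> borel_measurable circle_M" for m
      by (rule borel_measurable_lebesgue_on_borel)
    show "integrable circle_M ?W" by (intro integrable_mult_right integrable_singular_weight z)
    have ne: "AE \<theta> in circle_M. ?w \<theta> \<noteq> 1"
      using AE_cis_ne[of \<theta>0]
    proof eventually_elim
      case (elim \<theta>)
      then have "cmod (1 - ?w \<theta>) \<noteq> 0" using cmod_one_minus_cis[OF e, of \<theta> \<theta>0] by simp
      then show ?case by auto
    qed
    show "AE \<theta> in circle_M. (\<lambda>m. ?s m \<theta>) \<longlonglongrightarrow> branch z \<theta>0 e \<theta> * cis (- of_int j * \<theta>)"
      using ne
    proof eventually_elim
      case (elim \<theta>)
      have "0 < Re (1 - ?w \<theta>)" by (rule Re_one_minus_unit_pos) (use elim in auto)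
      then have "1 - ?w \<theta> \<notin> \<real>\<^sub>\<le>\<^sub>0" using complex_nonpos_Reals_iff by auto
      moreover have "(\<lambda>m. 1 - of_real (\<rho> m) * ?w \<theta>) \<longlonglongrightarrow> 1 - of_real 1 * ?w \<theta>"
        by (intro tendsto_intros \<rho>_lim)
      ultimately show ?case unfolding branch_def
        by (intro tendsto_mult tendsto_const tendsto_powr_complex) auto
    qed
    show "AE \<theta> in circle_M. norm (?s m \<theta>) \<le> ?W \<theta>" for m
      using ne
    proof eventually_elim
      case (elim \<theta>)
      from radial_dominated[of "?w \<theta>" "\<rho> m" z] \<rho>[of m] z elim
      show ?case by (simp add: norm_mult singular_weight_def cmod_one_minus_cis[OF e])
    qed
  qed
  moreover have "(\<lambda>m. LINT \<theta>|circle_M. ?s m \<theta>) \<longlonglongrightarrow>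
     (if 0 \<le> e * j then 2 * of_real pi * (binomial_coeff z (nat (e * j)) * cis (- of_int j * \<theta>0)) else 0)"
  proof (cases "0 \<le> e * j")
    case True
    have "(\<lambda>m. 2 * of_real pi * (binomial_coeff z (nat (e * j)) * of_real (\<rho> m) ^ nat (e * j) * cis (- of_int j * \<theta>0)))
      \<longlonglongrightarrow> 2 * of_real pi * (binomial_coeff z (nat (e * j)) * of_real 1 ^ nat (e * j) * cis (- of_int j * \<theta>0))"
      by (intro tendsto_intros \<rho>_lim)
    then show ?thesis unfolding radial_coeff[OF e \<rho>] using True
      by (simp only: if_True of_real_1 power_one mult_1_right)
  next
    case False
    then show ?thesis unfolding radial_coeff[OF e \<rho>] by simp
  qed
  ultimately show ?thesis by (rule LIMSEQ_unique)
qed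

section \<open>Coefficients close to a homogeneous kernel\<close>

lemma binomial_coeff_asymp:
  "(\<lambda>n. binomial_coeff z n / of_real (real n) powr (z - 1)) \<longlonglongrightarrow> inverse (Gamma z)"
proof (rule Lim_transform_eventually)
  show "(\<lambda>n. ((- z) gchoose n) / ((-1) ^ n / exp ((- z + 1) * of_real (ln (real n))))) \<longlonglongrightarrow> inverse (Gamma z)"
    using gbinomial_asymptotic[of "- z"] by simp
  show "eventually (\<lambda>n. ((- z) gchoose n) / ((-1) ^ n / exp ((- z + 1) * of_real (ln (real n)))) =
      binomial_coeff z n / of_real (real n) powr (z - 1)) sequentially"
    using eventually_gt_at_top[of 0]
  proof eventually_elim
    case (elim n)
    have "exp ((- z + 1) * of_real (ln (real n))) = inverse (exp ((z - 1) * of_real (ln (real n))))"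
      by (simp add: exp_minus[symmetric] algebra_simps)
    also have "exp ((z - 1) * of_real (ln (real n))) = of_real (real n) powr (z - 1)"
      using elim by (simp add: powr_def Ln_of_real[symmetric] del: Ln_of_nat)
    finally have "exp ((- z + 1) * of_real (ln (real n))) = inverse (of_real (real n) powr (z - 1))" .
    moreover have "inverse ((-1) ^ n) = (-1 :: complex) ^ n" by (simp add: power_inverse[symmetric])
    ultimately show ?case by (simp add: binomial_coeff_def divide_inverse mult.commute)
  qed
qed

text \<open>
  The convolution kernel that is homogeneous of degree \<open>z - 1\<close> on each half-line. Homogeneity is
  what links the integer scale of a matrix with the unit interval.
\<close>

definition conv_kernel :: "complex \<Rightarrow> complex \<Rightarrow> complex \<Rightarrow> real \<Rightarrow> complex" where
  "conv_kernel z L M t = (if t > 0 then L * of_real t powr (z - 1)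
     else if t < 0 then M * of_real (- t) powr (z - 1) else 0)"

lemma cmod_of_real_powr: "0 \<le> t \<Longrightarrow> cmod (of_real t powr w) = t powr Re w"
  using norm_powr_real_powr[of "of_real t" w] by simp

lemma conv_kernel_le: "cmod (conv_kernel z L M t) \<le> max (cmod L) (cmod M) * \<bar>t\<bar> powr (Re z - 1)"
proof -
  have "a * \<bar>t\<bar> powr (Re z - 1) \<le> max a b * \<bar>t\<bar> powr (Re z - 1)"
    "b * \<bar>t\<bar> powr (Re z - 1) \<le> max a b * \<bar>t\<bar> powr (Re z - 1)" for a b
    by (intro mult_right_mono; simp)+
  then show ?thesis
    by (auto simp: conv_kernel_def norm_mult cmod_of_real_powr le_max_iff_disj simp del: of_real_minus)
qed

lemma conv_kernel_scale:
  assumes "0 < c"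
  shows "conv_kernel z L M (c * t) = of_real c powr (z - 1) * conv_kernel z L M t"
proof -
  have "of_real (c * s) powr w = of_real c powr w * (of_real s powr w :: complex)" if "0 \<le> s" for s w
    using powr_times_real[of "of_real c" "of_real s" w] assms that by simp
  from this[of t "z - 1"] this[of "- t" "z - 1"] assms show ?thesis
    by (auto simp: conv_kernel_def zero_less_mult_iff mult_less_0_iff simp del: of_real_mult of_real_minus)
qed

text \<open>
  Divided by \<open>\<tau> powr (z - 1)\<close>, the difference becomes \<open>w P - L\<close> with \<open>w \<rightarrow> L\<close> and
  \<open>P = (n / \<tau>) powr (z - 1) \<rightarrow> 1\<close>, because \<open>|n / \<tau> - 1| < 1 / \<tau>\<close>.
\<close>

lemma regularly_varying_shift:
  fixes c :: "nat \<Rightarrow> complex"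
  assumes lim: "(\<lambda>n. c n / of_real (real n) powr (z - 1)) \<longlonglongrightarrow> L" and \<epsilon>: "0 < \<epsilon>"
  shows "\<exists>R\<ge>2. \<forall>\<tau> n. R \<le> \<tau> \<and> \<bar>\<tau> - real n\<bar> < 1 \<longrightarrow>
     cmod (c n - L * of_real \<tau> powr (z - 1)) \<le> \<epsilon> * \<tau> powr (Re z - 1)"
proof -
  define \<eta> where "\<eta> = min 1 (\<epsilon> / (2 + cmod L))"
  have pos: "0 < 2 + cmod L" by (simp add: add_pos_nonneg)
  have "\<eta> \<le> \<epsilon> / (2 + cmod L)" by (simp add: \<eta>_def)
  then have "\<eta> * (2 + cmod L) \<le> \<epsilon>" using pos by (simp only: pos_le_divide_eq)
  moreover have "0 < \<eta>" "\<eta> \<le> 1" using \<epsilon> pos by (simp_all add: \<eta>_def)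
  ultimately have \<eta>: "0 < \<eta>" "\<eta> \<le> 1" "\<eta> * (2 + cmod L) \<le> \<epsilon>" by blast+
  have "isCont (\<lambda>p::real. of_real p powr (z - 1) :: complex) 1"
    by (intro continuous_intros) auto
  then have "\<exists>d>0. \<forall>p. \<bar>p - 1\<bar> < d \<longrightarrow> cmod (of_real p powr (z - 1) - 1) < \<eta>"
    unfolding continuous_at_eps_delta dist_norm using \<eta>(1) by simp
  then obtain d where d: "d > 0" "\<And>p. \<bar>p - 1\<bar> < d \<Longrightarrow> cmod (of_real p powr (z - 1) - 1) < \<eta>" by blast
  obtain N where N: "\<And>n. n \<ge> N \<Longrightarrow> cmod (c n / of_real (real n) powr (z - 1) - L) < \<eta>"
    using LIMSEQ_D[OF lim \<eta>(1)] by blast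
  define R where "R = max 2 (max (real N + 1) (1 / d))"
  have "cmod (c n - L * of_real \<tau> powr (z - 1)) \<le> \<epsilon> * \<tau> powr (Re z - 1)"
    if "R \<le> \<tau>" "\<bar>\<tau> - real n\<bar> < 1" for \<tau> n
  proof -
    have \<tau>: "2 \<le> \<tau>" "real N + 1 \<le> \<tau>" "1 / d \<le> \<tau>" using that by (auto simp: R_def)
    have n: "real n > 0" "n \<ge> N" using that \<tau> by linarith+
    define w where "w = c n / of_real (real n) powr (z - 1)"
    define P where "P = (of_real (real n / \<tau>) powr (z - 1) :: complex)"
    define T where "T = (of_real \<tau> powr (z - 1) :: complex)"
    have "\<bar>real n / \<tau> - 1\<bar> = \<bar>\<tau> - real n\<bar> / \<tau>" using \<tau> by (simp add: field_simps abs_if)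
    also have "\<dots> < 1 / \<tau>" using that \<tau> by (intro divide_strict_right_mono) auto
    also have "1 / \<tau> \<le> d" using \<tau> d(1) by (simp add: field_simps)
    finally have "cmod (P - 1) < \<eta>" unfolding P_def by (rule d(2))
    moreover have "cmod (w - L) < \<eta>" unfolding w_def by (rule N) (rule n)
    ultimately have PL: "cmod (P - 1) \<le> \<eta>" "cmod (w - L) \<le> \<eta>" by simp_all
    have "P * T = of_real (real n / \<tau> * \<tau>) powr (z - 1)"
      unfolding P_def T_def using powr_times_real[of "of_real (real n / \<tau>)" "of_real \<tau>" "z - 1"] \<tau> n by simp
    also have "real n / \<tau> * \<tau> = real n" using \<tau> by simp
    finally have PT: "P * T = of_real (real n) powr (z - 1)" .
    have "c n = w * (P * T)" unfolding PT w_def using n by simp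
    then have "c n - L * T = ((w - L) * (P - 1) + (w - L) + L * (P - 1)) * T" by (simp add: algebra_simps)
    also have "cmod \<dots> = cmod ((w - L) * (P - 1) + (w - L) + L * (P - 1)) * \<tau> powr (Re z - 1)"
      unfolding T_def norm_mult using \<tau> by (simp add: cmod_of_real_powr)
    also have "\<dots> \<le> \<epsilon> * \<tau> powr (Re z - 1)"
    proof (rule mult_right_mono)
      have "cmod ((w - L) * (P - 1) + (w - L) + L * (P - 1)) \<le>
         cmod (w - L) * cmod (P - 1) + cmod (w - L) + cmod L * cmod (P - 1)"
        by (intro norm_triangle_le add_mono) (simp_all add: norm_mult)
      also have "\<dots> \<le> 1 * \<eta> + \<eta> + cmod L * \<eta>"
        using PL \<eta> by (intro add_mono mult_mono) auto
      also have "\<dots> \<le> \<epsilon>" using \<eta>(3) by (simp add: algebra_simps)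
      finally show "cmod ((w - L) * (P - 1) + (w - L) + L * (P - 1)) \<le> \<epsilon>" .
    qed simp
    finally show ?thesis by (simp add: T_def)
  qed
  then show ?thesis by (intro exI[of _ R]) (auto simp: R_def)
qed

text \<open>
  For large \<open>\<tau>\<close> the first summand alone suffices. On a bounded range of \<open>\<tau>\<close> there is only an
  \<open>O(1 + |\<tau>| powr (Re z - 1))\<close> bound, which the second summand absorbs. Any exponent strictly
  between \<open>-1\<close> and \<open>Re z - 1\<close> would serve there: it is still integrable at \<open>0\<close>, and it gains a
  negative power of \<open>n\<close> under rescaling.
\<close>

lemma coefficients_near_kernel:
  fixes s :: "int \<Rightarrow> complex"
  assumes z: "0 < Re z" "Re z < 1"
    and L: "(\<lambda>n. s (int n) / of_real (real n) powr (z - 1)) \<longlonglongrightarrow> L"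
    and M: "(\<lambda>n. s (- int n) / of_real (real n) powr (z - 1)) \<longlonglongrightarrow> M"
    and \<epsilon>: "0 < \<epsilon>"
  shows "\<exists>C\<ge>0. \<forall>\<tau> i. \<tau> \<noteq> 0 \<and> \<bar>\<tau> - of_int i\<bar> < 1 \<longrightarrow>
     cmod (s i - conv_kernel z L M \<tau>) \<le> \<epsilon> * \<bar>\<tau>\<bar> powr (Re z - 1) + C * \<bar>\<tau>\<bar> powr (Re z / 2 - 1)"
proof -
  from regularly_varying_shift[OF L \<epsilon>] obtain R1 where R1: "R1 \<ge> 2"
    "\<And>\<tau> n. R1 \<le> \<tau> \<Longrightarrow> \<bar>\<tau> - real n\<bar> < 1 \<Longrightarrow>
       cmod (s (int n) - L * of_real \<tau> powr (z - 1)) \<le> \<epsilon> * \<tau> powr (Re z - 1)" by blast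
  from regularly_varying_shift[OF M \<epsilon>] obtain R2 where R2: "R2 \<ge> 2"
    "\<And>\<tau> n. R2 \<le> \<tau> \<Longrightarrow> \<bar>\<tau> - real n\<bar> < 1 \<Longrightarrow>
       cmod (s (- int n) - M * of_real \<tau> powr (z - 1)) \<le> \<epsilon> * \<tau> powr (Re z - 1)" by blast
  define R where "R = max R1 R2"
  define I where "I = {- \<lceil>R + 1\<rceil>..\<lceil>R + 1\<rceil>}"
  define S where "S = (\<Sum>i\<in>I. cmod (s i))"
  have S: "cmod (s i) \<le> S" if "i \<in> I" for i
    unfolding S_def by (rule member_le_sum) (use that in \<open>auto simp: I_def\<close>)
  have S0: "0 \<le> S" unfolding S_def by (simp add: sum_nonneg)
  define C where "C = S * R powr (1 - Re z / 2) + max (cmod L) (cmod M) * R powr (Re z / 2)"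
  have C0: "0 \<le> C" using S0 by (simp add: C_def le_max_iff_disj)
  have "cmod (s i - conv_kernel z L M \<tau>) \<le> \<epsilon> * \<bar>\<tau>\<bar> powr (Re z - 1) + C * \<bar>\<tau>\<bar> powr (Re z / 2 - 1)"
    if \<tau>: "\<tau> \<noteq> 0" "\<bar>\<tau> - of_int i\<bar> < 1" for \<tau> i
  proof (cases "\<bar>\<tau>\<bar> < R")
    case True
    have "\<bar>of_int i\<bar> \<le> R + 1" using True \<tau> by linarith
    then have "i \<in> I" unfolding I_def by (simp add: abs_le_iff) linarith
    have R0: "R > 0" using R1 by (simp add: R_def)
    have "cmod (s i) \<le> S * (R powr (1 - Re z / 2) * \<bar>\<tau>\<bar> powr (Re z / 2 - 1))"
    proof -
      have "R powr (Re z / 2 - 1) \<le> \<bar>\<tau>\<bar> powr (Re z / 2 - 1)"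
        using True \<tau> z by (intro powr_mono2') auto
      then have "R powr (1 - Re z / 2) * R powr (Re z / 2 - 1) \<le> R powr (1 - Re z / 2) * \<bar>\<tau>\<bar> powr (Re z / 2 - 1)"
        by (rule mult_left_mono) simp
      moreover have "R powr (1 - Re z / 2) * R powr (Re z / 2 - 1) = 1"
        using R0 by (simp add: powr_add[symmetric])
      ultimately have "S * 1 \<le> S * (R powr (1 - Re z / 2) * \<bar>\<tau>\<bar> powr (Re z / 2 - 1))"
        using S0 by (intro mult_left_mono) auto
      then show ?thesis using S[OF \<open>i \<in> I\<close>] by simp
    qed
    moreover have "cmod (conv_kernel z L M \<tau>) \<le> max (cmod L) (cmod M) * (R powr (Re z / 2) * \<bar>\<tau>\<bar> powr (Re z / 2 - 1))"
    proof -
      have "\<bar>\<tau>\<bar> powr (Re z - 1) = \<bar>\<tau>\<bar> powr (Re z / 2) * \<bar>\<tau>\<bar> powr (Re z / 2 - 1)"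
        by (simp add: powr_add[symmetric])
      also have "\<dots> \<le> R powr (Re z / 2) * \<bar>\<tau>\<bar> powr (Re z / 2 - 1)"
        using True z by (intro mult_right_mono powr_mono2) auto
      finally have "max (cmod L) (cmod M) * \<bar>\<tau>\<bar> powr (Re z - 1) \<le>
         max (cmod L) (cmod M) * (R powr (Re z / 2) * \<bar>\<tau>\<bar> powr (Re z / 2 - 1))"
        by (rule mult_left_mono) (simp add: le_max_iff_disj)
      then show ?thesis using conv_kernel_le[of z L M \<tau>] by linarith
    qed
    moreover have "cmod (s i - conv_kernel z L M \<tau>) \<le> cmod (s i) + cmod (conv_kernel z L M \<tau>)"
      by (rule norm_triangle_ineq4)
    moreover have "C * \<bar>\<tau>\<bar> powr (Re z / 2 - 1) = S * (R powr (1 - Re z / 2) * \<bar>\<tau>\<bar> powr (Re z / 2 - 1)) +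
       max (cmod L) (cmod M) * (R powr (Re z / 2) * \<bar>\<tau>\<bar> powr (Re z / 2 - 1))"
      by (simp add: C_def algebra_simps)
    moreover have "0 \<le> \<epsilon> * \<bar>\<tau>\<bar> powr (Re z - 1)" using \<epsilon> by simp
    ultimately show ?thesis by linarith
  next
    case False
    have extra: "0 \<le> C * \<bar>\<tau>\<bar> powr (Re z / 2 - 1)" using C0 by simp
    show ?thesis
    proof (cases "\<tau> > 0")
      case True
      with False have ge: "R1 \<le> \<tau>" by (simp add: R_def)
      then have "i \<ge> 0" using \<tau>(2) R1(1) by linarith
      then obtain n where n: "i = int n" using nonneg_int_cases by blast
      from R1(2)[OF ge, of n] \<tau>(2) True extra show ?thesis by (simp add: n conv_kernel_def)
    next
      case neg: False
      with False \<tau>(1) have ge: "R2 \<le> - \<tau>" by (simp add: R_def)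
      then have "i \<le> 0" using \<tau>(2) R2(1) by linarith
      then obtain n where n: "i = - int n" using nonpos_int_cases by blast
      have "\<bar>- \<tau> - real n\<bar> < 1" using \<tau>(2) n by simp
      from R2(2)[OF ge this] neg \<tau>(1) extra show ?thesis by (simp add: n conv_kernel_def)
    qed
  qed
  with C0 show ?thesis by blast
qed

section \<open>The Schur test on the unit interval\<close>

abbreviation unit_M :: "real measure" where
  "unit_M \<equiv> lebesgue_on {0<..<1}"

lemma finite_unit_M: "finite_measure unit_M"
  by (rule finite_measure_lebesgue_on) simp

interpretation unit: finite_measure unit_M
  by (rule finite_unit_M)

interpretation unit_pair: pair_sigma_finite unit_M unit_M
  by unfold_locales

lemma L2_spaceD:
  assumes "f \<in> L2_space"
  shows "f \<in> borel_measurable unit_M" "integrable unit_M (\<lambda>x. (cmod (f x))\<^sup>2)"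
  using assms by (auto simp: L2_space_def)

lemma L2_norm_nonneg: "0 \<le> L2_norm f"
  by (simp add: L2_norm_def)

lemma L2_norm_sq: "(L2_norm f)\<^sup>2 = (LINT x|unit_M. (cmod (f x))\<^sup>2)"
  by (simp add: L2_norm_def)

lemma L2_norm_sq_nn:
  assumes "f \<in> L2_space"
  shows "(\<integral>\<^sup>+x. ennreal ((cmod (f x))\<^sup>2) \<partial>unit_M) = ennreal ((L2_norm f)\<^sup>2)"
  unfolding L2_norm_sq by (rule nn_integral_eq_integral) (use L2_spaceD[OF assms] in auto)

lemma L2_intro_nn:
  assumes "g \<in> borel_measurable unit_M" "0 \<le> B"
    and le: "(\<integral>\<^sup>+x. ennreal ((cmod (g x))\<^sup>2) \<partial>unit_M) \<le> ennreal (B\<^sup>2)"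
  shows "g \<in> L2_space" "L2_norm g \<le> B"
proof -
  have meas: "(\<lambda>x. (cmod (g x))\<^sup>2) \<in> borel_measurable unit_M" using assms(1) by measurable
  have int: "integrable unit_M (\<lambda>x. (cmod (g x))\<^sup>2)"
    by (rule integrableI_nonneg[OF meas]) (use le in \<open>auto intro: le_less_trans\<close>)
  then show "g \<in> L2_space" using assms(1) by (simp add: L2_space_def)
  have "ennreal ((L2_norm g)\<^sup>2) \<le> ennreal (B\<^sup>2)"
    using le L2_norm_sq_nn[OF \<open>g \<in> L2_space\<close>] by simp
  then have "(L2_norm g)\<^sup>2 \<le> B\<^sup>2" by simp
  then show "L2_norm g \<le> B" by (rule power2_le_imp_le) (rule assms(2))
qed

lemma L2_norm_cong_AE:
  assumes "f \<in> borel_measurable unit_M" "g \<in> borel_measurable unit_M"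
    and "AE x in unit_M. f x = g x"
  shows "L2_norm f = L2_norm g"
proof -
  have "(LINT x|unit_M. (cmod (f x))\<^sup>2) = (LINT x|unit_M. (cmod (g x))\<^sup>2)"
  proof (rule integral_cong_AE)
    show "AE x in unit_M. (cmod (f x))\<^sup>2 = (cmod (g x))\<^sup>2" using assms(3) by eventually_elim simp
  qed (use assms(1,2) in measurable)
  then show ?thesis by (simp add: L2_norm_def)
qed

text \<open>
  Minkowski's inequality, from \<open>|u + v|\<^sup>2 \<le> (1 + b/a) |u|\<^sup>2 + (1 + a/b) |v|\<^sup>2\<close> with
  \<open>a\<close> and \<open>b\<close> slightly above the two norms, so that neither is zero.
\<close>

lemma L2_norm_add_le:
  assumes f: "f \<in> L2_space" and g: "g \<in> L2_space"
  shows "(\<lambda>x. f x + g x) \<in> L2_space" "L2_norm (\<lambda>x. f x + g x) \<le> L2_norm f + L2_norm g"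
proof -
  note fD = L2_spaceD[OF f] and gD = L2_spaceD[OF g]
  have meas: "(\<lambda>x. f x + g x) \<in> borel_measurable unit_M" using fD gD by measurable
  have pointwise: "(cmod (u + v))\<^sup>2 \<le> (1 + b / a) * (cmod u)\<^sup>2 + (1 + a / b) * (cmod v)\<^sup>2"
    if "0 < a" "0 < b" for a b :: real and u v
  proof -
    have "0 \<le> (b * cmod u - a * cmod v)\<^sup>2 / (a * b)" using that by simp
    also have "\<dots> = b / a * (cmod u)\<^sup>2 + a / b * (cmod v)\<^sup>2 - 2 * cmod u * cmod v"
      using that by (simp add: field_simps power2_eq_square)
    finally have "2 * cmod u * cmod v \<le> b / a * (cmod u)\<^sup>2 + a / b * (cmod v)\<^sup>2" by simp
    moreover have "(cmod (u + v))\<^sup>2 \<le> (cmod u + cmod v)\<^sup>2"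
      by (intro power_mono norm_triangle_ineq) simp
    ultimately show ?thesis by (simp add: power2_sum algebra_simps)
  qed
  have bound: "(LINT x|unit_M. (cmod (f x + g x))\<^sup>2) \<le> (a + b)\<^sup>2
      \<and> integrable unit_M (\<lambda>x. (cmod (f x + g x))\<^sup>2)"
    if ab: "L2_norm f < a" "L2_norm g < b" for a b
  proof
    have pos: "0 < a" "0 < b" using ab L2_norm_nonneg[of f] L2_norm_nonneg[of g] by linarith+
    let ?M = "\<lambda>x. (1 + b / a) * (cmod (f x))\<^sup>2 + (1 + a / b) * (cmod (g x))\<^sup>2"
    have M: "integrable unit_M ?M"
      by (intro Bochner_Integration.integrable_add integrable_mult_right fD gD)
    show int: "integrable unit_M (\<lambda>x. (cmod (f x + g x))\<^sup>2)"
    proof (rule Bochner_Integration.integrable_bound[OF M])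
      show "(\<lambda>x. (cmod (f x + g x))\<^sup>2) \<in> borel_measurable unit_M" using meas by measurable
      have "norm ((cmod (f x + g x))\<^sup>2) \<le> norm (?M x)" for x
        using order_trans[OF pointwise[OF pos, of "f x" "g x"] abs_ge_self] by simp
      then show "AE x in unit_M. norm ((cmod (f x + g x))\<^sup>2) \<le> norm (?M x)" by simp
    qed
    have "(LINT x|unit_M. (cmod (f x + g x))\<^sup>2) \<le> (LINT x|unit_M. ?M x)"
      by (intro integral_mono int M pointwise pos)
    also have "\<dots> = (1 + b / a) * (L2_norm f)\<^sup>2 + (1 + a / b) * (L2_norm g)\<^sup>2"
      unfolding L2_norm_sq using fD gD by simp
    also have "\<dots> \<le> (1 + b / a) * a\<^sup>2 + (1 + a / b) * b\<^sup>2"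
      using pos ab by (intro add_mono mult_left_mono power_mono L2_norm_nonneg) auto
    also have "\<dots> = (a + b)\<^sup>2" using pos by (simp add: power2_eq_square distrib_left distrib_right)
    finally show "(LINT x|unit_M. (cmod (f x + g x))\<^sup>2) \<le> (a + b)\<^sup>2" .
  qed
  show "(\<lambda>x. f x + g x) \<in> L2_space"
    using bound[of "L2_norm f + 1" "L2_norm g + 1"] meas by (simp add: L2_space_def)
  show "L2_norm (\<lambda>x. f x + g x) \<le> L2_norm f + L2_norm g"
  proof (rule field_le_epsilon)
    fix e :: real assume "0 < e"
    then have "(L2_norm (\<lambda>x. f x + g x))\<^sup>2 \<le> ((L2_norm f + e / 2) + (L2_norm g + e / 2))\<^sup>2"
      unfolding L2_norm_sq[of "\<lambda>x. f x + g x"] using bound[of "L2_norm f + e / 2" "L2_norm g + e / 2"] by simp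
    then have "L2_norm (\<lambda>x. f x + g x) \<le> (L2_norm f + e / 2) + (L2_norm g + e / 2)"
      by (rule power2_le_imp_le) (use \<open>0 < e\<close> L2_norm_nonneg[of f] L2_norm_nonneg[of g] in linarith)
    then show "L2_norm (\<lambda>x. f x + g x) \<le> L2_norm f + L2_norm g + e" by simp
  qed
qed

lemma L2_integrable:
  assumes "f \<in> L2_space"
  shows "integrable unit_M f"
proof (rule Bochner_Integration.integrable_bound)
  show "integrable unit_M (\<lambda>x. 1 + (cmod (f x))\<^sup>2)"
    by (intro Bochner_Integration.integrable_add L2_spaceD(2)[OF assms]) simp
  have "cmod (f x) \<le> 1 + (cmod (f x))\<^sup>2" for x
  proof -
    have "2 * cmod (f x) \<le> 1 + (cmod (f x))\<^sup>2"
      using zero_le_power2[of "cmod (f x) - 1"] by (simp add: power2_diff)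
    then show ?thesis using norm_ge_zero[of "f x"] by linarith
  qed
  then show "AE x in unit_M. cmod (f x) \<le> norm (1 + (cmod (f x))\<^sup>2)"
    by (auto intro: order_trans)
qed (rule L2_spaceD(1)[OF assms])

text \<open>
  The hypothesis of the Schur test for a convolution majorant \<open>h\<close>. As \<open>h\<close> is even, the row
  bound is also a column bound. The diagonal is exempt, because a power of \<open>0\<close> takes the
  default value \<open>0\<close> there.
\<close>

definition schur_dominated :: "(real \<Rightarrow> real \<Rightarrow> complex) \<Rightarrow> (real \<Rightarrow> real) \<Rightarrow> real \<Rightarrow> bool" where
  "schur_dominated D h \<eta> \<longleftrightarrow>
     (\<lambda>p. D (fst p) (snd p)) \<in> borel_measurable (borel \<Otimes>\<^sub>M borel) \<and>
     h \<in> borel_measurable borel \<and> (\<forall>t. 0 \<le> h t) \<and> (\<forall>t. h (- t) = h t) \<and>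
     (\<forall>x y. x \<noteq> y \<longrightarrow> cmod (D x y) \<le> h (x - y)) \<and>
     0 \<le> \<eta> \<and> (\<forall>x\<in>{0<..<1}. (\<integral>\<^sup>+y. ennreal (h (x - y)) \<partial>unit_M) \<le> ennreal \<eta>)"

lemma AE_unit_ne: "AE y in unit_M. x \<noteq> y"
proof -
  have "AE y in lborel. x \<noteq> y" using AE_lborel_singleton[of x] by eventually_elim auto
  then have "AE y in lebesgue. x \<noteq> y" by (rule AE_completion)
  then show ?thesis by (simp add: AE_restrict_space_iff) (auto elim: eventually_mono)
qed

lemma measurable_unit_pair:
  assumes "(\<lambda>p. D (fst p) (snd p)) \<in> borel_measurable (borel \<Otimes>\<^sub>M borel)"
  shows "(\<lambda>p. D (fst p) (snd p)) \<in> borel_measurable (unit_M \<Otimes>\<^sub>M unit_M)"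
proof -
  have id: "(\<lambda>x. x) \<in> unit_M \<rightarrow>\<^sub>M borel" by (rule borel_measurable_lebesgue_on_borel) simp
  have "(\<lambda>p. (fst p, snd p)) \<in> unit_M \<Otimes>\<^sub>M unit_M \<rightarrow>\<^sub>M borel \<Otimes>\<^sub>M borel"
    by (intro measurable_Pair measurable_compose[OF measurable_fst id] measurable_compose[OF measurable_snd id])
  from measurable_compose[OF this assms] show ?thesis by simp
qed

text \<open>
  By the Cauchy-Schwarz inequality \<open>|D f (x)|\<^sup>2\<close> is at most the row integral of \<open>h\<close> times
  \<open>\<integral> h(x - y) |f(y)|\<^sup>2 dy\<close>; integrating over \<open>x\<close> and exchanging the integrals brings in
  the column bound.
\<close>

lemma schur_test:
  assumes D: "schur_dominated D h \<eta>" and f: "f \<in> L2_space"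
  shows "AE x in unit_M. integrable unit_M (\<lambda>y. D x y * f y)"
    and "integral_operator D f \<in> L2_space"
    and "L2_norm (integral_operator D f) \<le> \<eta> * L2_norm f"
proof -
  note fD = L2_spaceD[OF f]
  have Dm: "(\<lambda>p. D (fst p) (snd p)) \<in> borel_measurable (borel \<Otimes>\<^sub>M borel)"
    and hm [measurable]: "h \<in> borel_measurable borel" and h0: "\<And>t. 0 \<le> h t" and heven: "\<And>t. h (- t) = h t"
    and le: "\<And>x y. x \<noteq> y \<Longrightarrow> cmod (D x y) \<le> h (x - y)" and \<eta>: "0 \<le> \<eta>"
    and row: "\<And>x. x \<in> {0<..<1} \<Longrightarrow> (\<integral>\<^sup>+y. ennreal (h (x - y)) \<partial>unit_M) \<le> ennreal \<eta>"
    using D unfolding schur_dominated_def by blast+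
  have D2 [measurable]: "(\<lambda>p. D (fst p) (snd p)) \<in> borel_measurable (unit_M \<Otimes>\<^sub>M unit_M)"
    by (rule measurable_unit_pair[OF Dm])
  have h2 [measurable]: "(\<lambda>p. h (fst p - snd p)) \<in> borel_measurable (unit_M \<Otimes>\<^sub>M unit_M)"
    by (rule measurable_unit_pair[of "\<lambda>x y. h (x - y)"]) measurable
  have f2 [measurable]: "(\<lambda>p. f (snd p)) \<in> borel_measurable (unit_M \<Otimes>\<^sub>M unit_M)"
    by (rule measurable_compose[OF measurable_snd fD(1)])
  have fm [measurable]: "f \<in> borel_measurable unit_M" by (rule fD(1))
  have hx [measurable]: "(\<lambda>y. h (x - y)) \<in> borel_measurable unit_M" for x
    by (rule borel_measurable_lebesgue_on_borel) measurable
  have Dx: "(\<lambda>y. D x y) \<in> borel_measurable unit_M" for x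
    by (rule borel_measurable_lebesgue_on_borel) (use measurable_compose[OF _ Dm, of "\<lambda>y. (x, y)" borel] in simp)
  have Dfx: "(\<lambda>y. D x y * f y) \<in> borel_measurable unit_M" for x
    using Dx[of x] fD(1) by measurable
  have Kmeas: "integral_operator D f \<in> borel_measurable unit_M"
    unfolding integral_operator_def
    by (rule unit.borel_measurable_lebesgue_integral) (simp add: case_prod_beta)
  let ?G = "\<lambda>x. \<integral>\<^sup>+y. ennreal (h (x - y) * (cmod (f y))\<^sup>2) \<partial>unit_M"
  have nn_le: "(\<integral>\<^sup>+y. ennreal (cmod (D x y * f y)) \<partial>unit_M)\<^sup>2 \<le> ennreal \<eta> * ?G x"
    if x: "x \<in> {0<..<1}" for x
  proof -
    have "(\<integral>\<^sup>+y. ennreal (cmod (D x y * f y)) \<partial>unit_M)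
       \<le> (\<integral>\<^sup>+y. ennreal (sqrt (h (x - y))) * ennreal (sqrt (h (x - y)) * cmod (f y)) \<partial>unit_M)"
    proof (rule nn_integral_mono_AE)
      show "AE y in unit_M. ennreal (cmod (D x y * f y)) \<le>
          ennreal (sqrt (h (x - y))) * ennreal (sqrt (h (x - y)) * cmod (f y))"
        using AE_unit_ne[of x]
      proof eventually_elim
        case (elim y)
        have "cmod (D x y * f y) \<le> h (x - y) * cmod (f y)"
          unfolding norm_mult using le[OF elim] by (rule mult_right_mono) simp
        also have "\<dots> = sqrt (h (x - y)) * (sqrt (h (x - y)) * cmod (f y))"
          using h0[of "x - y"] by (simp add: mult.assoc[symmetric])
        finally show ?case using h0[of "x - y"] by (simp add: ennreal_mult[symmetric])
      qed
    qed
    then have "(\<integral>\<^sup>+y. ennreal (cmod (D x y * f y)) \<partial>unit_M)\<^sup>2 \<le>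
        (\<integral>\<^sup>+y. ennreal (sqrt (h (x - y))) * ennreal (sqrt (h (x - y)) * cmod (f y)) \<partial>unit_M)\<^sup>2"
      by (rule power_mono) simp
    also have "\<dots> \<le> (\<integral>\<^sup>+y. (ennreal (sqrt (h (x - y))))\<^sup>2 \<partial>unit_M) *
        (\<integral>\<^sup>+y. (ennreal (sqrt (h (x - y)) * cmod (f y)))\<^sup>2 \<partial>unit_M)"
      by (rule Cauchy_Schwarz_nn_integral) measurable
    also have "(\<integral>\<^sup>+y. (ennreal (sqrt (h (x - y))))\<^sup>2 \<partial>unit_M) = (\<integral>\<^sup>+y. ennreal (h (x - y)) \<partial>unit_M)"
      by (intro nn_integral_cong) (simp add: ennreal_power h0)
    also have "(\<integral>\<^sup>+y. (ennreal (sqrt (h (x - y)) * cmod (f y)))\<^sup>2 \<partial>unit_M) = ?G x"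
      by (intro nn_integral_cong) (simp add: ennreal_power h0 power_mult_distrib)
    also have "(\<integral>\<^sup>+y. ennreal (h (x - y)) \<partial>unit_M) * ?G x \<le> ennreal \<eta> * ?G x"
      by (intro mult_right_mono row x) simp
    finally show ?thesis .
  qed
  have "(\<integral>\<^sup>+x. ?G x \<partial>unit_M) =
      (\<integral>\<^sup>+y. (\<integral>\<^sup>+x. ennreal (h (x - y) * (cmod (f y))\<^sup>2) \<partial>unit_M) \<partial>unit_M)"
    by (rule unit_pair.Fubini'[symmetric]) (simp add: case_prod_beta)
  also have "\<dots> \<le> (\<integral>\<^sup>+y. ennreal \<eta> * ennreal ((cmod (f y))\<^sup>2) \<partial>unit_M)"
  proof (rule nn_integral_mono)
    fix y assume "y \<in> space unit_M"
    then have y: "y \<in> {0<..<1}" by simp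
    have "(\<integral>\<^sup>+x. ennreal (h (x - y) * (cmod (f y))\<^sup>2) \<partial>unit_M) =
        (\<integral>\<^sup>+x. ennreal (h (y - x)) * ennreal ((cmod (f y))\<^sup>2) \<partial>unit_M)"
      using heven by (intro nn_integral_cong) (metis ennreal_mult h0 minus_diff_eq zero_le_power2)
    also have "\<dots> = (\<integral>\<^sup>+x. ennreal (h (y - x)) \<partial>unit_M) * ennreal ((cmod (f y))\<^sup>2)"
      by (rule nn_integral_multc) measurable
    also have "\<dots> \<le> ennreal \<eta> * ennreal ((cmod (f y))\<^sup>2)"
      by (intro mult_right_mono row y) simp
    finally show "(\<integral>\<^sup>+x. ennreal (h (x - y) * (cmod (f y))\<^sup>2) \<partial>unit_M) \<le> ennreal \<eta> * ennreal ((cmod (f y))\<^sup>2)" .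
  qed
  also have "\<dots> = ennreal \<eta> * ennreal ((L2_norm f)\<^sup>2)"
    unfolding L2_norm_sq_nn[OF f, symmetric] by (rule nn_integral_cmult) measurable
  finally have G: "(\<integral>\<^sup>+x. ?G x \<partial>unit_M) \<le> ennreal \<eta> * ennreal ((L2_norm f)\<^sup>2)" .
  have Gm [measurable]: "?G \<in> borel_measurable unit_M"
    by (rule unit.borel_measurable_nn_integral) (simp add: case_prod_beta)
  have "(\<integral>\<^sup>+x. ?G x \<partial>unit_M) \<noteq> \<infinity>"
    using G by (auto simp: ennreal_mult[symmetric] \<eta> top_unique)
  then have "AE x in unit_M. ?G x \<noteq> \<infinity>"
    by (rule nn_integral_noteq_infinite[OF Gm])
  then show "AE x in unit_M. integrable unit_M (\<lambda>y. D x y * f y)"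
    using AE_space
  proof eventually_elim
    case (elim x)
    then have x: "x \<in> {0<..<1}" by simp
    have "ennreal \<eta> * ?G x < \<infinity>" using elim by (simp add: ennreal_mult_less_top less_top)
    then have "(\<integral>\<^sup>+y. ennreal (cmod (D x y * f y)) \<partial>unit_M)\<^sup>2 < \<infinity>"
      using nn_le[OF x] by (rule le_less_trans[rotated])
    then have "(\<integral>\<^sup>+y. ennreal (cmod (D x y * f y)) \<partial>unit_M) < \<infinity>"
      by (cases "(\<integral>\<^sup>+y. ennreal (cmod (D x y * f y)) \<partial>unit_M)") (auto simp: power2_eq_square)
    then show ?case by (rule integrableI_bounded[OF Dfx])
  qed
  have "(\<integral>\<^sup>+x. ennreal ((cmod (integral_operator D f x))\<^sup>2) \<partial>unit_M) \<le> (\<integral>\<^sup>+x. ennreal \<eta> * ?G x \<partial>unit_M)"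
  proof (rule nn_integral_mono)
    fix x assume "x \<in> space unit_M"
    then have x: "x \<in> {0<..<1}" by simp
    have "ennreal (cmod (integral_operator D f x)) \<le> (\<integral>\<^sup>+y. ennreal (cmod (D x y * f y)) \<partial>unit_M)"
    proof (cases "integrable unit_M (\<lambda>y. D x y * f y)")
      case True
      then show ?thesis unfolding integral_operator_def by (rule integral_norm_bound_ennreal)
    next
      case False
      then show ?thesis by (simp add: integral_operator_def not_integrable_integral_eq)
    qed
    then have "(ennreal (cmod (integral_operator D f x)))\<^sup>2 \<le> (\<integral>\<^sup>+y. ennreal (cmod (D x y * f y)) \<partial>unit_M)\<^sup>2"
      by (rule power_mono) simp
    also have "\<dots> \<le> ennreal \<eta> * ?G x" by (rule nn_le[OF x])
    finally show "ennreal ((cmod (integral_operator D f x))\<^sup>2) \<le> ennreal \<eta> * ?G x"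
      by (simp add: ennreal_power)
  qed
  also have "\<dots> = ennreal \<eta> * (\<integral>\<^sup>+x. ?G x \<partial>unit_M)" by (rule nn_integral_cmult) measurable
  also have "\<dots> \<le> ennreal \<eta> * (ennreal \<eta> * ennreal ((L2_norm f)\<^sup>2))"
    by (intro mult_left_mono G) simp
  also have "\<dots> = ennreal ((\<eta> * L2_norm f)\<^sup>2)"
    using \<eta> by (simp add: ennreal_mult[symmetric] power2_eq_square ac_simps)
  finally have fin: "(\<integral>\<^sup>+x. ennreal ((cmod (integral_operator D f x))\<^sup>2) \<partial>unit_M) \<le> ennreal ((\<eta> * L2_norm f)\<^sup>2)" .
  show "integral_operator D f \<in> L2_space" "L2_norm (integral_operator D f) \<le> \<eta> * L2_norm f"
    by (rule L2_intro_nn[OF Kmeas _ fin]; use \<eta> L2_norm_nonneg in simp)+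
qed

lemma nn_integral_powr_row_le:
  assumes "0 < p" "x \<in> {0<..<1}"
  shows "(\<integral>\<^sup>+y. ennreal (\<bar>x - y\<bar> powr (p - 1)) \<partial>unit_M) \<le> ennreal (2 / p)"
proof -
  have "(\<integral>\<^sup>+y. ennreal (\<bar>x - y\<bar> powr (p - 1)) \<partial>unit_M) =
      (\<integral>\<^sup>+y. ennreal (\<bar>x - y\<bar> powr (p - 1)) * indicator {0<..<1} y \<partial>lborel)"
    by (rule nn_integral_lebesgue_on_borel) auto
  also have "\<dots> \<le> (\<integral>\<^sup>+y. ennreal (indicator {x - 1..x + 1} y * \<bar>y - x\<bar> powr (p - 1)) \<partial>lborel)"
    using assms(2) by (intro nn_integral_mono) (auto simp: indicator_def abs_minus_commute)
  also have "\<dots> = ennreal (2 / p)"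
    using nn_integral_powr_interval[of p 1 x] assms(1) by simp
  finally show ?thesis .
qed

lemma schur_dominated_powr:
  assumes Dm: "(\<lambda>p. D (fst p) (snd p)) \<in> borel_measurable (borel \<Otimes>\<^sub>M borel)"
    and p: "0 < p" "0 < p'" and c: "0 \<le> c" "0 \<le> c'"
    and le: "\<And>x y. x \<noteq> y \<Longrightarrow> cmod (D x y) \<le> c * \<bar>x - y\<bar> powr (p - 1) + c' * \<bar>x - y\<bar> powr (p' - 1)"
  shows "schur_dominated D (\<lambda>t. c * \<bar>t\<bar> powr (p - 1) + c' * \<bar>t\<bar> powr (p' - 1)) (2 * c / p + 2 * c' / p')"
proof -
  have "(\<integral>\<^sup>+y. ennreal (c * \<bar>x - y\<bar> powr (p - 1) + c' * \<bar>x - y\<bar> powr (p' - 1)) \<partial>unit_M)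
     \<le> ennreal (2 * c / p + 2 * c' / p')" if x: "x \<in> {0<..<1}" for x
  proof -
    have m: "(\<lambda>y. ennreal (\<bar>x - y\<bar> powr (r - 1))) \<in> borel_measurable unit_M" for r
      by (rule borel_measurable_lebesgue_on_borel) measurable
    have "(\<integral>\<^sup>+y. ennreal (c * \<bar>x - y\<bar> powr (p - 1) + c' * \<bar>x - y\<bar> powr (p' - 1)) \<partial>unit_M) =
      (\<integral>\<^sup>+y. ennreal c * ennreal (\<bar>x - y\<bar> powr (p - 1)) + ennreal c' * ennreal (\<bar>x - y\<bar> powr (p' - 1)) \<partial>unit_M)"
      using c by (intro nn_integral_cong) (simp add: ennreal_mult[symmetric])
    also have "\<dots> = ennreal c * (\<integral>\<^sup>+y. ennreal (\<bar>x - y\<bar> powr (p - 1)) \<partial>unit_M) +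
       ennreal c' * (\<integral>\<^sup>+y. ennreal (\<bar>x - y\<bar> powr (p' - 1)) \<partial>unit_M)"
      using m by (subst nn_integral_add) (auto simp: nn_integral_cmult)
    also have "\<dots> \<le> ennreal c * ennreal (2 / p) + ennreal c' * ennreal (2 / p')"
      by (intro add_mono mult_left_mono nn_integral_powr_row_le p x) auto
    also have "\<dots> = ennreal (2 * c / p + 2 * c' / p')"
      using c p by (simp add: ennreal_mult[symmetric] ennreal_plus[symmetric] mult.commute del: ennreal_plus)
    finally show ?thesis .
  qed
  then show ?thesis
    unfolding schur_dominated_def using assms by auto
qed

section \<open>Discretisation of the unit interval\<close>

text \<open>
  For an unbounded operator the infimum would be taken over the empty set.
\<close>

lemma L2_operator_norm_nonneg:
  assumes "\<exists>C\<ge>0. \<forall>f\<in>L2_space. T f \<in> L2_space \<and> L2_norm (T f) \<le> C * L2_norm f"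
  shows "0 \<le> L2_operator_norm T"
  unfolding L2_operator_norm_def using assms by (intro cInf_greatest) auto

lemma L2_operator_norm_least:
  assumes "0 \<le> C" "\<And>f. f \<in> L2_space \<Longrightarrow> T f \<in> L2_space \<and> L2_norm (T f) \<le> C * L2_norm f"
  shows "L2_operator_norm T \<le> C"
  unfolding L2_operator_norm_def using assms by (intro cInf_lower) (auto intro!: bdd_belowI[of _ 0])

lemma L2_operator_norm_bound:
  assumes ex: "\<exists>C\<ge>0. \<forall>f\<in>L2_space. T f \<in> L2_space \<and> L2_norm (T f) \<le> C * L2_norm f" and f: "f \<in> L2_space"
  shows "L2_norm (T f) \<le> L2_operator_norm T * L2_norm f"
proof (cases "L2_norm f = 0")
  case True
  from ex obtain C where "L2_norm (T f) \<le> C * L2_norm f" using f by blast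
  with True show ?thesis by simp
next
  case False
  then have pos: "L2_norm f > 0" using L2_norm_nonneg[of f] by linarith
  have "L2_norm (T f) / L2_norm f \<le> L2_operator_norm T"
    unfolding L2_operator_norm_def
  proof (rule cInf_greatest)
    show "{C. 0 \<le> C \<and> (\<forall>f\<in>L2_space. T f \<in> L2_space \<and> L2_norm (T f) \<le> C * L2_norm f)} \<noteq> {}"
      using ex by blast
    fix C assume "C \<in> {C. 0 \<le> C \<and> (\<forall>f\<in>L2_space. T f \<in> L2_space \<and> L2_norm (T f) \<le> C * L2_norm f)}"
    then have "L2_norm (T f) \<le> C * L2_norm f" using f by blast
    then show "L2_norm (T f) / L2_norm f \<le> C" using pos by (simp add: pos_divide_le_eq)
  qed
  then show ?thesis using pos by (simp add: pos_divide_le_eq)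
qed

text \<open>
  The points of the \<open>k\<close>-th of \<open>n\<close> equal parts of the unit interval, written with the floor
  function so that it matches the kernel of the discretised operator literally.
\<close>

definition cell :: "nat \<Rightarrow> nat \<Rightarrow> real set" where
  "cell n k = {y. \<lfloor>real n * y\<rfloor> = int k}"

lemma cell_borel: "cell n k \<in> sets borel"
proof -
  have "{y \<in> space borel. \<lfloor>real n * y\<rfloor> = int k} \<in> sets borel" by measurable
  then show ?thesis by (simp add: cell_def)
qed

lemma cell_indicator_measurable: "(\<lambda>y. indicator (cell n k) y :: real) \<in> borel_measurable unit_M"
  by (intro borel_measurable_lebesgue_on_borel borel_measurable_indicator cell_borel)

lemma integrable_cell:
  fixes g :: "real \<Rightarrow> 'a :: {banach, second_countable_topology}"
  assumes "integrable unit_M g"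
  shows "integrable unit_M (\<lambda>y. indicator (cell n k) y *\<^sub>R g y)"
proof (rule Bochner_Integration.integrable_bound[OF assms])
  show "(\<lambda>y. indicator (cell n k) y *\<^sub>R g y) \<in> borel_measurable unit_M"
    by (intro borel_measurable_scaleR cell_indicator_measurable borel_measurable_integrable assms)
qed (simp add: indicator_def)

lemma floor_unit:
  assumes "0 < n" "y \<in> {0<..<1}"
  shows "\<exists>k<n. \<lfloor>real n * y\<rfloor> = int k"
proof -
  have "0 \<le> real n * y" "real n * y < real n" using assms by auto
  then have "0 \<le> \<lfloor>real n * y\<rfloor>" "\<lfloor>real n * y\<rfloor> < int n" by (auto simp: floor_less_iff)
  then show ?thesis by (metis nonneg_int_cases of_nat_less_iff)
qed

lemma integral_cells:
  fixes g :: "real \<Rightarrow> 'a :: {banach, second_countable_topology, real_normed_algebra}"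
  assumes n: "0 < n" and g: "integrable unit_M g"
  shows "(LINT y|unit_M. \<phi> \<lfloor>real n * y\<rfloor> * g y) =
      (\<Sum>k<n. \<phi> (int k) * (LINT y|unit_M. indicator (cell n k) y *\<^sub>R g y))"
    and "integrable unit_M (\<lambda>y. \<phi> \<lfloor>real n * y\<rfloor> * g y)"
proof -
  let ?S = "\<lambda>y. \<Sum>k<n. \<phi> (int k) * (indicator (cell n k) y *\<^sub>R g y)"
  have eq: "\<phi> \<lfloor>real n * y\<rfloor> * g y = ?S y" if "y \<in> {0<..<1}" for y
  proof -
    from floor_unit[OF n that] obtain k where k: "k < n" "\<lfloor>real n * y\<rfloor> = int k" by blast
    have "?S y = (\<Sum>j<n. if j = k then \<phi> (int k) * g y else 0)"
      by (intro sum.cong) (auto simp: cell_def indicator_def k)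
    then show ?thesis using k by simp
  qed
  have intS: "integrable unit_M ?S"
    by (intro Bochner_Integration.integrable_sum integrable_mult_right integrable_cell g)
  show "integrable unit_M (\<lambda>y. \<phi> \<lfloor>real n * y\<rfloor> * g y)"
    by (subst Bochner_Integration.integrable_cong[where g = ?S, OF refl]) (use eq intS in auto)
  have "(LINT y|unit_M. \<phi> \<lfloor>real n * y\<rfloor> * g y) = (LINT y|unit_M. ?S y)"
    by (intro Bochner_Integration.integral_cong) (use eq in auto)
  also have "\<dots> = (\<Sum>k<n. \<phi> (int k) * (LINT y|unit_M. indicator (cell n k) y *\<^sub>R g y))"
    by (subst Bochner_Integration.integral_sum)
       (intro integrable_mult_right integrable_cell g sum.cong refl Bochner_Integration.integral_mult_right)+
  finally show "(LINT y|unit_M. \<phi> \<lfloor>real n * y\<rfloor> * g y) =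
      (\<Sum>k<n. \<phi> (int k) * (LINT y|unit_M. indicator (cell n k) y *\<^sub>R g y))" .
qed

lemma measure_cell:
  assumes "k < n"
  shows "(LINT y|unit_M. indicator (cell n k) y) = 1 / real n"
proof -
  have n: "real n > 0" using assms by simp
  have cell: "cell n k \<inter> {0<..<1} \<in> sets lebesgue"
    using cell_borel[of n k] by (intro sets.Int) auto
  have "(LINT y|unit_M. indicator (cell n k) y) = measure unit_M (cell n k \<inter> {0<..<1})"
    by simp
  also have "\<dots> = measure lebesgue (cell n k \<inter> {0<..<1})"
    by (subst measure_restrict_space) auto
  also have "\<dots> = 1 / real n"
  proof (rule antisym)
    have "cell n k \<inter> {0<..<1} \<subseteq> {real k / n..real (Suc k) / n}"
    proof
      fix y assume "y \<in> cell n k \<inter> {0<..<1}"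
      then have "real k \<le> real n * y" "real n * y < real k + 1"
        by (auto simp: cell_def floor_eq_iff)
      then show "y \<in> {real k / n..real (Suc k) / n}" using n by (auto simp: pos_divide_le_eq pos_le_divide_eq mult.commute)
    qed
    then have "measure lebesgue (cell n k \<inter> {0<..<1}) \<le> measure lebesgue {real k / n..real (Suc k) / n}"
      by (rule measure_mono_fmeasurable) (use cell in auto)
    also have "\<dots> = 1 / n" using n by (simp add: diff_divide_distrib[symmetric] divide_right_mono)
    finally show "measure lebesgue (cell n k \<inter> {0<..<1}) \<le> 1 / real n" .
    have "{real k / n<..<real (Suc k) / n} \<subseteq> cell n k \<inter> {0<..<1}"
    proof
      fix y assume "y \<in> {real k / n<..<real (Suc k) / n}"
      then have *: "real k < real n * y" "real n * y < real k + 1" using n by (auto simp: field_simps)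
      moreover have "real n * y < real n * 1" using * assms by linarith
      moreover have "0 < real n * y" using * by (meson le_less_trans of_nat_0_le_iff)
      ultimately show "y \<in> cell n k \<inter> {0<..<1}" using n
        by (auto simp: cell_def floor_eq_iff zero_less_mult_iff)
    qed
    then have "measure lebesgue {real k / n<..<real (Suc k) / n} \<le> measure lebesgue (cell n k \<inter> {0<..<1})"
      by (rule measure_mono_fmeasurable) (use cell in \<open>auto intro!: bounded_set_imp_lmeasurable bounded_Int\<close>)
    then show "1 / real n \<le> measure lebesgue (cell n k \<inter> {0<..<1})"
      using n by (simp add: diff_divide_distrib[symmetric] divide_right_mono)
  qed
  finally show ?thesis .
qed

definition cell_integral :: "nat \<Rightarrow> (real \<Rightarrow> complex) \<Rightarrow> nat \<Rightarrow> complex" where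
  "cell_integral n f k = (LINT y|unit_M. indicator (cell n k) y *\<^sub>R f y)"

lemma step_function_L2:
  fixes \<phi> :: "int \<Rightarrow> complex"
  assumes n: "0 < n"
  shows "(\<lambda>x. \<phi> \<lfloor>real n * x\<rfloor>) \<in> L2_space"
    and "(L2_norm (\<lambda>x. \<phi> \<lfloor>real n * x\<rfloor>))\<^sup>2 = (l2norm n (\<lambda>k. \<phi> (int k)))\<^sup>2 / real n"
proof -
  have one: "integrable unit_M (\<lambda>x. 1 :: real)" "integrable unit_M (\<lambda>x. 1 :: complex)" by auto
  have "integrable unit_M (\<lambda>x. \<phi> \<lfloor>real n * x\<rfloor>)"
    using integral_cells(2)[OF n one(2), of \<phi>] by simp
  moreover have "integrable unit_M (\<lambda>x. (cmod (\<phi> \<lfloor>real n * x\<rfloor>))\<^sup>2)"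
    using integral_cells(2)[OF n one(1), of "\<lambda>i. (cmod (\<phi> i))\<^sup>2"] by simp
  ultimately show "(\<lambda>x. \<phi> \<lfloor>real n * x\<rfloor>) \<in> L2_space" by (simp add: L2_space_def)
  have "(L2_norm (\<lambda>x. \<phi> \<lfloor>real n * x\<rfloor>))\<^sup>2 = (\<Sum>k<n. (cmod (\<phi> (int k)))\<^sup>2 * (LINT y|unit_M. indicator (cell n k) y))"
    unfolding L2_norm_sq using integral_cells(1)[OF n one(1), of "\<lambda>i. (cmod (\<phi> i))\<^sup>2"] by simp
  also have "\<dots> = (\<Sum>k<n. (cmod (\<phi> (int k)))\<^sup>2 / real n)"
    by (intro sum.cong refl) (simp only: lessThan_iff measure_cell times_divide_eq_right mult_1_right)
  also have "\<dots> = (l2norm n (\<lambda>k. \<phi> (int k)))\<^sup>2 / real n"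
    by (simp add: L2_set_def sum_nonneg sum_divide_distrib)
  finally show "(L2_norm (\<lambda>x. \<phi> \<lfloor>real n * x\<rfloor>))\<^sup>2 = (l2norm n (\<lambda>k. \<phi> (int k)))\<^sup>2 / real n" .
qed

lemma cell_integral_step:
  fixes \<phi> :: "int \<Rightarrow> complex"
  assumes "k < n"
  shows "cell_integral n (\<lambda>x. \<phi> \<lfloor>real n * x\<rfloor>) k = \<phi> (int k) / of_nat n"
proof -
  have "cell_integral n (\<lambda>x. \<phi> \<lfloor>real n * x\<rfloor>) k = (LINT y|unit_M. indicator (cell n k) y *\<^sub>R \<phi> (int k))"
    unfolding cell_integral_def
    by (intro Bochner_Integration.integral_cong) (auto simp: cell_def indicator_def)
  also have "\<dots> = (LINT y|unit_M. indicator (cell n k) y) *\<^sub>R \<phi> (int k)"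
    by (rule integral_scaleR_left) (use integrable_cell[of "\<lambda>_. 1::real" n k] in simp)
  also have "\<dots> = \<phi> (int k) / of_nat n"
    unfolding measure_cell[OF assms] by (simp add: scaleR_conv_of_real)
  finally show ?thesis .
qed

text \<open>
  On a cell of length \<open>1/n\<close> the Cauchy-Schwarz inequality gains a factor \<open>1/n\<close>.
\<close>

lemma cell_integral_l2norm_le:
  assumes n: "0 < n" and f: "f \<in> L2_space"
  shows "(l2norm n (cell_integral n f))\<^sup>2 \<le> (L2_norm f)\<^sup>2 / real n"
proof -
  note fi = L2_integrable[OF f] and fs = L2_spaceD(2)[OF f]
  have cell: "(cmod (cell_integral n f k))\<^sup>2 \<le> (LINT y|unit_M. indicator (cell n k) y *\<^sub>R (cmod (f y))\<^sup>2) / real n"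
    if k: "k < n" for k
  proof -
    define A where "A = (LINT y|unit_M. indicator (cell n k) y *\<^sub>R cmod (f y))"
    define B where "B = (LINT y|unit_M. indicator (cell n k) y *\<^sub>R (cmod (f y))\<^sup>2)"
    define c where "c = real n * A"
    have one: "integrable unit_M (\<lambda>y. indicator (cell n k) y *\<^sub>R (1::real))" by (rule integrable_cell) simp
    have i1: "integrable unit_M (\<lambda>y. indicator (cell n k) y *\<^sub>R cmod (f y))"
      by (intro integrable_cell integrable_norm fi)
    have i2: "integrable unit_M (\<lambda>y. indicator (cell n k) y *\<^sub>R (cmod (f y))\<^sup>2)"
      by (intro integrable_cell fs)
    \<comment> \<open>The constant \<open>c\<close> is the mean of \<open>|f|\<close> over the cell, which gives the least integral.\<close>
    have "0 \<le> (LINT y|unit_M. indicator (cell n k) y *\<^sub>R (cmod (f y) - c)\<^sup>2)"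
      by (rule integral_nonneg_AE) (simp add: indicator_def)
    also have "\<dots> = (LINT y|unit_M. indicator (cell n k) y *\<^sub>R (cmod (f y))\<^sup>2
        - 2 * c * (indicator (cell n k) y *\<^sub>R cmod (f y)) + c\<^sup>2 * (indicator (cell n k) y *\<^sub>R 1))"
      by (intro Bochner_Integration.integral_cong refl) (simp add: power2_diff algebra_simps)
    also have "\<dots> = B - 2 * c * A + c\<^sup>2 * (LINT y|unit_M. indicator (cell n k) y *\<^sub>R 1)"
      unfolding A_def B_def
      by (subst Bochner_Integration.integral_add Bochner_Integration.integral_diff
          | intro Bochner_Integration.integrable_diff integrable_mult_right i1 i2 one
          | simp only: integral_mult_right_zero)+
    also have "(LINT y|unit_M. indicator (cell n k) y *\<^sub>R (1::real)) = 1 / real n"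
      using measure_cell[OF k] by simp
    also have "B - 2 * c * A + c\<^sup>2 * (1 / real n) = B - real n * A\<^sup>2"
      using n by (simp add: c_def power2_eq_square field_simps)
    finally have "A\<^sup>2 \<le> B / real n" using n by (simp add: pos_le_divide_eq mult.commute)
    moreover have "cmod (cell_integral n f k) \<le> A"
      unfolding cell_integral_def A_def
      by (rule order_trans[OF integral_norm_bound]) (simp add: indicator_def abs_mult)
    then have "(cmod (cell_integral n f k))\<^sup>2 \<le> A\<^sup>2" by (rule power_mono) simp
    ultimately show ?thesis by (simp add: B_def)
  qed
  have "(l2norm n (cell_integral n f))\<^sup>2 = (\<Sum>k<n. (cmod (cell_integral n f k))\<^sup>2)"
    by (simp add: L2_set_def sum_nonneg)
  also have "\<dots> \<le> (\<Sum>k<n. (LINT y|unit_M. indicator (cell n k) y *\<^sub>R (cmod (f y))\<^sup>2) / real n)"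
    by (intro sum_mono cell) simp
  also have "\<dots> = (L2_norm f)\<^sup>2 / real n"
    using integral_cells(1)[OF n fs, of "\<lambda>_. 1"] by (simp add: L2_norm_sq sum_divide_distrib)
  finally show ?thesis .
qed

text \<open>
  The kernel that represents the matrix with entries \<open>s (j - k)\<close> on step functions; the factor
  makes it comparable with the homogeneous kernel of degree \<open>z - 1\<close>.
\<close>

definition discrete_kernel :: "(int \<Rightarrow> complex) \<Rightarrow> complex \<Rightarrow> nat \<Rightarrow> real \<Rightarrow> real \<Rightarrow> complex" where
  "discrete_kernel s z n x y = of_real (real n) powr (1 - z) * s (\<lfloor>real n * x\<rfloor> - \<lfloor>real n * y\<rfloor>)"

lemma discrete_operator_integrable:
  assumes n: "0 < n" and f: "f \<in> L2_space"
  shows "integrable unit_M (\<lambda>y. discrete_kernel s z n x y * f y)"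
  unfolding discrete_kernel_def
  using integral_cells(2)[OF n L2_integrable[OF f], of "\<lambda>i. of_real (real n) powr (1 - z) * s (\<lfloor>real n * x\<rfloor> - i)"]
  by simp

lemma discrete_operator_eq:
  assumes n: "0 < n" and f: "f \<in> L2_space"
  shows "integral_operator (discrete_kernel s z n) f =
     (\<lambda>x. (\<lambda>i. of_real (real n) powr (1 - z) * (\<Sum>k<n. s (i - int k) * cell_integral n f k)) \<lfloor>real n * x\<rfloor>)"
proof
  fix x
  show "integral_operator (discrete_kernel s z n) f x =
     (\<lambda>i. of_real (real n) powr (1 - z) * (\<Sum>k<n. s (i - int k) * cell_integral n f k)) \<lfloor>real n * x\<rfloor>"
    unfolding integral_operator_def discrete_kernel_def cell_integral_def
    using integral_cells(1)[OF n L2_integrable[OF f], of "\<lambda>i. of_real (real n) powr (1 - z) * s (\<lfloor>real n * x\<rfloor> - i)"]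
    by (simp add: sum_distrib_left mult.assoc)
qed

lemma discrete_operator_L2:
  assumes n: "0 < n" and f: "f \<in> L2_space"
  shows "integral_operator (discrete_kernel s z n) f \<in> L2_space"
    and "(L2_norm (integral_operator (discrete_kernel s z n) f))\<^sup>2 =
       (real n powr (1 - Re z) * l2norm n (toeplitz_mult s n (cell_integral n f)))\<^sup>2 / real n"
proof -
  let ?\<phi> = "\<lambda>i. of_real (real n) powr (1 - z) * (\<Sum>k<n. s (i - int k) * cell_integral n f k)"
  show "integral_operator (discrete_kernel s z n) f \<in> L2_space"
    unfolding discrete_operator_eq[OF n f] by (rule step_function_L2(1)[OF n])
  have "l2norm n (\<lambda>k. ?\<phi> (int k)) = real n powr (1 - Re z) * l2norm n (toeplitz_mult s n (cell_integral n f))"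
    by (simp add: norm_mult cmod_of_real_powr toeplitz_mult_def L2_set_right_distrib del: of_real_of_nat_eq)
  then show "(L2_norm (integral_operator (discrete_kernel s z n) f))\<^sup>2 =
       (real n powr (1 - Re z) * l2norm n (toeplitz_mult s n (cell_integral n f)))\<^sup>2 / real n"
    unfolding discrete_operator_eq[OF n f] by (subst step_function_L2(2)[OF n, of ?\<phi>]) (simp only:)
qed

text \<open>
  The integral operator factors through the cell integrals of \<open>f\<close>: it maps them by the matrix and
  makes a step function of the result. So its norm is at most the rescaled norm of the matrix;
  the next lemma, testing on step functions, gives the converse.
\<close>

lemma discrete_operator_norm_le:
  assumes n: "0 < n" and f: "f \<in> L2_space"
  shows "L2_norm (integral_operator (discrete_kernel s z n) f) \<le> toeplitz_norm s n / real n powr Re z * L2_norm f"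
proof (rule power2_le_imp_le)
  let ?w = "cell_integral n f"
  have "(L2_norm (integral_operator (discrete_kernel s z n) f))\<^sup>2 =
     (real n powr (1 - Re z))\<^sup>2 * (l2norm n (toeplitz_mult s n ?w))\<^sup>2 / real n"
    by (simp add: discrete_operator_L2(2)[OF n f] power_mult_distrib)
  also have "\<dots> \<le> (real n powr (1 - Re z))\<^sup>2 * ((toeplitz_norm s n)\<^sup>2 * ((L2_norm f)\<^sup>2 / real n)) / real n"
  proof (intro divide_right_mono mult_left_mono)
    have "(l2norm n (toeplitz_mult s n ?w))\<^sup>2 \<le> (toeplitz_norm s n * l2norm n ?w)\<^sup>2"
      by (intro power_mono toeplitz_norm_bound L2_set_nonneg)
    also have "\<dots> \<le> (toeplitz_norm s n)\<^sup>2 * ((L2_norm f)\<^sup>2 / real n)"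
      unfolding power_mult_distrib by (intro mult_left_mono cell_integral_l2norm_le n f) simp
    finally show "(l2norm n (toeplitz_mult s n ?w))\<^sup>2 \<le> (toeplitz_norm s n)\<^sup>2 * ((L2_norm f)\<^sup>2 / real n)" .
  qed auto
  also have "\<dots> = (real n powr (1 - Re z) / real n * toeplitz_norm s n * L2_norm f)\<^sup>2"
    by (simp add: power_mult_distrib power_divide power2_eq_square)
  also have "real n powr (1 - Re z) / real n = 1 / real n powr Re z"
    using n by (simp add: powr_diff)
  finally show "(L2_norm (integral_operator (discrete_kernel s z n) f))\<^sup>2 \<le> (toeplitz_norm s n / real n powr Re z * L2_norm f)\<^sup>2"
    by simp
qed (simp add: toeplitz_norm_nonneg L2_norm_nonneg)

lemma toeplitz_norm_le_discrete_operator: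
  assumes n: "0 < n" and B: "0 \<le> B"
    and bound: "\<And>f. f \<in> L2_space \<Longrightarrow> L2_norm (integral_operator (discrete_kernel s z n) f) \<le> B * L2_norm f"
  shows "toeplitz_norm s n \<le> B * real n powr Re z"
proof (rule toeplitz_norm_least)
  fix u :: "nat \<Rightarrow> complex"
  let ?f = "\<lambda>x. u (nat \<lfloor>real n * x\<rfloor>)"
  have f: "?f \<in> L2_space" "(L2_norm ?f)\<^sup>2 = (l2norm n u)\<^sup>2 / real n"
    using step_function_L2[OF n, of "\<lambda>i. u (nat i)"] by simp_all
  have w: "cell_integral n ?f k = u k / of_nat n" if "k < n" for k
    using cell_integral_step[OF that, of "\<lambda>i. u (nat i)"] by simp
  have "toeplitz_mult s n (cell_integral n ?f) j = toeplitz_mult s n u j / of_nat n" for j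
    by (simp add: toeplitz_mult_def w sum_divide_distrib)
  then have T: "l2norm n (toeplitz_mult s n (cell_integral n ?f)) = l2norm n (toeplitz_mult s n u) / real n"
    using L2_set_left_distrib[of "1 / real n" "\<lambda>i. cmod (toeplitz_mult s n u i)" "{..<n}"]
    by (simp add: norm_divide)
  have "(real n powr (1 - Re z) * (l2norm n (toeplitz_mult s n u) / real n))\<^sup>2 / real n
      = (L2_norm (integral_operator (discrete_kernel s z n) ?f))\<^sup>2"
    unfolding discrete_operator_L2(2)[OF n f(1)] T ..
  also have "\<dots> \<le> (B * L2_norm ?f)\<^sup>2" by (intro power_mono bound f L2_norm_nonneg)
  also have "\<dots> = (B * l2norm n u)\<^sup>2 / real n" by (simp add: power_mult_distrib f(2))
  finally have "(real n powr (1 - Re z) * (l2norm n (toeplitz_mult s n u) / real n))\<^sup>2 \<le> (B * l2norm n u)\<^sup>2"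
    using n by (simp add: divide_le_cancel)
  then have "real n powr (1 - Re z) * (l2norm n (toeplitz_mult s n u) / real n) \<le> B * l2norm n u"
    by (rule power2_le_imp_le) (simp add: B L2_set_nonneg)
  moreover have "real n powr (1 - Re z) * (l2norm n (toeplitz_mult s n u) / real n) = l2norm n (toeplitz_mult s n u) / real n powr Re z"
    using n by (simp add: powr_diff)
  ultimately have "l2norm n (toeplitz_mult s n u) / real n powr Re z \<le> B * l2norm n u" by (simp only:)
  moreover have "0 < real n powr Re z" using n by simp
  ultimately have "l2norm n (toeplitz_mult s n u) \<le> B * l2norm n u * real n powr Re z"
    by (simp only: pos_divide_le_eq)
  then show "l2norm n (toeplitz_mult s n u) \<le> B * real n powr Re z * l2norm n u"
    by (simp only: ac_simps)
qed (simp add: B)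

section \<open>Convergence of the rescaled norms\<close>

text \<open>
  A perturbation of the kernel that satisfies the Schur test changes norms by at most the Schur
  bound. Integrability of the unperturbed integrand is needed because a divergent integral has the
  value \<open>0\<close>, which would break additivity.
\<close>

lemma operator_triangle:
  assumes f: "f \<in> L2_space"
    and A: "AE x in unit_M. integrable unit_M (\<lambda>y. A x y * f y)" "integral_operator A f \<in> L2_space"
    and B: "integral_operator B f \<in> L2_space"
    and D: "schur_dominated (\<lambda>x y. B x y - A x y) h \<eta>"
  shows "L2_norm (integral_operator B f) \<le> L2_norm (integral_operator A f) + \<eta> * L2_norm f"
proof -
  let ?D = "\<lambda>x y. B x y - A x y"
  note S = schur_test[OF D f]
  have "AE x in unit_M. integral_operator B f x = integral_operator A f x + integral_operator ?D f x"
    using A(1) S(1)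
  proof eventually_elim
    case (elim x)
    have "integral_operator A f x + integral_operator ?D f x =
        (LINT y|unit_M. A x y * f y + (B x y - A x y) * f y)"
      unfolding integral_operator_def by (rule Bochner_Integration.integral_add[symmetric]) (rule elim)+
    also have "\<dots> = integral_operator B f x"
      unfolding integral_operator_def by (simp add: algebra_simps)
    finally show ?case by simp
  qed
  then have "L2_norm (integral_operator B f) = L2_norm (\<lambda>x. integral_operator A f x + integral_operator ?D f x)"
    by (intro L2_norm_cong_AE L2_spaceD(1) B L2_norm_add_le(1) A(2) S(2))
  also have "\<dots> \<le> L2_norm (integral_operator A f) + L2_norm (integral_operator ?D f)"
    by (intro L2_norm_add_le(2) A(2) S(2))
  finally show ?thesis using S(3) by linarith
qed

abbreviation conv_operator :: "complex \<Rightarrow> complex \<Rightarrow> complex \<Rightarrow> (real \<Rightarrow> complex) \<Rightarrow> real \<Rightarrow> complex" where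
  "conv_operator z L M \<equiv> integral_operator (\<lambda>x y. conv_kernel z L M (x - y))"

lemma conv_kernel_measurable [measurable]: "conv_kernel z L M \<in> borel_measurable borel"
  unfolding conv_kernel_def by measurable

lemma conv_kernel_pair_measurable:
  "(\<lambda>p. conv_kernel z L M (fst p - snd p)) \<in> borel_measurable (borel \<Otimes>\<^sub>M borel)"
  by measurable

lemma discrete_kernel_measurable:
  "(\<lambda>p. discrete_kernel s z n (fst p) (snd p)) \<in> borel_measurable (borel \<Otimes>\<^sub>M borel)"
proof -
  have "(\<lambda>p. \<lfloor>real n * fst p\<rfloor> - \<lfloor>real n * snd p\<rfloor>) \<in> (borel :: (real \<times> real) measure) \<rightarrow>\<^sub>M count_space UNIV"
    unfolding borel_prod[symmetric] by measurable
  then have "(\<lambda>p. s (\<lfloor>real n * fst p\<rfloor> - \<lfloor>real n * snd p\<rfloor>)) \<in> borel_measurable (borel :: (real \<times> real) measure)"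
    by (rule measurable_compose) simp
  then show ?thesis unfolding discrete_kernel_def borel_prod by measurable
qed

lemma schur_dominated_conv_kernel:
  assumes "0 < Re z"
  shows "\<exists>h \<eta>. schur_dominated (\<lambda>x y. conv_kernel z L M (x - y)) h \<eta>"
proof -
  let ?c = "max (cmod L) (cmod M)"
  have "schur_dominated (\<lambda>x y. conv_kernel z L M (x - y))
     (\<lambda>t. ?c * \<bar>t\<bar> powr (Re z - 1) + 0 * \<bar>t\<bar> powr (1 - 1)) (2 * ?c / Re z + 2 * 0 / 1)"
    by (rule schur_dominated_powr) (use assms conv_kernel_le[of z L M] conv_kernel_pair_measurable in \<open>auto simp: le_max_iff_disj\<close>)
  then show ?thesis by blast
qed

lemma conv_operator_bounded:
  assumes "0 < Re z"
  shows "\<exists>C\<ge>0. \<forall>f\<in>L2_space. conv_operator z L M f \<in> L2_space \<and> L2_norm (conv_operator z L M f) \<le> C * L2_norm f"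
proof -
  from schur_dominated_conv_kernel[OF assms] obtain h \<eta>
    where D: "schur_dominated (\<lambda>x y. conv_kernel z L M (x - y)) h \<eta>" by blast
  then have "0 \<le> \<eta>" by (simp add: schur_dominated_def)
  with schur_test(2,3)[OF D] show ?thesis by blast
qed

text \<open>
  With \<open>\<tau> = n (x - y)\<close> the index \<open>\<lfloor>n x\<rfloor> - \<lfloor>n y\<rfloor>\<close> differs from \<open>\<tau>\<close> by less than
  one, so homogeneity turns the estimate on the integer scale into one on the unit interval.
\<close>

lemma discrete_kernel_close:
  assumes n: "0 < n" and q: "0 < Re z" and \<epsilon>: "0 < \<epsilon>" "0 \<le> C" and xy: "x \<noteq> y"
    and near: "\<forall>\<tau> i. \<tau> \<noteq> 0 \<and> \<bar>\<tau> - of_int i\<bar> < 1 \<longrightarrow>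
     cmod (s i - conv_kernel z L M \<tau>) \<le> \<epsilon> * \<bar>\<tau>\<bar> powr (Re z - 1) + C * \<bar>\<tau>\<bar> powr (Re z / 2 - 1)"
  shows "cmod (discrete_kernel s z n x y - conv_kernel z L M (x - y)) \<le>
     \<epsilon> * \<bar>x - y\<bar> powr (Re z - 1) + C * real n powr (- (Re z / 2)) * \<bar>x - y\<bar> powr (Re z / 2 - 1)"
proof -
  define \<tau> where "\<tau> = real n * (x - y)"
  define i where "i = \<lfloor>real n * x\<rfloor> - \<lfloor>real n * y\<rfloor>"
  have npos: "0 < real n" using n by simp
  have "\<tau> \<noteq> 0" using n xy by (simp add: \<tau>_def)
  moreover have "\<bar>\<tau> - of_int i\<bar> < 1"
  proof -
    have "\<tau> = real n * x - real n * y" by (simp add: \<tau>_def right_diff_distrib)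
    moreover have "of_int \<lfloor>real n * x\<rfloor> \<le> real n * x" "real n * x < of_int \<lfloor>real n * x\<rfloor> + 1"
      "of_int \<lfloor>real n * y\<rfloor> \<le> real n * y" "real n * y < of_int \<lfloor>real n * y\<rfloor> + 1" by linarith+
    ultimately show ?thesis unfolding i_def of_int_diff by linarith
  qed
  ultimately have s: "cmod (s i - conv_kernel z L M \<tau>) \<le> \<epsilon> * \<bar>\<tau>\<bar> powr (Re z - 1) + C * \<bar>\<tau>\<bar> powr (Re z / 2 - 1)"
    using near by blast
  have "of_real (real n) powr (1 - z) * (of_real (real n) powr (z - 1)) = (1 :: complex)"
    using n by (simp add: powr_add[symmetric])
  then have "conv_kernel z L M (x - y) = of_real (real n) powr (1 - z) * conv_kernel z L M \<tau>"
    unfolding \<tau>_def conv_kernel_scale[OF npos] by (simp only: mult.assoc[symmetric] mult_1_left)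
  then have "discrete_kernel s z n x y - conv_kernel z L M (x - y) =
      of_real (real n) powr (1 - z) * (s i - conv_kernel z L M \<tau>)"
    by (simp add: discrete_kernel_def i_def right_diff_distrib)
  then have "cmod (discrete_kernel s z n x y - conv_kernel z L M (x - y)) =
      real n powr (1 - Re z) * cmod (s i - conv_kernel z L M \<tau>)"
    by (simp add: norm_mult cmod_of_real_powr del: of_real_of_nat_eq)
  also have "\<dots> \<le> real n powr (1 - Re z) * (\<epsilon> * \<bar>\<tau>\<bar> powr (Re z - 1) + C * \<bar>\<tau>\<bar> powr (Re z / 2 - 1))"
    by (intro mult_left_mono s) simp
  also have "\<dots> = \<epsilon> * (real n powr (1 - Re z) * real n powr (Re z - 1)) * \<bar>x - y\<bar> powr (Re z - 1)
      + C * (real n powr (1 - Re z) * real n powr (Re z / 2 - 1)) * \<bar>x - y\<bar> powr (Re z / 2 - 1)"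
    by (simp add: \<tau>_def abs_mult powr_mult distrib_left ac_simps)
  also have "real n powr (1 - Re z) * real n powr (Re z - 1) = 1"
    using n by (simp add: powr_add[symmetric])
  also have "real n powr (1 - Re z) * real n powr (Re z / 2 - 1) = real n powr (- (Re z / 2))"
    by (simp add: powr_add[symmetric])
  finally show ?thesis by simp
qed

text \<open>
  The discretised operator has norm \<open>toeplitz_norm s n / n powr Re z\<close> and differs from the limit
  operator by at most \<open>\<eta> n\<close> in the Schur bound. The limit of \<open>\<eta>\<close> is a multiple of \<open>\<epsilon>\<close>.
\<close>

lemma toeplitz_norm_tendsto_operator_norm:
  fixes s :: "int \<Rightarrow> complex"
  assumes z: "0 < Re z" "Re z < 1"
    and L: "(\<lambda>n. s (int n) / of_real (real n) powr (z - 1)) \<longlonglongrightarrow> L"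
    and M: "(\<lambda>n. s (- int n) / of_real (real n) powr (z - 1)) \<longlonglongrightarrow> M"
  shows "(\<lambda>n. toeplitz_norm s n / real n powr Re z) \<longlonglongrightarrow> L2_operator_norm (conv_operator z L M)"
proof (rule LIMSEQ_I)
  fix r :: real assume r: "0 < r"
  let ?K = "conv_operator z L M" and ?N = "\<lambda>n. toeplitz_norm s n / real n powr Re z"
  let ?q = "Re z"
  \<comment> \<open>Chosen so that the part of \<open>\<eta> n\<close> that does not tend to zero is \<open>r / 2\<close>.\<close>
  define \<epsilon> where "\<epsilon> = r * ?q / 4"
  have \<epsilon>: "0 < \<epsilon>" "2 * \<epsilon> / ?q = r / 2" using r z by (auto simp: \<epsilon>_def)
  from coefficients_near_kernel[OF z L M \<epsilon>(1)] obtain C where C: "0 \<le> C" and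
    near: "\<forall>\<tau> i. \<tau> \<noteq> 0 \<and> \<bar>\<tau> - of_int i\<bar> < 1 \<longrightarrow>
     cmod (s i - conv_kernel z L M \<tau>) \<le> \<epsilon> * \<bar>\<tau>\<bar> powr (?q - 1) + C * \<bar>\<tau>\<bar> powr (?q / 2 - 1)" by blast
  define \<eta> where "\<eta> n = 2 * \<epsilon> / ?q + 2 * (C * real n powr (- (?q / 2))) / (?q / 2)" for n
  have \<eta>0: "0 \<le> \<eta> n" for n using \<epsilon> C z by (simp add: \<eta>_def)
  have bounded: "\<exists>C\<ge>0. \<forall>f\<in>L2_space. ?K f \<in> L2_space \<and> L2_norm (?K f) \<le> C * L2_norm f"
    by (rule conv_operator_bounded) (rule z)
  note K0 = L2_operator_norm_nonneg[OF bounded]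
  have close: "\<bar>?N n - L2_operator_norm ?K\<bar> \<le> \<eta> n" if n: "0 < n" for n
  proof -
    let ?Kn = "integral_operator (discrete_kernel s z n)"
    let ?h = "\<lambda>t. \<epsilon> * \<bar>t\<bar> powr (?q - 1) + (C * real n powr (- (?q / 2))) * \<bar>t\<bar> powr (?q / 2 - 1)"
    have D1: "schur_dominated (\<lambda>x y. discrete_kernel s z n x y - conv_kernel z L M (x - y)) ?h (\<eta> n)"
      unfolding \<eta>_def
    proof (rule schur_dominated_powr)
      show "(\<lambda>p. discrete_kernel s z n (fst p) (snd p) - conv_kernel z L M (fst p - snd p)) \<in> borel_measurable (borel \<Otimes>\<^sub>M borel)"
        by (intro borel_measurable_diff discrete_kernel_measurable conv_kernel_pair_measurable)
      show "cmod (discrete_kernel s z n x y - conv_kernel z L M (x - y)) \<le> ?h (x - y)" if "x \<noteq> y" for x y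
        by (rule discrete_kernel_close[OF n z(1) \<epsilon>(1) C that near])
    qed (use z \<epsilon> C in auto)
    have D2: "schur_dominated (\<lambda>x y. conv_kernel z L M (x - y) - discrete_kernel s z n x y) ?h (\<eta> n)"
      unfolding \<eta>_def
    proof (rule schur_dominated_powr)
      show "(\<lambda>p. conv_kernel z L M (fst p - snd p) - discrete_kernel s z n (fst p) (snd p)) \<in> borel_measurable (borel \<Otimes>\<^sub>M borel)"
        by (intro borel_measurable_diff discrete_kernel_measurable conv_kernel_pair_measurable)
      show "cmod (conv_kernel z L M (x - y) - discrete_kernel s z n x y) \<le> ?h (x - y)" if "x \<noteq> y" for x y
        using discrete_kernel_close[OF n z(1) \<epsilon>(1) C that near] by (simp add: norm_minus_commute)
    qed (use z \<epsilon> C in auto)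
    have N0: "0 \<le> ?N n" by (simp add: toeplitz_norm_nonneg)
    have Kf: "?K f \<in> L2_space" if "f \<in> L2_space" for f using bounded that by blast
    have Kint: "AE x in unit_M. integrable unit_M (\<lambda>y. conv_kernel z L M (x - y) * f y)"
      if "f \<in> L2_space" for f
      using schur_dominated_conv_kernel[OF z(1), of L M] schur_test(1)[OF _ that] by blast
    have "L2_operator_norm ?K \<le> ?N n + \<eta> n"
    proof (rule L2_operator_norm_least)
      fix f assume f: "f \<in> L2_space"
      have "L2_norm (?K f) \<le> L2_norm (?Kn f) + \<eta> n * L2_norm f"
        using discrete_operator_integrable[OF n f] discrete_operator_L2(1)[OF n f]
        by (intro operator_triangle[OF f _ _ Kf[OF f] D2]) auto
      also have "\<dots> \<le> ?N n * L2_norm f + \<eta> n * L2_norm f"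
        by (intro add_mono discrete_operator_norm_le n f) simp
      finally show "?K f \<in> L2_space \<and> L2_norm (?K f) \<le> (?N n + \<eta> n) * L2_norm f"
        using Kf[OF f] by (simp add: distrib_right)
    qed (use N0 \<eta>0 in simp)
    moreover have "toeplitz_norm s n \<le> (L2_operator_norm ?K + \<eta> n) * real n powr ?q"
    proof (rule toeplitz_norm_le_discrete_operator[OF n])
      fix f assume f: "f \<in> L2_space"
      have "L2_norm (?Kn f) \<le> L2_norm (?K f) + \<eta> n * L2_norm f"
        by (rule operator_triangle[OF f Kint[OF f] Kf[OF f] discrete_operator_L2(1)[OF n f] D1])
      also have "\<dots> \<le> L2_operator_norm ?K * L2_norm f + \<eta> n * L2_norm f"
        by (intro add_mono L2_operator_norm_bound bounded f) simp
      finally show "L2_norm (?Kn f) \<le> (L2_operator_norm ?K + \<eta> n) * L2_norm f"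
        by (simp add: distrib_right)
    qed (use K0 \<eta>0 in simp)
    then have "?N n \<le> L2_operator_norm ?K + \<eta> n" using n by (simp add: pos_divide_le_eq)
    ultimately show ?thesis by linarith
  qed
  have "(\<lambda>n. 2 * \<epsilon> / ?q + 2 * (C * real n powr (- (?q / 2))) / (?q / 2)) \<longlonglongrightarrow> 2 * \<epsilon> / ?q + 2 * (C * 0) / (?q / 2)"
    by (intro tendsto_intros tendsto_neg_powr filterlim_real_sequentially) (use z in auto)
  then have "\<eta> \<longlonglongrightarrow> r / 2" unfolding \<eta>_def \<epsilon>(2) by simp
  then have "eventually (\<lambda>n. \<eta> n < r) sequentially" by (rule order_tendstoD(2)) (use r in simp)
  then have "eventually (\<lambda>n. norm (?N n - L2_operator_norm ?K) < r) sequentially"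
    using eventually_gt_at_top[of 0]
  proof eventually_elim
    case (elim n)
    then show ?case using close[of n] unfolding real_norm_def by linarith
  qed
  then show "\<exists>no. \<forall>n\<ge>no. norm (?N n - L2_operator_norm ?K) < r" unfolding eventually_sequentially .
qed

lemma isCont_conv_kernel:
  assumes "t \<noteq> 0"
  shows "isCont (conv_kernel z L M) t"
proof (cases "0 < t")
  case True
  have "isCont (\<lambda>t. L * of_real t powr (z - 1)) t"
    using True by (intro continuous_intros) auto
  moreover have "eventually (\<lambda>u. conv_kernel z L M u = L * of_real u powr (z - 1)) (nhds t)"
    using eventually_nhds_in_open[of "{0<..}" t] True by (auto simp: conv_kernel_def elim: eventually_mono)
  ultimately show ?thesis by (simp add: isCont_cong)
next
  case False
  with assms have t: "t < 0" by simp
  have "isCont (\<lambda>t. M * of_real (- t) powr (z - 1)) t"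
    using t by (intro continuous_intros) auto
  moreover have "eventually (\<lambda>u. conv_kernel z L M u = M * of_real (- u) powr (z - 1)) (nhds t)"
    using eventually_nhds_in_open[of "{..<0}" t] t by (auto simp: conv_kernel_def elim: eventually_mono)
  ultimately show ?thesis by (simp add: isCont_cong)
qed

text \<open>
  Near some off-diagonal point the kernel is close to a nonzero constant; the operator maps the
  indicator function of a short interval to a function that does not vanish on another interval.
\<close>

lemma conv_operator_norm_pos:
  assumes z: "0 < Re z" and LM: "L \<noteq> 0 \<or> M \<noteq> 0"
  shows "0 < L2_operator_norm (conv_operator z L M)"
proof (rule ccontr)
  let ?K = "conv_operator z L M" and ?k = "conv_kernel z L M"
  note bounded = conv_operator_bounded[OF z, of L M]
  assume "\<not> 0 < L2_operator_norm ?K"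
  then have K0: "L2_operator_norm ?K = 0" using L2_operator_norm_nonneg[OF bounded] by linarith
  \<comment> \<open>The side of the diagonal is chosen according to which constant is nonzero.\<close>
  obtain x0 y0 :: real where xy: "1/4 \<le> x0" "x0 \<le> 3/4" "1/4 \<le> y0" "y0 \<le> 3/4" "x0 \<noteq> y0" "?k (x0 - y0) \<noteq> 0"
  proof (cases "L = 0")
    case False
    then show ?thesis by (intro that[of "3/4" "1/4"]) (auto simp: conv_kernel_def)
  next
    case True
    then show ?thesis using LM by (intro that[of "1/4" "3/4"]) (auto simp: conv_kernel_def)
  qed
  define k0 where "k0 = ?k (x0 - y0)"
  have k0: "cmod k0 > 0" using xy by (simp add: k0_def)
  have "isCont ?k (x0 - y0)" by (rule isCont_conv_kernel) (use xy in simp)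
  then obtain d where d: "d > 0" "\<And>t. \<bar>t - (x0 - y0)\<bar> < d \<Longrightarrow> cmod (?k t - k0) < cmod k0 / 2"
    unfolding continuous_at_eps_delta dist_norm k0_def[symmetric] real_norm_def
    using k0 by (meson half_gt_zero)
  define \<delta> where "\<delta> = min (1/8) (d / 2)"
  have \<delta>: "0 < \<delta>" "\<delta> \<le> 1/8" "2 * \<delta> \<le> d" using d by (auto simp: \<delta>_def)
  let ?I = "{y0 - \<delta><..<y0 + \<delta>}"
  let ?f = "\<lambda>y. of_real (indicator ?I y) :: complex"
  have I: "?I \<subseteq> {0<..<1}" using xy \<delta> by auto
  have ind: "integrable unit_M (\<lambda>y. indicator ?I y :: real)" "(LINT y|unit_M. indicator ?I y) = 2 * \<delta>"
  proof -
    have "?I \<in> sets unit_M" using I by (auto simp: sets_restrict_space_iff)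
    then show "integrable unit_M (\<lambda>y. indicator ?I y :: real)" by (simp add: unit.emeasure_finite less_top[symmetric])
    have "(LINT y|unit_M. indicator ?I y) = measure unit_M (?I \<inter> space unit_M)"
      by simp
    also have "?I \<inter> space unit_M = ?I" by (rule Int_absorb2) (use I in simp)
    also have "measure unit_M ?I = measure lebesgue ?I" using I by (subst measure_restrict_space) auto
    finally show "(LINT y|unit_M. indicator ?I y) = 2 * \<delta>" using \<delta> by simp
  qed
  have fint: "integrable unit_M ?f" using ind(1) by (rule integrable_of_real)
  have f: "?f \<in> L2_space"
  proof -
    have "(cmod (?f y))\<^sup>2 = indicator ?I y" for y by (simp add: indicator_def)
    then show ?thesis using ind(1) fint by (simp add: L2_space_def)
  qed
  have Kf: "?K ?f \<in> L2_space" using bounded f by blast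
  have "L2_norm (?K ?f) \<le> 0" using L2_operator_norm_bound[OF bounded f] K0 by simp
  then have "(LINT x|unit_M. (cmod (?K ?f x))\<^sup>2) = 0"
    unfolding L2_norm_sq[symmetric] using L2_norm_nonneg[of "?K ?f"] by simp
  then have "AE x in unit_M. (cmod (?K ?f x))\<^sup>2 = 0"
    by (subst (asm) integral_nonneg_eq_0_iff_AE) (use L2_spaceD(2)[OF Kf] in auto)
  then have zero: "AE x in unit_M. ?K ?f x = 0" by simp
  have nonzero: "?K ?f x \<noteq> 0" if x: "\<bar>x - x0\<bar> < \<delta>" for x
  proof -
    let ?g = "\<lambda>y. (?k (x - y) - k0) * ?f y"
    have g_le: "cmod (?g y) \<le> cmod k0 / 2 * indicator ?I y" for y
    proof (cases "y \<in> ?I")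
      case True
      then have "\<bar>(x - y) - (x0 - y0)\<bar> < d" using x \<delta> unfolding greaterThanLessThan_iff by linarith
      from d(2)[OF this] True show ?thesis by (simp add: norm_mult)
    qed (use k0 in simp)
    have k_meas: "(\<lambda>y. ?k (x - y)) \<in> borel_measurable unit_M"
      by (rule borel_measurable_lebesgue_on_borel) measurable
    have gint: "integrable unit_M ?g"
    proof (rule Bochner_Integration.integrable_bound)
      show "integrable unit_M (\<lambda>y. cmod k0 / 2 * indicator ?I y)" by (intro integrable_mult_right ind)
      show "?g \<in> borel_measurable unit_M"
        by (intro borel_measurable_times borel_measurable_diff k_meas borel_measurable_const borel_measurable_integrable fint)
      have "norm (?g y) \<le> norm (cmod k0 / 2 * indicator ?I y)" for y
        using order_trans[OF g_le abs_ge_self] by simp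
      then show "AE y in unit_M. norm (?g y) \<le> norm (cmod k0 / 2 * indicator ?I y)" by simp
    qed
    have "?K ?f x = (LINT y|unit_M. ?g y + k0 * ?f y)"
      unfolding integral_operator_def by (simp add: algebra_simps)
    also have "\<dots> = (LINT y|unit_M. ?g y) + k0 * (LINT y|unit_M. ?f y)"
      by (subst Bochner_Integration.integral_add) (auto intro!: gint fint)
    also have "(LINT y|unit_M. ?f y) = of_real (2 * \<delta>)"
      using ind(2) by (simp only: integral_complex_of_real)
    finally have "?K ?f x = (LINT y|unit_M. ?g y) + k0 * of_real (2 * \<delta>)" .
    moreover have "cmod (LINT y|unit_M. ?g y) \<le> \<delta> * cmod k0"
    proof -
      have "cmod (LINT y|unit_M. ?g y) \<le> (LINT y|unit_M. cmod k0 / 2 * indicator ?I y)"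
        by (intro Bochner_Integration.integral_norm_bound_integral gint integrable_mult_right ind g_le)
      also have "\<dots> = \<delta> * cmod k0" using ind(2) by simp
      finally show ?thesis .
    qed
    moreover have "cmod (k0 * of_real (2 * \<delta>)) = 2 * (\<delta> * cmod k0)" using \<delta> by (simp add: norm_mult)
    moreover have "0 < \<delta> * cmod k0" using \<delta> k0 by simp
    moreover have "G + c \<noteq> 0" if "cmod G \<le> e" "cmod c = 2 * e" "0 < e" for G c :: complex and e :: real
    proof
      assume "G + c = 0"
      then have "G = - c" by (simp add: eq_neg_iff_add_eq_0)
      with that show False by simp
    qed
    ultimately show ?thesis by metis
  qed
  have "AE x in unit_M. x \<notin> {x0 - \<delta><..<x0 + \<delta>}"
    using zero
  proof eventually_elim
    case (elim x)
    then show ?case using nonzero[of x] by (auto simp: abs_less_iff)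
  qed
  then have "AE x in lebesgue. x \<in> {0<..<1} \<longrightarrow> x \<notin> {x0 - \<delta><..<x0 + \<delta>}"
    by (simp add: AE_restrict_space_iff)
  moreover have "{x0 - \<delta><..<x0 + \<delta>} \<subseteq> {0<..<1}" using xy \<delta> by auto
  ultimately have "AE x in lebesgue. x \<notin> {x0 - \<delta><..<x0 + \<delta>}"
    by (auto elim!: eventually_mono)
  then have "{x0 - \<delta><..<x0 + \<delta>} \<in> null_sets lebesgue"
    by (subst (asm) AE_iff_null_sets[symmetric]) auto
  then have "measure lebesgue {x0 - \<delta><..<x0 + \<delta>} = 0" by (rule measure_eq_0_null_sets)
  then show False using \<delta> by simp
qed

section \<open>Comparison of the symbol with a model symbol\<close>

text \<open>
  The number \<open>y\<close> is the argument that enters the jump factor of the symbol. The identity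
  \<open>1 + e\<^sup>i\<^sup>y = 2 cos (y/2) e\<^sup>i\<^sup>y\<^sup>/\<^sup>2\<close> expresses both one-sided binomials by it. Here
  \<open>cis \<theta>\<close> approaches \<open>cis \<theta>0\<close> exactly when \<open>|y|\<close> approaches \<open>pi\<close>.
\<close>

lemma polar_unit_distance:
  assumes "cis \<theta> \<noteq> cis \<theta>0"
  defines "y \<equiv> Arg (- cis \<theta> / cis \<theta>0)" and "\<rho> \<equiv> cmod (cis \<theta> - cis \<theta>0)"
  shows "\<bar>y\<bar> < pi" "0 < \<rho>" "\<rho> = 2 * cos (y / 2)"
    and "1 - cis (\<theta> - \<theta>0) = of_real \<rho> * cis (y / 2)"
    and "1 - cis (-(\<theta> - \<theta>0)) = of_real \<rho> * cis (-(y / 2))"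
proof -
  have y: "cis y = - cis (\<theta> - \<theta>0)"
    unfolding y_def by (subst cis_Arg) (simp_all add: sgn_div_norm norm_divide cis_divide)
  have "cis (\<theta> - \<theta>0) \<noteq> 1"
    using assms(1) by (auto simp: cis_divide[symmetric])
  then have ypi: "y \<noteq> pi" using y by auto
  have "- pi < y" "y \<le> pi" unfolding y_def using Arg_bounded by blast+
  with ypi show ylt: "\<bar>y\<bar> < pi" by (simp add: abs_less_iff)
  then have cos: "0 < cos (y / 2)" by (intro cos_gt_zero_pi) auto
  have half: "1 + cis u = of_real (2 * cos (u / 2)) * cis (u / 2)" for u
  proof -
    have "1 + cos u = 2 * cos (u / 2) * cos (u / 2)"
      using cos_double_cos[of "u / 2"] by (simp add: power2_eq_square)
    moreover have "sin u = 2 * cos (u / 2) * sin (u / 2)"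
      using sin_double[of "u / 2"] by simp
    ultimately show ?thesis by (simp add: complex_eq_iff)
  qed
  have one: "1 - cis (\<theta> - \<theta>0) = of_real (2 * cos (y / 2)) * cis (y / 2)"
    using half[of y] y by simp
  have "cmod (1 - cis (of_int 1 * (\<theta> - \<theta>0))) = \<rho>" unfolding \<rho>_def by (rule cmod_one_minus_cis) simp
  then show \<rho>: "\<rho> = 2 * cos (y / 2)" using one cos by (simp add: norm_mult)
  then show "0 < \<rho>" using cos by simp
  show "1 - cis (\<theta> - \<theta>0) = of_real \<rho> * cis (y / 2)" unfolding \<rho> by (rule one)
  have "cis (- y) = - cis (-(\<theta> - \<theta>0))"
  proof -
    have "cnj (cis y) = cnj (- cis (\<theta> - \<theta>0))" using y by simp
    then show ?thesis by (simp only: cis_cnj complex_cnj_minus)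
  qed
  then show "1 - cis (-(\<theta> - \<theta>0)) = of_real \<rho> * cis (-(y / 2))"
    unfolding \<rho> using half[of "- y"] by simp
qed

lemma powr_polar:
  assumes "0 < \<rho>" "\<bar>u\<bar> < pi"
  shows "(of_real \<rho> * cis u) powr w = of_real \<rho> powr w * exp (\<i> * w * of_real u)"
proof -
  have "Ln (of_real \<rho> * cis u) = of_real (ln \<rho>) + \<i> * of_real u"
  proof -
    have "of_real \<rho> * cis u = exp (of_real (ln \<rho>) + \<i> * of_real u)"
      using assms(1) by (simp add: exp_add cis_conv_exp exp_of_real)
    moreover have "Ln (exp (of_real (ln \<rho>) + \<i> * of_real u)) = of_real (ln \<rho>) + \<i> * of_real u"
      by (rule Ln_exp) (use assms(2) in \<open>simp_all add: abs_less_iff\<close>)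
    ultimately show ?thesis by simp
  qed
  then show ?thesis
    using assms(1) by (simp add: powr_def exp_add distrib_left Ln_of_real ac_simps)
qed

lemma branch_polar:
  assumes "cis \<theta> \<noteq> cis \<theta>0"
  defines "y \<equiv> Arg (- cis \<theta> / cis \<theta>0)" and "\<rho> \<equiv> cmod (cis \<theta> - cis \<theta>0)"
  shows "branch (2 * \<alpha>) \<theta>0 1 \<theta> = of_real \<rho> powr (- (2 * \<alpha>)) * exp (- (\<i> * \<alpha> * of_real y))"
    and "branch (2 * \<alpha>) \<theta>0 (-1) \<theta> = of_real \<rho> powr (- (2 * \<alpha>)) * exp (\<i> * \<alpha> * of_real y)"
proof -
  note P = polar_unit_distance[OF assms(1), folded y_def \<rho>_def]
  have u: "\<bar>y / 2\<bar> < pi" "\<bar>-(y / 2)\<bar> < pi" using P(1) by auto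
  have "branch (2 * \<alpha>) \<theta>0 1 \<theta> = (of_real \<rho> * cis (y / 2)) powr (- (2 * \<alpha>))"
    unfolding branch_def P(4)[symmetric] by simp
  then show "branch (2 * \<alpha>) \<theta>0 1 \<theta> = of_real \<rho> powr (- (2 * \<alpha>)) * exp (- (\<i> * \<alpha> * of_real y))"
    unfolding powr_polar[OF P(2) u(1)] by (simp add: mult.assoc)
  have "branch (2 * \<alpha>) \<theta>0 (-1) \<theta> = (of_real \<rho> * cis (-(y / 2))) powr (- (2 * \<alpha>))"
    unfolding branch_def P(5)[symmetric] by simp
  then show "branch (2 * \<alpha>) \<theta>0 (-1) \<theta> = of_real \<rho> powr (- (2 * \<alpha>)) * exp (\<i> * \<alpha> * of_real y)"
    unfolding powr_polar[OF P(2) u(2)] by (simp add: mult.assoc)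
qed

text \<open>
  Together with the next definition: the coefficients for which a combination of the two one-sided
  binomials has the same one-sided limits at the singularity, relative to \<open>|t - t0| powr (-2 \<alpha>)\<close>,
  as the given symbol. They solve the two linear equations of the lemma about matching weights.
\<close>

definition weight_plus :: "complex \<Rightarrow> complex \<Rightarrow> complex" where
  "weight_plus \<alpha> \<beta> = sin (of_real pi * (\<alpha> - \<beta>)) / sin (of_real pi * (2 * \<alpha>))"

definition weight_minus :: "complex \<Rightarrow> complex \<Rightarrow> complex" where
  "weight_minus \<alpha> \<beta> = sin (of_real pi * (\<alpha> + \<beta>)) / sin (of_real pi * (2 * \<alpha>))"

lemma sin_two_pi_alpha_nonzero:
  assumes "0 < Re \<alpha>" "Re \<alpha> < 1 / 2"
  shows "sin (of_real pi * (2 * \<alpha>)) \<noteq> 0"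
proof
  assume "sin (of_real pi * (2 * \<alpha>)) = 0"
  then obtain n :: int where "of_real pi * (2 * \<alpha>) = of_real (of_int n * pi)"
    unfolding sin_eq_0 by blast
  then have "2 * \<alpha> = of_int n" by (simp add: mult.commute)
  then have "2 * Re \<alpha> = of_int n" by (metis Re_complex_of_real mult_2 of_real_of_int_eq plus_complex.simps(1))
  then have "0 < (of_int n :: real)" "(of_int n :: real) < 1" using assms by simp_all
  then have "0 < n" "n < 1" by simp_all
  then show False by simp
qed

text \<open>
  With \<open>p = e\<^sup>i\<^sup>\<pi>\<^sup>\<alpha>\<close> and \<open>r = e\<^sup>i\<^sup>\<pi>\<^sup>\<beta>\<close> these are identities between rational functions
  of \<open>p\<close> and \<open>r\<close>.
\<close>

lemma weights_match:
  assumes "0 < Re \<alpha>" "Re \<alpha> < 1 / 2"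
  shows "weight_plus \<alpha> \<beta> * exp (- (\<i> * \<alpha> * of_real pi)) + weight_minus \<alpha> \<beta> * exp (\<i> * \<alpha> * of_real pi) = exp (\<i> * \<beta> * of_real pi)"
    and "weight_plus \<alpha> \<beta> * exp (\<i> * \<alpha> * of_real pi) + weight_minus \<alpha> \<beta> * exp (- (\<i> * \<alpha> * of_real pi)) = exp (- (\<i> * \<beta> * of_real pi))"
proof -
  define p where "p = exp (\<i> * \<alpha> * of_real pi)"
  define r where "r = exp (\<i> * \<beta> * of_real pi)"
  have nz: "p \<noteq> 0" "r \<noteq> 0" by (auto simp: p_def r_def)
  have minus: "exp (- (\<i> * \<alpha> * of_real pi)) = 1 / p" "exp (- (\<i> * \<beta> * of_real pi)) = 1 / r"
    by (auto simp: p_def r_def exp_minus inverse_eq_divide)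
  have S1: "sin (of_real pi * (\<alpha> - \<beta>)) = (p / r - r / p) / (2 * \<i>)"
    by (simp add: sin_exp_eq p_def r_def exp_diff[symmetric] algebra_simps)
  have S2: "sin (of_real pi * (\<alpha> + \<beta>)) = (p * r - 1 / (p * r)) / (2 * \<i>)"
    by (simp add: sin_exp_eq p_def r_def exp_add[symmetric] exp_minus[symmetric] inverse_eq_divide[symmetric] algebra_simps)
  have S3: "sin (of_real pi * (2 * \<alpha>)) = (p * p - 1 / (p * p)) / (2 * \<i>)"
    by (simp add: sin_exp_eq p_def exp_add[symmetric] exp_minus[symmetric] inverse_eq_divide[symmetric] algebra_simps)
  have D: "p * p - 1 / (p * p) \<noteq> 0" using sin_two_pi_alpha_nonzero[OF assms] S3 by simp
  then have W: "weight_plus \<alpha> \<beta> = (p / r - r / p) / (p * p - 1 / (p * p))"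
    "weight_minus \<alpha> \<beta> = (p * r - 1 / (p * r)) / (p * p - 1 / (p * p))"
    by (simp_all add: weight_plus_def weight_minus_def S1 S2 S3)
  have E1: "(p / r - r / p) * (1 / p) + (p * r - 1 / (p * r)) * p = r * (p * p - 1 / (p * p))"
    using nz by (simp add: field_simps)
  have E2: "(p / r - r / p) * p + (p * r - 1 / (p * r)) * (1 / p) = 1 / r * (p * p - 1 / (p * p))"
    using nz by (simp add: field_simps)
  have solve: "a / D * x + b / D * y = v" if "a * x + b * y = v * D" "D \<noteq> 0" for a b x y v D :: complex
    using that by (simp add: add_divide_distrib[symmetric])
  show "weight_plus \<alpha> \<beta> * exp (- (\<i> * \<alpha> * of_real pi)) + weight_minus \<alpha> \<beta> * exp (\<i> * \<alpha> * of_real pi) = exp (\<i> * \<beta> * of_real pi)"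
    unfolding minus p_def[symmetric] r_def[symmetric] W by (rule solve[OF E1 D])
  show "weight_plus \<alpha> \<beta> * exp (\<i> * \<alpha> * of_real pi) + weight_minus \<alpha> \<beta> * exp (- (\<i> * \<alpha> * of_real pi)) = exp (- (\<i> * \<beta> * of_real pi))"
    unfolding minus p_def[symmetric] r_def[symmetric] W by (rule solve[OF E2 D])
qed

definition model_symbol :: "complex \<Rightarrow> complex \<Rightarrow> real \<Rightarrow> real \<Rightarrow> complex" where
  "model_symbol \<alpha> \<beta> \<theta>0 \<theta> =
     weight_plus \<alpha> \<beta> * branch (2 * \<alpha>) \<theta>0 1 \<theta> + weight_minus \<alpha> \<beta> * branch (2 * \<alpha>) \<theta>0 (-1) \<theta>"

definition model_coeff :: "complex \<Rightarrow> complex \<Rightarrow> int \<Rightarrow> complex" where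
  "model_coeff \<alpha> \<beta> j =
     (if 0 \<le> j then weight_plus \<alpha> \<beta> * binomial_coeff (2 * \<alpha>) (nat j) else 0) +
     (if j \<le> 0 then weight_minus \<alpha> \<beta> * binomial_coeff (2 * \<alpha>) (nat (- j)) else 0)"

lemma integrable_branch:
  assumes e: "e = 1 \<or> e = -1" and z: "0 < Re z" "Re z < 1" "\<bar>\<theta>0\<bar> \<le> pi"
  shows "integrable circle_M (branch z \<theta>0 e)"
proof (rule Bochner_Integration.integrable_bound)
  show "integrable circle_M (\<lambda>\<theta>. exp (pi * \<bar>Im z\<bar>) * singular_weight (Re z) \<theta>0 \<theta>)"
    by (intro integrable_mult_right integrable_singular_weight z)
  show "branch z \<theta>0 e \<in> borel_measurable circle_M"
    by (intro borel_measurable_lebesgue_on_borel branch_measurable)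
  have "norm (branch z \<theta>0 e \<theta>) \<le> norm (exp (pi * \<bar>Im z\<bar>) * singular_weight (Re z) \<theta>0 \<theta>)" for \<theta>
    using order_trans[OF branch_le[OF e] abs_ge_self] by simp
  then show "AE \<theta> in circle_M. norm (branch z \<theta>0 e \<theta>) \<le> norm (exp (pi * \<bar>Im z\<bar>) * singular_weight (Re z) \<theta>0 \<theta>)"
    by simp
qed

lemma integrable_mult_cis:
  assumes "integrable circle_M g"
  shows "integrable circle_M (\<lambda>\<theta>. g \<theta> * cis (- of_int j * \<theta>))"
  by (rule integrable_mult_trig_poly[OF assms, where B = 1])
     (intro borel_measurable_continuous_onI continuous_intros, simp)

lemma model_symbol_coeff:
  assumes \<alpha>: "0 < Re \<alpha>" "Re \<alpha> < 1 / 2" and \<theta>0: "\<bar>\<theta>0\<bar> \<le> pi"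
  shows "integrable circle_M (model_symbol \<alpha> \<beta> \<theta>0)"
    and "1 / (2 * of_real pi) * (LINT \<theta>|circle_M. model_symbol \<alpha> \<beta> \<theta>0 \<theta> * cis (- of_int j * \<theta>)) =
       cis (of_int j * (- \<theta>0)) * model_coeff \<alpha> \<beta> j"
proof -
  have z: "0 < Re (2 * \<alpha>)" "Re (2 * \<alpha>) < 1" using \<alpha> by auto
  let ?b = "\<lambda>e. branch (2 * \<alpha>) \<theta>0 e"
  have e: "(1::int) = 1 \<or> (1::int) = -1" "(-1::int) = 1 \<or> (-1::int) = -1" by auto
  have int: "integrable circle_M (?b 1)" "integrable circle_M (?b (-1))"
    using integrable_branch[OF e(1) z \<theta>0] integrable_branch[OF e(2) z \<theta>0] .
  then show "integrable circle_M (model_symbol \<alpha> \<beta> \<theta>0)"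
    unfolding model_symbol_def by (intro Bochner_Integration.integrable_add integrable_mult_right)
  have "(LINT \<theta>|circle_M. model_symbol \<alpha> \<beta> \<theta>0 \<theta> * cis (- of_int j * \<theta>)) =
      (LINT \<theta>|circle_M. weight_plus \<alpha> \<beta> * (?b 1 \<theta> * cis (- of_int j * \<theta>)) +
         weight_minus \<alpha> \<beta> * (?b (-1) \<theta> * cis (- of_int j * \<theta>)))"
    by (simp only: model_symbol_def distrib_right mult.assoc)
  also have "\<dots> = weight_plus \<alpha> \<beta> * (LINT \<theta>|circle_M. ?b 1 \<theta> * cis (- of_int j * \<theta>)) +
      weight_minus \<alpha> \<beta> * (LINT \<theta>|circle_M. ?b (-1) \<theta> * cis (- of_int j * \<theta>))"
    by (subst Bochner_Integration.integral_add)
       (intro integrable_mult_right integrable_mult_cis int | simp only: integral_mult_right_zero)+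
  finally show "1 / (2 * of_real pi) * (LINT \<theta>|circle_M. model_symbol \<alpha> \<beta> \<theta>0 \<theta> * cis (- of_int j * \<theta>)) =
       cis (of_int j * (- \<theta>0)) * model_coeff \<alpha> \<beta> j"
    unfolding branch_coeff[OF e(1) z \<theta>0] branch_coeff[OF e(2) z \<theta>0]
    by (simp add: model_coeff_def algebra_simps)
qed

lemma Gamma_nonzero_Re_pos: "0 < Re z \<Longrightarrow> Gamma z \<noteq> 0"
  by (auto simp: Gamma_eq_zero_iff elim!: nonpos_Ints_cases)

text \<open>
  Euler's reflection formula turns the weights into the constants of the limit kernel.
\<close>

lemma model_coeff_asymp:
  assumes \<alpha>: "0 < Re \<alpha>" "Re \<alpha> < 1 / 2"
  shows "(\<lambda>n. model_coeff \<alpha> \<beta> (int n) / of_real (real n) powr (2 * \<alpha> - 1)) \<longlonglongrightarrow> C_plus \<alpha> \<beta>"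
    and "(\<lambda>n. model_coeff \<alpha> \<beta> (- int n) / of_real (real n) powr (2 * \<alpha> - 1)) \<longlonglongrightarrow> C_minus \<alpha> \<beta>"
proof -
  let ?z = "2 * \<alpha>"
  have lim: "(\<lambda>n. c * (binomial_coeff ?z n / of_real (real n) powr (?z - 1))) \<longlonglongrightarrow> c * inverse (Gamma ?z)" for c
    by (intro tendsto_mult tendsto_const binomial_coeff_asymp)
  have G: "Gamma ?z \<noteq> 0" by (rule Gamma_nonzero_Re_pos) (use \<alpha> in simp)
  have "Gamma ?z * Gamma (1 - ?z) = of_real pi / sin (of_real pi * ?z)" by (rule Gamma_reflection_complex)
  then have inv: "inverse (Gamma ?z) = Gamma (1 - ?z) * sin (of_real pi * ?z) / of_real pi"
    using G sin_two_pi_alpha_nonzero[OF \<alpha>] by (simp add: field_simps)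
  have vals: "weight_plus \<alpha> \<beta> * inverse (Gamma ?z) = C_plus \<alpha> \<beta>"
    "weight_minus \<alpha> \<beta> * inverse (Gamma ?z) = C_minus \<alpha> \<beta>"
    unfolding inv weight_plus_def weight_minus_def C_plus_def C_minus_def
    using sin_two_pi_alpha_nonzero[OF \<alpha>] by (simp_all add: mult.commute)
  show "(\<lambda>n. model_coeff \<alpha> \<beta> (int n) / of_real (real n) powr (2 * \<alpha> - 1)) \<longlonglongrightarrow> C_plus \<alpha> \<beta>"
    using lim[of "weight_plus \<alpha> \<beta>"] unfolding vals
    by (rule Lim_transform_eventually)
       (use eventually_gt_at_top[of 0] in \<open>rule eventually_mono, simp add: model_coeff_def\<close>)
  show "(\<lambda>n. model_coeff \<alpha> \<beta> (- int n) / of_real (real n) powr (2 * \<alpha> - 1)) \<longlonglongrightarrow> C_minus \<alpha> \<beta>"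
    using lim[of "weight_minus \<alpha> \<beta>"] unfolding vals
    by (rule Lim_transform_eventually)
       (use eventually_gt_at_top[of 0] in \<open>rule eventually_mono, simp add: model_coeff_def\<close>)
qed

lemma kernel_k_eq_conv_kernel:
  "kernel_k \<alpha> \<beta> = (\<lambda>x y. conv_kernel (2 * \<alpha>) (C_plus \<alpha> \<beta>) (C_minus \<alpha> \<beta>) (x - y))"
  by (intro ext) (simp add: kernel_k_def conv_kernel_def)

text \<open>
  If both constants vanished, so would both weights, and their combination could not be an
  exponential.
\<close>

lemma C_plus_or_C_minus_nonzero:
  assumes \<alpha>: "0 < Re \<alpha>" "Re \<alpha> < 1 / 2"
  shows "C_plus \<alpha> \<beta> \<noteq> 0 \<or> C_minus \<alpha> \<beta> \<noteq> 0"
proof (rule ccontr)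
  assume "\<not> ?thesis"
  moreover have "Gamma (1 - 2 * \<alpha>) \<noteq> 0" by (rule Gamma_nonzero_Re_pos) (use \<alpha> in simp)
  ultimately have "weight_plus \<alpha> \<beta> = 0" "weight_minus \<alpha> \<beta> = 0"
    by (auto simp: C_plus_def C_minus_def weight_plus_def weight_minus_def)
  with weights_match(1)[OF \<alpha>, of \<beta>] show False by simp
qed

text \<open>
  Restates vanishing at \<open>|y| = pi\<close> in terms of \<open>2 cos (y/2)\<close>, which is the distance to the
  singularity.
\<close>

lemma continuous_vanishing_at_pi:
  fixes h :: "real \<Rightarrow> complex"
  assumes h: "continuous_on UNIV h" "h pi = 0" "h (- pi) = 0" and \<epsilon>: "0 < \<epsilon>"
  shows "\<exists>\<delta>>0. \<forall>y. \<bar>y\<bar> \<le> pi \<and> 2 * cos (y / 2) < \<delta> \<longrightarrow> cmod (h y) < \<epsilon>"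
proof -
  have cont: "isCont h y" for y using h(1) by (simp add: continuous_on_eq_continuous_at)
  obtain d1 where d1: "d1 > 0" "\<And>y. \<bar>y - pi\<bar> < d1 \<Longrightarrow> cmod (h y) < \<epsilon>"
    using cont[of pi] \<epsilon> unfolding continuous_at_eps_delta h dist_norm by auto
  obtain d2 where d2: "d2 > 0" "\<And>y. \<bar>y + pi\<bar> < d2 \<Longrightarrow> cmod (h y) < \<epsilon>"
    using cont[of "- pi"] \<epsilon> unfolding continuous_at_eps_delta h dist_norm by auto
  define d where "d = min (min d1 d2) pi / 2"
  have d: "0 < d" "d < d1" "d < d2" "d < pi" 
  proof -
    have "min (min d1 d2) pi \<le> d1" "min (min d1 d2) pi \<le> d2" "min (min d1 d2) pi \<le> pi" by auto
    moreover have "0 < min (min d1 d2) pi" using d1(1) d2(1) by simp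
    ultimately show "0 < d" "d < d1" "d < d2" "d < pi" unfolding d_def by linarith+
  qed
  have "cmod (h y) < \<epsilon>" if y: "\<bar>y\<bar> \<le> pi" "2 * cos (y / 2) < 2 * sin (d / 2)" for y
  proof -
    have "pi - d < \<bar>y\<bar>"
    proof (rule ccontr)
      assume "\<not> pi - d < \<bar>y\<bar>"
      then have "cos ((pi - d) / 2) \<le> cos (\<bar>y\<bar> / 2)"
        using d y by (intro cos_monotone_0_pi_le) auto
      moreover have "cos ((pi - d) / 2) = sin (d / 2)" by (simp add: sin_cos_eq diff_divide_distrib)
      moreover have "cos (\<bar>y\<bar> / 2) = cos (y / 2)" by (cases "0 \<le> y") auto
      ultimately show False using y(2) by simp
    qed
    then have "\<bar>y - pi\<bar> < d1 \<or> \<bar>y + pi\<bar> < d2" using d y(1) by linarith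
    then show ?thesis using d1(2) d2(2) by blast
  qed
  moreover have "0 < 2 * sin (d / 2)" using d by (simp add: sin_gt_zero)
  ultimately show ?thesis by blast
qed

lemma cmod_exp_i_le:
  assumes "\<bar>y\<bar> \<le> pi"
  shows "cmod (exp (\<i> * w * of_real y)) \<le> exp (pi * \<bar>Im w\<bar>)"
    and "cmod (exp (- (\<i> * w * of_real y))) \<le> exp (pi * \<bar>Im w\<bar>)"
proof -
  have "\<bar>Im w * y\<bar> \<le> \<bar>Im w\<bar> * pi" unfolding abs_mult by (intro mult_left_mono assms) simp
  then have "- (Im w * y) \<le> pi * \<bar>Im w\<bar>" "Im w * y \<le> pi * \<bar>Im w\<bar>" by (simp_all add: abs_le_iff mult.commute)
  then show "cmod (exp (\<i> * w * of_real y)) \<le> exp (pi * \<bar>Im w\<bar>)"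
    "cmod (exp (- (\<i> * w * of_real y))) \<le> exp (pi * \<bar>Im w\<bar>)" by simp_all
qed

lemma symbol_polar:
  assumes "cis \<theta> \<noteq> cis \<theta>0"
  defines "y \<equiv> Arg (- cis \<theta> / cis \<theta>0)"
  shows "cmod (symbol_sigma \<alpha> \<beta> (cis \<theta>0) (cis \<theta>) * b - b0 * model_symbol \<alpha> \<beta> \<theta>0 \<theta>) =
     singular_weight (2 * Re \<alpha>) \<theta>0 \<theta> *
       cmod (b * exp (\<i> * \<beta> * of_real y) -
          b0 * (weight_plus \<alpha> \<beta> * exp (- (\<i> * \<alpha> * of_real y)) + weight_minus \<alpha> \<beta> * exp (\<i> * \<alpha> * of_real y)))"
proof -
  let ?\<rho> = "cmod (cis \<theta> - cis \<theta>0)"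
  have "symbol_sigma \<alpha> \<beta> (cis \<theta>0) (cis \<theta>) * b - b0 * model_symbol \<alpha> \<beta> \<theta>0 \<theta> =
     of_real ?\<rho> powr (- (2 * \<alpha>)) * (b * exp (\<i> * \<beta> * of_real y) -
          b0 * (weight_plus \<alpha> \<beta> * exp (- (\<i> * \<alpha> * of_real y)) + weight_minus \<alpha> \<beta> * exp (\<i> * \<alpha> * of_real y)))"
    unfolding model_symbol_def branch_polar[OF assms(1), folded y_def] symbol_sigma_def phi_def y_def[symmetric]
    by (simp add: algebra_simps)
  moreover have "cmod (of_real ?\<rho> powr (- (2 * \<alpha>))) = singular_weight (2 * Re \<alpha>) \<theta>0 \<theta>"
    by (subst cmod_of_real_powr) (simp_all add: singular_weight_def)
  ultimately show ?thesis by (simp only: norm_mult)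
qed

lemma Arg_measurable: "Arg \<in> borel_measurable borel"
proof -
  have "(\<lambda>w. if w = 0 then 0 else Im (Ln w)) \<in> borel_measurable borel" by measurable
  also have "(\<lambda>w. if w = 0 then 0 else Im (Ln w)) = Arg"
    by (auto simp: fun_eq_iff Arg_eq_Im_Ln Arg_zero)
  finally show ?thesis .
qed

lemma symbol_sigma_measurable: "(\<lambda>\<theta>. symbol_sigma \<alpha> \<beta> t0 (cis \<theta>)) \<in> borel_measurable borel"
proof -
  have "cis \<in> borel_measurable borel"
    by (intro borel_measurable_continuous_onI continuous_intros)
  note [measurable] = this Arg_measurable
  show ?thesis unfolding symbol_sigma_def phi_def by measurable
qed

section \<open>The norm asymptotics\<close>

lemma toeplitz_norm_fourier: "spectral_norm (toeplitz n a) = toeplitz_norm (fourier_coeff a) n"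
  by (simp add: toeplitz_norm_def toeplitz_def)

lemma fourier_coeff_cis:
  "fourier_coeff a k = 1 / (2 * of_real pi) * (LINT \<theta>|circle_M. a (cis \<theta>) * cis (- of_int k * \<theta>))"
  by (simp add: fourier_coeff_def cis_conv_exp mult.assoc)

lemma symbol_minus_model_bounded:
  assumes b: "Linfinity_circle b"
  shows "\<exists>M. AE \<theta> in circle_M. cmod (symbol_sigma \<alpha> \<beta> (cis \<theta>0) (cis \<theta>) * b (cis \<theta>) -
      b0 * model_symbol \<alpha> \<beta> \<theta>0 \<theta>) \<le> M * singular_weight (2 * Re \<alpha>) \<theta>0 \<theta>"
proof -
  from b obtain C where C: "AE \<theta> in circle_M. cmod (b (cis \<theta>)) \<le> C"
    by (auto simp: Linfinity_circle_def)
  define E where "E = exp (pi * \<bar>Im \<beta>\<bar>)"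
  define A where "A = exp (pi * \<bar>Im \<alpha>\<bar>)"
  define M where "M = C * E + cmod b0 * (cmod (weight_plus \<alpha> \<beta>) * A + cmod (weight_minus \<alpha> \<beta>) * A)"
  have "AE \<theta> in circle_M. cmod (symbol_sigma \<alpha> \<beta> (cis \<theta>0) (cis \<theta>) * b (cis \<theta>) -
      b0 * model_symbol \<alpha> \<beta> \<theta>0 \<theta>) \<le> M * singular_weight (2 * Re \<alpha>) \<theta>0 \<theta>"
    using C AE_cis_ne[of \<theta>0]
  proof eventually_elim
    case (elim \<theta>)
    define y where "y = Arg (- cis \<theta> / cis \<theta>0)"
    have y: "\<bar>y\<bar> \<le> pi" using polar_unit_distance(1)[OF elim(2)] by (simp add: y_def)
    let ?F = "exp (\<i> * \<beta> * of_real y)"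
    let ?P = "exp (- (\<i> * \<alpha> * of_real y))" and ?Q = "exp (\<i> * \<alpha> * of_real y)"
    have "cmod (b (cis \<theta>) * ?F - b0 * (weight_plus \<alpha> \<beta> * ?P + weight_minus \<alpha> \<beta> * ?Q)) \<le>
       cmod (b (cis \<theta>)) * cmod ?F + cmod b0 * (cmod (weight_plus \<alpha> \<beta>) * cmod ?P + cmod (weight_minus \<alpha> \<beta>) * cmod ?Q)"
      unfolding norm_mult[symmetric]
      by (rule order_trans[OF norm_triangle_ineq4])
         (simp add: norm_mult mult_left_mono norm_triangle_le)
    also have "\<dots> \<le> M"
      unfolding M_def E_def A_def using elim(1) order_trans[OF norm_ge_zero elim(1)]
      by (intro add_mono mult_mono mult_left_mono cmod_exp_i_le y) auto
    finally have "cmod (b (cis \<theta>) * ?F - b0 * (weight_plus \<alpha> \<beta> * ?P + weight_minus \<alpha> \<beta> * ?Q)) \<le> M" .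
    from mult_left_mono[OF this singular_weight_nonneg[of "2 * Re \<alpha>" \<theta>0 \<theta>]]
    show ?case unfolding symbol_polar[OF elim(2)] y_def[symmetric] by (simp only: mult.commute)
  qed
  then show ?thesis by blast
qed

text \<open>
  Here the choice of the weights enters: relative to the weight, the difference of the symbols is
  \<open>b F - b0 G\<close> with continuous functions \<open>F\<close> and \<open>G\<close> of the argument \<open>y\<close> that agree at
  \<open>y = pi\<close> and \<open>y = -pi\<close>.
\<close>

lemma symbol_minus_model_small_locally:
  assumes \<alpha>: "0 < Re \<alpha>" "Re \<alpha> < 1 / 2"
    and b: "continuous (at (cis \<theta>0) within sphere 0 1) b" and \<epsilon>: "0 < \<epsilon>"
  shows "\<exists>\<delta>>0. AE \<theta> in circle_M. cmod (cis \<theta> - cis \<theta>0) < \<delta> \<longrightarrow>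
      cmod (symbol_sigma \<alpha> \<beta> (cis \<theta>0) (cis \<theta>) * b (cis \<theta>) - b (cis \<theta>0) * model_symbol \<alpha> \<beta> \<theta>0 \<theta>)
        \<le> \<epsilon> * singular_weight (2 * Re \<alpha>) \<theta>0 \<theta>"
proof -
  define E where "E = exp (pi * \<bar>Im \<beta>\<bar>)"
  have E: "0 < E" by (simp add: E_def)
  let ?b0 = "b (cis \<theta>0)"
  let ?G = "\<lambda>y. weight_plus \<alpha> \<beta> * exp (- (\<i> * \<alpha> * of_real y)) + weight_minus \<alpha> \<beta> * exp (\<i> * \<alpha> * of_real y)"
  let ?F = "\<lambda>y. exp (\<i> * \<beta> * of_real y)"
  have "0 < \<epsilon> / (2 * E)" using \<epsilon> E by simp
  then obtain \<delta>1 where \<delta>1: "\<delta>1 > 0" "\<And>t. t \<in> sphere 0 1 \<Longrightarrow> dist t (cis \<theta>0) < \<delta>1 \<Longrightarrow> dist (b t) ?b0 < \<epsilon> / (2 * E)"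
    using b unfolding continuous_within_eps_delta by blast
  have pos: "0 < \<epsilon> / (2 * (cmod ?b0 + 1))" using \<epsilon> by (simp add: add_nonneg_pos)
  have "\<exists>\<delta>>0. \<forall>y. \<bar>y\<bar> \<le> pi \<and> 2 * cos (y / 2) < \<delta> \<longrightarrow> cmod (?F y - ?G y) < \<epsilon> / (2 * (cmod ?b0 + 1))"
  proof (rule continuous_vanishing_at_pi[OF _ _ _ pos])
    show "continuous_on UNIV (\<lambda>y. ?F y - ?G y)" by (intro continuous_intros)
    show "?F pi - ?G pi = 0" using weights_match(1)[OF \<alpha>, of \<beta>] by simp
    show "?F (- pi) - ?G (- pi) = 0" using weights_match(2)[OF \<alpha>, of \<beta>] by simp
  qed
  then obtain \<delta>2 where \<delta>2: "\<delta>2 > 0"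
    "\<And>y. \<bar>y\<bar> \<le> pi \<Longrightarrow> 2 * cos (y / 2) < \<delta>2 \<Longrightarrow> cmod (?F y - ?G y) < \<epsilon> / (2 * (cmod ?b0 + 1))" by blast
  have "AE \<theta> in circle_M. cmod (cis \<theta> - cis \<theta>0) < min \<delta>1 \<delta>2 \<longrightarrow>
      cmod (symbol_sigma \<alpha> \<beta> (cis \<theta>0) (cis \<theta>) * b (cis \<theta>) - ?b0 * model_symbol \<alpha> \<beta> \<theta>0 \<theta>)
        \<le> \<epsilon> * singular_weight (2 * Re \<alpha>) \<theta>0 \<theta>"
    using AE_cis_ne[of \<theta>0]
  proof eventually_elim
    fix \<theta> assume ne: "cis \<theta> \<noteq> cis \<theta>0"
    let ?g = "symbol_sigma \<alpha> \<beta> (cis \<theta>0) (cis \<theta>) * b (cis \<theta>) - ?b0 * model_symbol \<alpha> \<beta> \<theta>0 \<theta>"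
    define y where "y = Arg (- cis \<theta> / cis \<theta>0)"
    note P = polar_unit_distance[OF ne, folded y_def]
    have "cmod ?g \<le> \<epsilon> * singular_weight (2 * Re \<alpha>) \<theta>0 \<theta>" if near: "cmod (cis \<theta> - cis \<theta>0) < min \<delta>1 \<delta>2"
    proof -
      have y: "\<bar>y\<bar> \<le> pi" using P(1) by simp
      have h: "cmod (?F y - ?G y) \<le> \<epsilon> / (2 * (cmod ?b0 + 1))"
        using \<delta>2(2)[OF y] P(3) near by simp
      have bt: "cmod (b (cis \<theta>) - ?b0) \<le> \<epsilon> / (2 * E)"
        using \<delta>1(2)[of "cis \<theta>"] near by (simp add: dist_norm)
      have "b (cis \<theta>) * ?F y - ?b0 * ?G y = (b (cis \<theta>) - ?b0) * ?F y + ?b0 * (?F y - ?G y)"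
        by (simp add: algebra_simps)
      also have "cmod \<dots> \<le> cmod (b (cis \<theta>) - ?b0) * cmod (?F y) + cmod ?b0 * cmod (?F y - ?G y)"
        by (rule order_trans[OF norm_triangle_ineq]) (simp add: norm_mult)
      also have "\<dots> \<le> \<epsilon> / (2 * E) * E + (cmod ?b0 + 1) * (\<epsilon> / (2 * (cmod ?b0 + 1)))"
        unfolding E_def using \<epsilon>
        by (intro add_mono mult_mono bt[unfolded E_def] cmod_exp_i_le(1) y h) auto
      also have "\<dots> = \<epsilon>"
      proof -
        have "cmod ?b0 + 1 \<noteq> 0" using norm_ge_zero[of ?b0] by linarith
        moreover have "u * (\<epsilon> / (2 * u)) = \<epsilon> / 2" if "u \<noteq> 0" for u :: real using that by simp
        ultimately have "(cmod ?b0 + 1) * (\<epsilon> / (2 * (cmod ?b0 + 1))) = \<epsilon> / 2" by blast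
        moreover have "\<epsilon> / (2 * E) * E = \<epsilon> / 2" using E by simp
        ultimately show ?thesis by (simp only: field_sum_of_halves)
      qed
      finally have "cmod (b (cis \<theta>) * ?F y - ?b0 * ?G y) \<le> \<epsilon>" .
      from mult_left_mono[OF this singular_weight_nonneg[of "2 * Re \<alpha>" \<theta>0 \<theta>]]
      show ?thesis unfolding symbol_polar[OF ne] y_def[symmetric] by (simp only: mult.commute)
    qed
    then show "cmod (cis \<theta> - cis \<theta>0) < min \<delta>1 \<delta>2 \<longrightarrow> cmod ?g \<le> \<epsilon> * singular_weight (2 * Re \<alpha>) \<theta>0 \<theta>" ..
  qed
  then show ?thesis using \<delta>1(1) \<delta>2(1) by (intro exI[of _ "min \<delta>1 \<delta>2"]) simp
qed

theorem theorem3p3: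
  fixes \<alpha> \<beta> t0 :: complex and a b :: "complex \<Rightarrow> complex"
  assumes "t0 \<in> sphere 0 1"
    and "0 < Re \<alpha>" and "Re \<alpha> < 1 / 2"
    and "- 1 / 2 < Re \<beta>" and "Re \<beta> \<le> 1 / 2"
    and "Linfinity_circle b"
    and "continuous (at t0 within sphere 0 1) b"
    and "b t0 \<noteq> 0"
    and "\<And>t. t \<in> sphere 0 1 \<Longrightarrow> a t = symbol_sigma \<alpha> \<beta> t0 t * b t"
  shows "(\<lambda>n. spectral_norm (toeplitz n a) /
            (L2_operator_norm (integral_operator (kernel_k \<alpha> \<beta>)) * cmod (b t0) *
              real n powr (2 * Re \<alpha>))) \<longlonglongrightarrow> 1"
proof -
  note \<alpha> = assms(2,3)
  define \<theta>0 where "\<theta>0 = Arg t0"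
  have t0: "t0 = cis \<theta>0"
    using cis_Arg[of t0] assms(1) by (cases "t0 = 0") (simp_all add: \<theta>0_def sgn_div_norm)
  have \<theta>0: "\<bar>\<theta>0\<bar> \<le> pi" using Arg_bounded[of t0] by (simp add: \<theta>0_def abs_le_iff)
  let ?q = "2 * Re \<alpha>"
  have q: "0 < ?q" "?q < 1" using \<alpha> by auto
  have z: "0 < Re (2 * \<alpha>)" "Re (2 * \<alpha>) < 1" using \<alpha> by auto
  let ?K = "integral_operator (kernel_k \<alpha> \<beta>)"
  define s where "s = model_coeff \<alpha> \<beta>"
  define m where "m = (\<lambda>j. b t0 * (cis (of_int j * (- \<theta>0)) * s j))"
  define g where "g = (\<lambda>\<theta>. a (cis \<theta>) - b t0 * model_symbol \<alpha> \<beta> \<theta>0 \<theta>)"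
  define c where "c = (\<lambda>j. 1 / (2 * of_real pi) * (LINT \<theta>|circle_M. g \<theta> * cis (- of_int j * \<theta>)))"
  have a: "a (cis \<theta>) = symbol_sigma \<alpha> \<beta> (cis \<theta>0) (cis \<theta>) * b (cis \<theta>)" for \<theta>
    using assms(9)[of "cis \<theta>"] by (simp add: t0)
  note model = model_symbol_coeff[OF \<alpha> \<theta>0, of \<beta>]
  have g_meas: "g \<in> borel_measurable circle_M"
  proof -
    have "(\<lambda>\<theta>. b (cis \<theta>)) \<in> borel_measurable circle_M"
      using assms(6) by (simp add: Linfinity_circle_def)
    then show ?thesis
      unfolding g_def a
      by (intro borel_measurable_diff borel_measurable_times borel_measurable_const
          borel_measurable_lebesgue_on_borel[OF symbol_sigma_measurable]
          borel_measurable_integrable[OF model(1)])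
  qed
  obtain M where M: "AE \<theta> in circle_M. cmod (g \<theta>) \<le> M * singular_weight ?q \<theta>0 \<theta>"
    using symbol_minus_model_bounded[OF assms(6), of \<alpha> \<beta> \<theta>0 "b t0"] unfolding g_def a by blast
  have local: "\<exists>\<delta>>0. AE \<theta> in circle_M. cmod (cis \<theta> - cis \<theta>0) < \<delta> \<longrightarrow>
      cmod (g \<theta>) \<le> \<epsilon> * singular_weight ?q \<theta>0 \<theta>" if "0 < \<epsilon>" for \<epsilon>
    using symbol_minus_model_small_locally[OF \<alpha> assms(7)[unfolded t0] that, of \<beta>] unfolding g_def a t0 .
  have small: "(\<lambda>n. toeplitz_norm c n / real n powr ?q) \<longlonglongrightarrow> 0"
    by (rule toeplitz_norm_small_o[OF q \<theta>0 g_meas M local]) (simp_all add: c_def)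
  have g_int: "integrable circle_M g"
  proof (rule Bochner_Integration.integrable_bound)
    show "integrable circle_M (\<lambda>\<theta>. M * singular_weight ?q \<theta>0 \<theta>)"
      by (intro integrable_mult_right integrable_singular_weight q \<theta>0)
    show "AE \<theta> in circle_M. norm (g \<theta>) \<le> norm (M * singular_weight ?q \<theta>0 \<theta>)"
      using M by eventually_elim (simp add: order_trans[OF _ abs_ge_self])
  qed (rule g_meas)
  have coeff: "fourier_coeff a j = m j + c j" for j
  proof -
    have "(LINT \<theta>|circle_M. a (cis \<theta>) * cis (- of_int j * \<theta>)) =
        (LINT \<theta>|circle_M. b t0 * (model_symbol \<alpha> \<beta> \<theta>0 \<theta> * cis (- of_int j * \<theta>)) + g \<theta> * cis (- of_int j * \<theta>))"
      by (simp add: g_def algebra_simps)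
    also have "\<dots> = b t0 * (LINT \<theta>|circle_M. model_symbol \<alpha> \<beta> \<theta>0 \<theta> * cis (- of_int j * \<theta>)) +
        (LINT \<theta>|circle_M. g \<theta> * cis (- of_int j * \<theta>))"
      by (subst Bochner_Integration.integral_add)
         (intro integrable_mult_right integrable_mult_cis model(1) g_int | simp only: integral_mult_right_zero)+
    finally have "fourier_coeff a j = b t0 * (1 / (2 * of_real pi) *
        (LINT \<theta>|circle_M. model_symbol \<alpha> \<beta> \<theta>0 \<theta> * cis (- of_int j * \<theta>))) + c j"
      unfolding fourier_coeff_cis c_def by (simp only: distrib_left ac_simps)
    then show ?thesis unfolding model(2) m_def s_def .
  qed
  have norm_m: "toeplitz_norm m n = cmod (b t0) * toeplitz_norm s n" for n
    unfolding m_def toeplitz_norm_scale toeplitz_norm_modulate ..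
  have diff: "\<bar>toeplitz_norm (fourier_coeff a) n - cmod (b t0) * toeplitz_norm s n\<bar> \<le> toeplitz_norm c n" for n
  proof -
    have "toeplitz_norm (\<lambda>j. m j + c j) n \<le> toeplitz_norm m n + toeplitz_norm c n"
      by (rule toeplitz_norm_add_le)
    moreover have "toeplitz_norm (\<lambda>j. (m j + c j) + (-1) * c j) n \<le>
        toeplitz_norm (\<lambda>j. m j + c j) n + toeplitz_norm (\<lambda>j. (-1) * c j) n"
      by (rule toeplitz_norm_add_le)
    moreover have "toeplitz_norm (\<lambda>j. (-1) * c j) n = toeplitz_norm c n"
      unfolding toeplitz_norm_scale by simp
    moreover have "fourier_coeff a = (\<lambda>j. m j + c j)" using coeff by blast
    ultimately show ?thesis unfolding norm_m[symmetric] by simp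
  qed
  have lim_s: "(\<lambda>n. toeplitz_norm s n / real n powr ?q) \<longlonglongrightarrow> L2_operator_norm ?K"
    using toeplitz_norm_tendsto_operator_norm[OF z model_coeff_asymp[OF \<alpha>, of \<beta>]]
    by (simp add: s_def kernel_k_eq_conv_kernel)
  have "(\<lambda>n. toeplitz_norm (fourier_coeff a) n / real n powr ?q - cmod (b t0) * (toeplitz_norm s n / real n powr ?q)) \<longlonglongrightarrow> 0"
  proof (rule Lim_null_comparison[OF _ small])
    show "eventually (\<lambda>n. norm (toeplitz_norm (fourier_coeff a) n / real n powr ?q - cmod (b t0) * (toeplitz_norm s n / real n powr ?q))
        \<le> toeplitz_norm c n / real n powr ?q) sequentially"
    proof (rule always_eventually, rule allI)
      fix n
      have "norm (toeplitz_norm (fourier_coeff a) n / real n powr ?q - cmod (b t0) * (toeplitz_norm s n / real n powr ?q))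
        = \<bar>toeplitz_norm (fourier_coeff a) n - cmod (b t0) * toeplitz_norm s n\<bar> / real n powr ?q"
        by (simp add: diff_divide_distrib[symmetric])
      also have "\<dots> \<le> toeplitz_norm c n / real n powr ?q" by (intro divide_right_mono diff) simp
      finally show "norm (toeplitz_norm (fourier_coeff a) n / real n powr ?q - cmod (b t0) * (toeplitz_norm s n / real n powr ?q))
        \<le> toeplitz_norm c n / real n powr ?q" .
    qed
  qed
  from tendsto_add[OF this tendsto_mult[OF tendsto_const[of "cmod (b t0)"] lim_s]]
  have lim: "(\<lambda>n. toeplitz_norm (fourier_coeff a) n / real n powr ?q) \<longlonglongrightarrow> cmod (b t0) * L2_operator_norm ?K"
    by simp
  have "L2_operator_norm ?K > 0"
    unfolding kernel_k_eq_conv_kernel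
    by (rule conv_operator_norm_pos[OF z(1) C_plus_or_C_minus_nonzero[OF \<alpha>]])
  then have pos: "L2_operator_norm ?K * cmod (b t0) \<noteq> 0" using assms(8) by simp
  from tendsto_divide[OF lim tendsto_const pos]
  have "(\<lambda>n. toeplitz_norm (fourier_coeff a) n / real n powr ?q / (L2_operator_norm ?K * cmod (b t0))) \<longlonglongrightarrow> 1"
    using pos by (simp add: mult.commute)
  then show ?thesis
    unfolding toeplitz_norm_fourier by (simp add: divide_divide_eq_left ac_simps)
qed

end
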